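(* Let $G$ be a countably infinite sofic group with a fixed sofic approximation, $A$ a finite set with $|A|\geq 2$, $\varphi:A^G\to\mathbb{R}$ a potential, and suppose $\mu$ is the unique Gibbs measure for $\varphi$. Let $\alpha$ be the canonical alphabet partition of $A^G$. Then the sofic entropy of the shift action on $(A^G,\mu)$ satisfies $$h(\mu)\ \geq\ \mathbb{E}_{\xi}\,H\big(\alpha\mid\widetilde{\alpha^{L_\xi}}\big).$$
   Context: Shift action: $(gx)(h)=x(hg)$ for $x\in A^G$, $g,h\in G$. A potential is a function $\varphi:A^G\to\mathbb{R}$ for which there is a finite $D\subset G$ such that $\varphi(x)$ depends only on $x|_D$. For finite $\Lambda\subset G$ and $x\in A^G$ let $\pi_\Lambda(x)$ be the probability measure supported on the set of $y\in A^G$ agreeing with $x$ on $G\setminus\Lambda$, giving such $y$ mass proportional to $\exp(-\sum_{g:\,Dg\cap\Lambda\ne\varnothing}\varphi(gy))$; for a Borel probability measure $\nu$ put $\bar\pi_\Lambda(\nu)=\int\pi_\Lambda(x)\,d\nu(x)$. A Borel probability measure $\nu$ on $A^G$ is a Gibbs measure for $\varphi$ if $\bar\pi_\Lambda(\nu)=\nu$ for all finite $\Lambda\subset G$. Partitions: $\alpha=\{B_a:a\in A\}$, $B_a=\{x:x(e)=a\}$ ($e$ the identity); $\alpha^g=\{g^{-1}(B):B\in\alpha\}$; for $F\subset G$, $\alpha^F=\bigvee_{g\in F}\alpha^g$ (the $\sigma$-subalgebra generated by the coordinates in $F$). For a $\sigma$-subalgebra $\mathscr{A}$ its saturation is $\widetilde{\mathscr{A}}=\bigcap_{F\subset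 G\text{ finite}}(\mathscr{A}\vee\alpha^{G\setminus F})$, where $\vee$ denotes the generated $\sigma$-algebra and intersections are of $\mu$-completions. $H$ is Shannon entropy (natural log) and $H(\alpha\mid\mathscr{A})=\inf_\beta(H(\alpha\vee\beta)-H(\beta))$, over $\mathscr{A}$-measurable partitions $\beta$ of finite entropy, is conditional entropy with respect to $\mu$. $(\xi_g)_{g\in G}$ are i.i.d. uniform on $[0,1]$ and $L_\xi=\{g\in G:\xi_g<\xi_e\}$. Sofic approximation of $G$: finite sets $V_i$ and maps $\sigma_i:G\to\mathrm{Sym}(V_i)$, $g\mapsto\sigma_i^g$, $i\in\mathbb{N}$, such that, with $d_H$ the normalized Hamming distance, $d_H(\sigma_i^{g_1},\sigma_i^{g_2})\to1$ for $g_1\neq g_2$ and $d_H(\sigma_i^{g_1}\circ\sigma_i^{g_2},\sigma_i^{g_1g_2})\to0$ for all $g_1,g_2$. $G$ is sofic if one exists. For $v\in V_i$, $\theta_v:A^{V_i}\to A^G$ is $(\theta_v(\tau))(g)=\tau(\sigma_i^g(v))$. Let $l$ be a metric for the weak* topology on probability measures on $A^G$, and $\mathrm{Hom}(i,\varepsilon)$ the set of $\tau\in A^{V_i}$ with $l(\frac1{|V_i|}\sum_{v\in V_i}\delta_{\theta_v(\tau)},\mu)<\varepsilon$. Sofic entropy: $h(\mu)=\inf_{\varepsilon>0}\limsup_{i\to\infty}\frac{\log|\mathrm{Hom}(i,\varepsilon)|}{|V_i|}$. *)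

theory Defs
  imports "HOL-Probability.Probability" "HOL-Combinatorics.Permutations"
begin

text \<open>
  The group \<open>G\<close> is a type of class \<open>group_add\<close>, which does not assume commutativity: the
  product \<open>gh\<close> is written \<open>g + h\<close> and the identity \<open>0\<close>.
  The alphabet is a finite type with the discrete topology, so that \<open>borel\<close> and
  \<open>continuous_on UNIV\<close> on configurations \<open>'g \<Rightarrow> 'a\<close> refer to the product topology on \<open>A\<^sup>G\<close>.
\<close>

definition shift :: "'g::group_add \<Rightarrow> ('g \<Rightarrow> 'a) \<Rightarrow> 'g \<Rightarrow> 'a" where
  "shift g x = (\<lambda>h. x (h + g))"


section \<open>Gibbs measures\<close>

definition potential_with_window :: "(('g \<Rightarrow> 'a) \<Rightarrow> real) \<Rightarrow> 'g set \<Rightarrow> bool" where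
  "potential_with_window \<phi> D \<longleftrightarrow>
     finite D \<and> (\<forall>x y. (\<forall>d\<in>D. x d = y d) \<longrightarrow> \<phi> x = \<phi> y)"

definition boltzmann_weight ::
  "(('g::group_add \<Rightarrow> 'a) \<Rightarrow> real) \<Rightarrow> 'g set \<Rightarrow> 'g set \<Rightarrow> ('g \<Rightarrow> 'a) \<Rightarrow> real" where
  "boltzmann_weight \<phi> D \<Lambda> y =
     exp (- (\<Sum>g\<in>{g. (\<lambda>d. d + g) ` D \<inter> \<Lambda> \<noteq> {}}. \<phi> (shift g y)))"

definition agreeing_off :: "'g set \<Rightarrow> ('g \<Rightarrow> 'a) \<Rightarrow> ('g \<Rightarrow> 'a) set" where
  "agreeing_off \<Lambda> x = {y. \<forall>g. g \<notin> \<Lambda> \<longrightarrow> y g = x g}"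

text \<open>The pushforward along the identity only replaces the power set of the finite support by
  the Borel sets of \<open>A\<^sup>G\<close>.\<close>

definition gibbs_kernel ::
  "(('g::group_add \<Rightarrow> 'a::{finite,discrete_topology}) \<Rightarrow> real) \<Rightarrow> 'g set \<Rightarrow> 'g set
     \<Rightarrow> ('g \<Rightarrow> 'a) \<Rightarrow> ('g \<Rightarrow> 'a) measure" where
  "gibbs_kernel \<phi> D \<Lambda> x =
     distr
       (point_measure (agreeing_off \<Lambda> x)
         (\<lambda>y. ennreal (boltzmann_weight \<phi> D \<Lambda> y
                / (\<Sum>z\<in>agreeing_off \<Lambda> x. boltzmann_weight \<phi> D \<Lambda> z))))
       borel (\<lambda>y. y)"

text \<open>The average \<open>\<integral> \<pi>\<^sub>\<Lambda>(x) d\<nu>(x)\<close> of measures is the monadic bind of the Giry monad.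
  The kernel does not depend on which window \<open>D\<close> of \<open>\<phi>\<close> is used: enlarging \<open>D\<close> only adds terms
  to the exponent that are constant on \<open>agreeing_off \<Lambda> x\<close>.\<close>

definition gibbs_measure ::
  "(('g::group_add \<Rightarrow> 'a::{finite,discrete_topology}) \<Rightarrow> real) \<Rightarrow> 'g set
     \<Rightarrow> ('g \<Rightarrow> 'a) measure \<Rightarrow> bool" where
  "gibbs_measure \<phi> D \<nu> \<longleftrightarrow>
     \<nu> \<in> space (prob_algebra borel) \<and>
     (\<forall>\<Lambda>. finite \<Lambda> \<longrightarrow> bind \<nu> (gibbs_kernel \<phi> D \<Lambda>) = \<nu>)"


section \<open>Partitions, saturation and conditional entropy\<close>

definition alphabet_partition :: "('g::group_add \<Rightarrow> 'a) set set" where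
  "alphabet_partition = range (\<lambda>a. {x. x 0 = a})"

definition translated_partition ::
  "('g::group_add \<Rightarrow> 'a) set set \<Rightarrow> 'g \<Rightarrow> ('g \<Rightarrow> 'a) set set" where
  "translated_partition \<beta> g = (\<lambda>B. shift g -` B) ` \<beta>"

definition coordinate_algebra :: "'g::group_add set \<Rightarrow> ('g \<Rightarrow> 'a) set set" where
  "coordinate_algebra F = sigma_sets UNIV (\<Union>g\<in>F. translated_partition alphabet_partition g)"

definition sigma_join :: "'x set set \<Rightarrow> 'x set set \<Rightarrow> 'x set set" where
  "sigma_join \<A> \<B> = sigma_sets UNIV (\<A> \<union> \<B>)"

text \<open>The completion of a sub-\<open>\<sigma>\<close>-algebra adjoins all subsets of \<open>\<mu>\<close>-null sets.\<close>

definition completed_algebra :: "'x measure \<Rightarrow> 'x set set \<Rightarrow> 'x set set" where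
  "completed_algebra \<mu> \<A> = sigma_join \<A> (null_sets (completion \<mu>))"

definition saturation ::
  "('g::group_add \<Rightarrow> 'a) measure \<Rightarrow> ('g \<Rightarrow> 'a) set set \<Rightarrow> ('g \<Rightarrow> 'a) set set" where
  "saturation \<mu> \<A> =
     (\<Inter>F\<in>{F. finite F}. completed_algebra \<mu> (sigma_join \<A> (coordinate_algebra (UNIV - F))))"

definition partition_join :: "'x set set \<Rightarrow> 'x set set \<Rightarrow> 'x set set" where
  "partition_join \<beta> \<gamma> = {B \<inter> C | B C. B \<in> \<beta> \<and> C \<in> \<gamma>} - {{}}"

text \<open>Measures are taken in the completion of \<open>\<mu>\<close>, since members of a saturation need only be
  measurable up to null sets. Null cells contribute \<open>0\<close>.\<close>

definition entropy_term :: "'x measure \<Rightarrow> 'x set \<Rightarrow> real" where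
  "entropy_term \<mu> B = - measure (completion \<mu>) B * ln (measure (completion \<mu>) B)"

definition partition_entropy :: "'x measure \<Rightarrow> 'x set set \<Rightarrow> real" where
  "partition_entropy \<mu> \<beta> = infsum (entropy_term \<mu>) \<beta>"

definition finite_entropy_partitions :: "'x measure \<Rightarrow> 'x set set \<Rightarrow> 'x set set set" where
  "finite_entropy_partitions \<mu> \<A> =
     {\<beta>. partition_on UNIV \<beta> \<and> countable \<beta> \<and> \<beta> \<subseteq> \<A> \<and> entropy_term \<mu> summable_on \<beta>}"

definition cond_partition_entropy :: "'x measure \<Rightarrow> 'x set set \<Rightarrow> 'x set set \<Rightarrow> real" where
  "cond_partition_entropy \<mu> \<alpha> \<A> =
     (INF \<beta>\<in>finite_entropy_partitions \<mu> \<A>.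
        partition_entropy \<mu> (partition_join \<alpha> \<beta>) - partition_entropy \<mu> \<beta>)"


section \<open>Sofic approximations and sofic entropy\<close>

definition normalized_hamming :: "'v set \<Rightarrow> ('v \<Rightarrow> 'v) \<Rightarrow> ('v \<Rightarrow> 'v) \<Rightarrow> real" where
  "normalized_hamming V p q = real (card {v\<in>V. p v \<noteq> q v}) / real (card V)"

definition sofic_approximation ::
  "(nat \<Rightarrow> 'v set) \<Rightarrow> (nat \<Rightarrow> 'g::group_add \<Rightarrow> 'v \<Rightarrow> 'v) \<Rightarrow> bool" where
  "sofic_approximation V \<sigma> \<longleftrightarrow>
     (\<forall>i. finite (V i) \<and> V i \<noteq> {}) \<and>
     (\<forall>i g. \<sigma> i g permutes V i) \<and>
     (\<forall>g h. g \<noteq> h \<longrightarrow>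
        (\<lambda>i. normalized_hamming (V i) (\<sigma> i g) (\<sigma> i h)) \<longlonglongrightarrow> 1) \<and>
     (\<forall>g h. (\<lambda>i. normalized_hamming (V i) (\<sigma> i g \<circ> \<sigma> i h) (\<sigma> i (g + h))) \<longlonglongrightarrow> 0)"

definition weak_star_topology :: "'x::topological_space measure topology" where
  "weak_star_topology =
     topology_generated_by
       {{\<nu> \<in> space (prob_algebra borel). (\<integral>x. f x \<partial>\<nu>) \<in> U} | (f :: 'x \<Rightarrow> real) U.
          continuous_on UNIV f \<and> open U}"

definition weak_star_metric ::
  "('x::topological_space measure \<Rightarrow> 'x measure \<Rightarrow> real) \<Rightarrow> bool" where
  "weak_star_metric l \<longleftrightarrow>
     Metric_space (space (prob_algebra borel)) l \<and>
     Metric_space.mtopology (space (prob_algebra borel)) l = weak_star_topology"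

definition pullback_name :: "('g \<Rightarrow> 'v \<Rightarrow> 'v) \<Rightarrow> ('v \<Rightarrow> 'a) \<Rightarrow> 'v \<Rightarrow> 'g \<Rightarrow> 'a" where
  "pullback_name s \<tau> v = (\<lambda>g. \<tau> (s g v))"

text \<open>The average of the point masses at \<open>\<theta>\<^sub>v(\<tau>)\<close> is the law of \<open>\<theta>\<^sub>v(\<tau>)\<close> for uniformly random
  \<open>v \<in> V\<close>.\<close>

definition empirical_measure ::
  "'v set \<Rightarrow> ('g \<Rightarrow> 'v \<Rightarrow> 'v) \<Rightarrow> ('v \<Rightarrow> 'a::topological_space) \<Rightarrow> ('g \<Rightarrow> 'a) measure" where
  "empirical_measure V s \<tau> = distr (uniform_count_measure V) borel (pullback_name s \<tau>)"

definition good_models ::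
  "(('g \<Rightarrow> 'a::topological_space) measure \<Rightarrow> ('g \<Rightarrow> 'a) measure \<Rightarrow> real) \<Rightarrow> 'v set
     \<Rightarrow> ('g \<Rightarrow> 'v \<Rightarrow> 'v) \<Rightarrow> ('g \<Rightarrow> 'a) measure \<Rightarrow> real \<Rightarrow> ('v \<Rightarrow> 'a) set" where
  "good_models l V s \<mu> \<epsilon> = {\<tau> \<in> V \<rightarrow>\<^sub>E UNIV. l (empirical_measure V s \<tau>) \<mu> < \<epsilon>}"

text \<open>The library sets \<open>ln 0 = 0\<close>; here \<open>log 0 = -\<infinity>\<close> is needed.\<close>

definition ln_card :: "'x set \<Rightarrow> ereal" where
  "ln_card S = (if card S = 0 then -\<infinity> else ereal (ln (real (card S))))"

definition sofic_entropy ::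
  "(('g \<Rightarrow> 'a::topological_space) measure \<Rightarrow> ('g \<Rightarrow> 'a) measure \<Rightarrow> real) \<Rightarrow> (nat \<Rightarrow> 'v set)
     \<Rightarrow> (nat \<Rightarrow> 'g \<Rightarrow> 'v \<Rightarrow> 'v) \<Rightarrow> ('g \<Rightarrow> 'a) measure \<Rightarrow> ereal" where
  "sofic_entropy l V \<sigma> \<mu> =
     (INF \<epsilon>\<in>{0<..}. limsup (\<lambda>i. ln_card (good_models l (V i) (\<sigma> i) \<mu> \<epsilon>) / ereal (card (V i))))"

end

theory Submission
  imports Defs
begin

text \<open>
  Put on each finite model \<open>V i\<close> the Gibbs distribution with weight proportional to
  \<open>exp (- (\<Sum>v\<in>V i. \<phi> (\<theta>\<^sub>v \<tau>)))\<close>.  Near most vertices it has the same conditional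
  probabilities as the infinite-volume specification.  The sofic entropy of \<open>\<mu>\<close> is bounded below by
  the entropy rate of these distributions, and that rate by the entropy in the theorem.

  \<^bold>\<open>The typical configuration is a good model.\<close>  Since \<open>\<mu>\<close> is the only Gibbs measure, compactness
  makes the influence of boundary conditions decay uniformly
  (\<open>unique_gibbs_uniform_convergence\<close>).  Hence the values of a local function seen from two distant
  vertices are almost uncorrelated, empirical averages have small variance
  (\<open>empirical_avg_variance\<close>), and a random configuration lies in \<open>Hom(i, \<epsilon>)\<close> with probability tending
  to \<open>1\<close> (\<open>good_models_probable\<close>).  A distribution concentrated on a set has entropy at most about the
  logarithm of its cardinality (\<open>entropy_le_ln_card\<close>).

  \<^bold>\<open>The entropy rate is large.\<close>  Reveal the symbols of a finite model in a uniformly random order.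
  By the chain rule the entropy is the sum over \<open>v\<close> of the entropy of the symbol at \<open>v\<close> given the
  symbols revealed earlier.  Fix a finite \<open>F \<subseteq> G\<close> with the identity.  Additionally revealing everything
  outside the image of \<open>F\<close> around \<open>v\<close> only decreases this conditional entropy, and afterwards only a
  finite set \<open>\<Lambda> = F - L\<close> around \<open>v\<close> is unknown, where \<open>L\<close> is the set of \<open>g\<close> that precede the identity.
  The Gibbs property turns the result into the average of an explicit local function, \<open>origin_entropy \<Lambda>\<close>
  (\<open>entropy_increment_ge\<close>), whose empirical averages converge to its \<open>\<mu>\<close>-integral.  So for
  every such \<open>F\<close> the sofic entropy is at least the mean of \<open>\<integral> origin_entropy (F - L) d\<mu>\<close> over
  the random order (\<open>sofic_entropy_ge_window\<close>).

  \<^bold>\<open>Exhausting the group.\<close>  For fixed \<open>L\<close> and \<open>F\<close> increasing to \<open>G\<close>, the conditional probabilities of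
  the symbol at the identity given the coordinates outside \<open>F - L\<close> form a reverse martingale.  It is
  Cauchy in \<open>L\<^sup>2\<close>, and the limit is measurable for the saturation of the coordinates in \<open>L\<close>.  Rounding the
  limit gives finite partitions, which show that the saturated conditional entropy is at most the limit
  of the integrals above (\<open>cond_entropy_saturation_le_limit\<close>).  Dominated convergence over the random
  order finishes the proof.
\<close>

section \<open>Local functions and finite-volume averages\<close>

definition local_on :: "'g set \<Rightarrow> (('g \<Rightarrow> 'a) \<Rightarrow> 'b) \<Rightarrow> bool" where
  "local_on W f \<longleftrightarrow> (\<forall>x y. (\<forall>g\<in>W. x g = y g) \<longrightarrow> f x = f y)"

definition local_fun :: "(('g \<Rightarrow> 'a) \<Rightarrow> 'b) \<Rightarrow> bool" where
  "local_fun f \<longleftrightarrow> (\<exists>W. finite W \<and> local_on W f)"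

abbreviation patterns :: "'i set \<Rightarrow> ('i \<Rightarrow> 'a) set" where
  "patterns W \<equiv> W \<rightarrow>\<^sub>E UNIV"

lemma finite_patterns [simp]: "finite W \<Longrightarrow> finite (patterns W :: ('i \<Rightarrow> 'a::finite) set)"
  by (intro finite_PiE) auto

lemma patterns_nonempty [simp]: "patterns W \<noteq> {}"
  by (simp add: PiE_eq_empty_iff)

lemma restrict_patterns [simp]: "restrict x W \<in> patterns W"
  by auto

lemma patterns_eqI: "u \<in> patterns W \<Longrightarrow> w \<in> patterns W \<Longrightarrow> (\<And>g. g \<in> W \<Longrightarrow> u g = w g) \<Longrightarrow> u = w"
  by (rule PiE_ext)

lemma local_onD: "local_on W f \<Longrightarrow> (\<And>g. g \<in> W \<Longrightarrow> x g = y g) \<Longrightarrow> f x = f y"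
  unfolding local_on_def by blast

lemma local_onI: "(\<And>x y. (\<And>g. g \<in> W \<Longrightarrow> x g = y g) \<Longrightarrow> f x = f y) \<Longrightarrow> local_on W f"
  unfolding local_on_def by blast

lemma local_on_mono: "local_on W f \<Longrightarrow> W \<subseteq> W' \<Longrightarrow> local_on W' f"
  by (auto simp: local_on_def)

lemma local_on_comp: "local_on W f \<Longrightarrow> local_on W (\<lambda>x. h (f x))"
  unfolding local_on_def by metis

lemma local_on_comp2: "local_on W f \<Longrightarrow> local_on W f' \<Longrightarrow> local_on W (\<lambda>x. h (f x) (f' x))"
  unfolding local_on_def by metis

lemma local_funI: "finite W \<Longrightarrow> local_on W f \<Longrightarrow> local_fun f"
  by (auto simp: local_fun_def)

lemma local_funE: assumes "local_fun f" obtains W where "finite W" "local_on W f"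
  using assms by (auto simp: local_fun_def)

lemma local_fun_const [simp]: "local_fun (\<lambda>x. c)"
  by (rule local_funI[of "{}"]) (auto simp: local_on_def)

lemma local_fun_coordinate: "local_fun (\<lambda>x. h (x g))"
  by (rule local_funI[of "{g}"]) (auto simp: local_on_def)

lemma local_fun_comp: "local_fun f \<Longrightarrow> local_fun (\<lambda>x. h (f x))"
  by (metis local_fun_def local_on_comp)

lemma local_fun_comp2:
  assumes "local_fun f" "local_fun f'"
  shows "local_fun (\<lambda>x. h (f x) (f' x))"
proof -
  obtain W W' where W: "finite W" "local_on W f" "finite W'" "local_on W' f'"
    using assms by (auto simp: local_fun_def)
  have "local_on (W \<union> W') (\<lambda>x. h (f x) (f' x))"
    by (rule local_on_comp2[OF local_on_mono[OF W(2)] local_on_mono[OF W(4)]]) auto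
  with W show ?thesis by (intro local_funI[of "W \<union> W'"]) auto
qed

lemma local_fun_sum:
  assumes "finite I" "\<And>i. i \<in> I \<Longrightarrow> local_fun (f i)"
  shows "local_fun (\<lambda>x. \<Sum>i\<in>I. f i x :: real)"
  using assms
proof (induction rule: finite_induct)
  case (insert i I)
  then have "local_fun (f i)" "local_fun (\<lambda>x. \<Sum>i\<in>I. f i x)" by auto
  then have "local_fun (\<lambda>x. f i x + (\<Sum>i\<in>I. f i x))" by (rule local_fun_comp2)
  with insert show ?case by simp
qed simp

lemma local_on_restrict:
  assumes "local_on W f" shows "f x = f (restrict x W)"
  by (rule local_onD[OF assms]) auto

text \<open>This reduces integrals of local functions to measures of cylinders.\<close>

lemma local_on_sum_patterns:
  fixes f :: "('g \<Rightarrow> 'a::finite) \<Rightarrow> real"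
  assumes "finite W" "local_on W f"
  shows "f x = (\<Sum>u\<in>patterns W. f u * of_bool (restrict x W = u))"
proof -
  have "(\<Sum>u\<in>patterns W. f u * of_bool (restrict x W = u))
      = (\<Sum>u\<in>patterns W. if restrict x W = u then f (restrict x W) else 0)"
    by (intro sum.cong) auto
  also have "\<dots> = f (restrict x W)" using assms(1) by (simp add: sum.delta)
  finally show ?thesis using local_on_restrict[OF assms(2), of x] by simp
qed

lemma local_fun_bounded:
  fixes f :: "('g \<Rightarrow> 'a::finite) \<Rightarrow> real"
  assumes "local_fun f"
  obtains b where "b \<ge> 0" "\<And>x. \<bar>f x\<bar> \<le> b"
proof -
  obtain W where W: "finite W" "local_on W f" using assms by (rule local_funE)
  let ?b = "\<Sum>u\<in>patterns W. \<bar>f u\<bar>"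
  have "\<bar>f x\<bar> \<le> ?b" for x
    using local_on_restrict[OF W(2), of x] W(1)
    by (auto intro!: member_le_sum[of "restrict x W" _ "\<lambda>u. \<bar>f u\<bar>"])
  moreover have "?b \<ge> 0" by (intro sum_nonneg) auto
  ultimately show ?thesis using that by blast
qed

text \<open>Resampling a state within its class of an equivalence relation, according to the weight
  conditioned on that class, leaves the weight invariant.  Here the class of a state \<open>\<tau>\<close> is the set of
  all \<open>R w \<tau>\<close>, and \<open>c\<close> recovers the label \<open>w\<close>.  The proof exchanges the old and the new state: the map
  \<open>(\<tau>, w) \<mapsto> (R w \<tau>, c \<tau>)\<close> is an involution.\<close>

lemma sum_resampling:
  fixes m F :: "'o \<Rightarrow> real"
  assumes fin: "finite \<Omega>" "finite W"
    and R: "\<And>w \<tau>. w \<in> W \<Longrightarrow> \<tau> \<in> \<Omega> \<Longrightarrow> R w \<tau> \<in> \<Omega>"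
    and c: "\<And>\<tau>. \<tau> \<in> \<Omega> \<Longrightarrow> c \<tau> \<in> W"
    and cR: "\<And>w \<tau>. w \<in> W \<Longrightarrow> \<tau> \<in> \<Omega> \<Longrightarrow> c (R w \<tau>) = w"
    and RR: "\<And>w w' \<tau>. w \<in> W \<Longrightarrow> w' \<in> W \<Longrightarrow> \<tau> \<in> \<Omega> \<Longrightarrow> R w' (R w \<tau>) = R w' \<tau>"
    and Rc: "\<And>\<tau>. \<tau> \<in> \<Omega> \<Longrightarrow> R (c \<tau>) \<tau> = \<tau>"
    and pos: "\<And>\<tau>. \<tau> \<in> \<Omega> \<Longrightarrow> m \<tau> > 0"
  shows "(\<Sum>\<tau>\<in>\<Omega>. m \<tau> * (\<Sum>w\<in>W. m (R w \<tau>) / (\<Sum>w'\<in>W. m (R w' \<tau>)) * F (R w \<tau>)))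
       = (\<Sum>\<tau>\<in>\<Omega>. m \<tau> * F \<tau>)"
proof -
  define Z where "Z \<tau> = (\<Sum>w\<in>W. m (R w \<tau>))" for \<tau>
  have ZR: "Z (R w \<tau>) = Z \<tau>" if "w \<in> W" "\<tau> \<in> \<Omega>" for w \<tau>
    unfolding Z_def by (intro sum.cong) (auto simp: RR that)
  have Zpos: "Z \<tau> > 0" if "\<tau> \<in> \<Omega>" for \<tau>
    unfolding Z_def using c[OF that] by (intro sum_pos fin) (auto intro: pos R that)
  have "(\<Sum>\<tau>\<in>\<Omega>. m \<tau> * (\<Sum>w\<in>W. m (R w \<tau>) / Z \<tau> * F (R w \<tau>)))
      = (\<Sum>(\<tau>, w)\<in>\<Omega> \<times> W. m \<tau> * m (R w \<tau>) / Z \<tau> * F (R w \<tau>))"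
    by (simp add: sum.cartesian_product[symmetric] sum_distrib_left mult.assoc)
  also have "\<dots> = (\<Sum>(\<tau>, w)\<in>\<Omega> \<times> W. m (R w \<tau>) * m \<tau> / Z \<tau> * F \<tau>)"
    by (rule sum.reindex_bij_witness[of _ "\<lambda>(\<tau>, w). (R w \<tau>, c \<tau>)" "\<lambda>(\<tau>, w). (R w \<tau>, c \<tau>)"])
       (auto simp: cR RR Rc R c ZR)
  also have "\<dots> = (\<Sum>\<tau>\<in>\<Omega>. \<Sum>w\<in>W. m (R w \<tau>) * (m \<tau> / Z \<tau> * F \<tau>))"
    by (simp add: sum.cartesian_product[symmetric] mult.assoc)
  also have "\<dots> = (\<Sum>\<tau>\<in>\<Omega>. Z \<tau> * (m \<tau> / Z \<tau> * F \<tau>))"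
    by (simp only: Z_def sum_distrib_right)
  also have "\<dots> = (\<Sum>\<tau>\<in>\<Omega>. m \<tau> * F \<tau>)"
    using Zpos by (intro sum.cong) (auto simp: less_imp_neq[symmetric])
  finally show ?thesis by (simp add: Z_def)
qed

lemma override_on_override_on:
  "\<Lambda> \<subseteq> F \<Longrightarrow> override_on (override_on x u F) w \<Lambda> = override_on x (override_on u w \<Lambda>) F"
  by (auto simp: override_on_def fun_eq_iff)

lemma override_on_override_on_superset:
  "\<Lambda> \<subseteq> F \<Longrightarrow> override_on (override_on x w \<Lambda>) u F = override_on x u F"
  by (auto simp: override_on_def fun_eq_iff)

lemma override_on_patterns: "u \<in> patterns F \<Longrightarrow> \<Lambda> \<subseteq> F \<Longrightarrow> override_on u w \<Lambda> \<in> patterns F"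
  by (auto simp: override_on_def PiE_def extensional_def)

lemma override_on_restrict_self: "override_on x (restrict x \<Lambda>) \<Lambda> = x"
  by (auto simp: override_on_def)

lemma restrict_override_on: "w \<in> patterns \<Lambda> \<Longrightarrow> restrict (override_on u w \<Lambda>) \<Lambda> = w"
  by (rule patterns_eqI[of _ \<Lambda>]) auto

locale finite_range_potential =
  fixes \<phi> :: "('g::group_add \<Rightarrow> 'a::{finite,discrete_topology}) \<Rightarrow> real" and D :: "'g set"
  assumes window: "potential_with_window \<phi> D"
begin

abbreviation weight :: "'g set \<Rightarrow> ('g \<Rightarrow> 'a) \<Rightarrow> real" where
  "weight \<equiv> boltzmann_weight \<phi> D"

text \<open>Translates of the window \<open>D\<close> by elements of \<open>reach \<Lambda>\<close> are those that meet \<open>\<Lambda>\<close>; \<open>collar \<Lambda>\<close> is their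
  union.\<close>

definition reach :: "'g set \<Rightarrow> 'g set" where
  "reach \<Lambda> = {g. (\<lambda>d. d + g) ` D \<inter> \<Lambda> \<noteq> {}}"

definition collar :: "'g set \<Rightarrow> 'g set" where
  "collar \<Lambda> = (\<lambda>(d, g). d + g) ` (D \<times> reach \<Lambda>)"

text \<open>The probability that \<open>\<pi>\<^sub>\<Lambda>(x)\<close> gives to the pattern \<open>w\<close> on \<open>\<Lambda>\<close>.\<close>

definition spec :: "'g set \<Rightarrow> ('g \<Rightarrow> 'a) \<Rightarrow> ('g \<Rightarrow> 'a) \<Rightarrow> real" where
  "spec \<Lambda> x w = weight \<Lambda> (override_on x w \<Lambda>) / (\<Sum>w'\<in>patterns \<Lambda>. weight \<Lambda> (override_on x w' \<Lambda>))"

text \<open>The average \<open>\<integral> f d\<pi>\<^sub>\<Lambda>(x)\<close> as a finite sum.\<close>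

definition gibbs_avg :: "'g set \<Rightarrow> (('g \<Rightarrow> 'a) \<Rightarrow> real) \<Rightarrow> ('g \<Rightarrow> 'a) \<Rightarrow> real" where
  "gibbs_avg \<Lambda> f x = (\<Sum>w\<in>patterns \<Lambda>. spec \<Lambda> x w * f (override_on x w \<Lambda>))"

lemma finite_window: "finite D"
  using window by (simp add: potential_with_window_def)

lemma potential_cong: "(\<And>d. d \<in> D \<Longrightarrow> x d = y d) \<Longrightarrow> \<phi> x = \<phi> y"
  using window by (auto simp: potential_with_window_def)

lemma reach_eq: "reach \<Lambda> = (\<lambda>(d, k). - d + k) ` (D \<times> \<Lambda>)"
proof (intro set_eqI iffI)
  fix g assume "g \<in> reach \<Lambda>"
  then obtain d where d: "d \<in> D" "d + g \<in> \<Lambda>" by (auto simp: reach_def)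
  have "g = - d + (d + g)" by (simp add: add.assoc[symmetric])
  with d show "g \<in> (\<lambda>(d, k). - d + k) ` (D \<times> \<Lambda>)" by force
next
  fix g assume "g \<in> (\<lambda>(d, k). - d + k) ` (D \<times> \<Lambda>)"
  then obtain d k where "d \<in> D" "k \<in> \<Lambda>" "g = - d + k" by auto
  moreover from this have "d + g = k" by (simp add: add.assoc[symmetric])
  ultimately show "g \<in> reach \<Lambda>" by (auto simp: reach_def)
qed

lemma finite_reach: "finite \<Lambda> \<Longrightarrow> finite (reach \<Lambda>)"
  by (simp add: reach_eq finite_window)

lemma finite_collar: "finite \<Lambda> \<Longrightarrow> finite (collar \<Lambda>)"
  by (simp add: collar_def finite_reach finite_window)

lemma reach_mono: "\<Lambda> \<subseteq> F \<Longrightarrow> reach \<Lambda> \<subseteq> reach F"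
  by (auto simp: reach_def)

lemma weight_eq: "weight \<Lambda> y = exp (- (\<Sum>g\<in>reach \<Lambda>. \<phi> (shift g y)))"
  by (simp add: boltzmann_weight_def reach_def)

lemma weight_pos: "weight \<Lambda> y > 0"
  by (simp add: weight_eq)

lemma local_on_weight: "local_on (collar \<Lambda>) (weight \<Lambda>)"
proof (rule local_onI)
  fix x y :: "'g \<Rightarrow> 'a" assume eq: "\<And>g. g \<in> collar \<Lambda> \<Longrightarrow> x g = y g"
  have "\<phi> (shift g x) = \<phi> (shift g y)" if "g \<in> reach \<Lambda>" for g
    by (rule potential_cong) (use that in \<open>force simp: shift_def collar_def intro!: eq\<close>)
  then show "weight \<Lambda> x = weight \<Lambda> y" by (simp add: weight_eq)
qed

text \<open>Terms of the energy whose window misses \<open>\<Lambda>\<close> do not see a change inside \<open>\<Lambda>\<close>; hence conditioning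
  a Gibbs weight on the outside of a smaller volume gives the Gibbs weight of that volume.\<close>

lemma weight_ratio:
  assumes "finite F" "\<Lambda> \<subseteq> F" "\<And>g. g \<notin> \<Lambda> \<Longrightarrow> y g = z g"
  shows "weight F y * weight \<Lambda> z = weight F z * weight \<Lambda> y"
proof -
  have split: "(\<Sum>g\<in>reach F. \<phi> (shift g x)) =
      (\<Sum>g\<in>reach F - reach \<Lambda>. \<phi> (shift g x)) + (\<Sum>g\<in>reach \<Lambda>. \<phi> (shift g x))" for x
    by (rule sum.subset_diff) (use assms reach_mono finite_reach in auto)
  have "(\<Sum>g\<in>reach F - reach \<Lambda>. \<phi> (shift g y)) = (\<Sum>g\<in>reach F - reach \<Lambda>. \<phi> (shift g z))"
  proof (rule sum.cong)
    fix g assume "g \<in> reach F - reach \<Lambda>"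
    then show "\<phi> (shift g y) = \<phi> (shift g z)"
      by (intro potential_cong) (auto simp: shift_def reach_def intro!: assms(3))
  qed auto
  then show ?thesis by (simp add: weight_eq split exp_add[symmetric])
qed

lemma weight_sum_pos:
  "finite \<Lambda> \<Longrightarrow> (\<Sum>w\<in>patterns \<Lambda>. weight \<Lambda> (override_on x w \<Lambda>)) > 0"
  by (intro sum_pos) (auto simp: weight_pos)

lemma spec_pos: "finite \<Lambda> \<Longrightarrow> spec \<Lambda> x w > 0"
  by (simp add: spec_def weight_pos weight_sum_pos)

lemma sum_spec: "finite \<Lambda> \<Longrightarrow> (\<Sum>w\<in>patterns \<Lambda>. spec \<Lambda> x w) = 1"
  using weight_sum_pos[of \<Lambda> x] by (simp add: spec_def sum_divide_distrib[symmetric])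

text \<open>The energy terms in the weight of \<open>\<Lambda>\<close> use coordinates in the collar only, and those inside \<open>\<Lambda>\<close> are
  overwritten.\<close>

lemma spec_cong:
  assumes "\<And>g. g \<in> collar \<Lambda> - \<Lambda> \<Longrightarrow> x g = y g"
  shows "spec \<Lambda> x w = spec \<Lambda> y w"
proof -
  have "weight \<Lambda> (override_on x w' \<Lambda>) = weight \<Lambda> (override_on y w' \<Lambda>)" for w'
    by (rule local_onD[OF local_on_weight]) (use assms in \<open>auto simp: override_on_def\<close>)
  then show ?thesis by (simp add: spec_def)
qed

lemma local_on_gibbs_avg:
  assumes "local_on W f" shows "local_on (collar \<Lambda> \<union> W - \<Lambda>) (gibbs_avg \<Lambda> f)"
proof (rule local_onI)
  fix x y :: "'g \<Rightarrow> 'a" assume eq: "\<And>g. g \<in> collar \<Lambda> \<union> W - \<Lambda> \<Longrightarrow> x g = y g"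
  have "spec \<Lambda> x w = spec \<Lambda> y w" for w by (rule spec_cong) (use eq in auto)
  moreover have "f (override_on x w \<Lambda>) = f (override_on y w \<Lambda>)" for w
    by (rule local_onD[OF assms]) (use eq in \<open>auto simp: override_on_def\<close>)
  ultimately show "gibbs_avg \<Lambda> f x = gibbs_avg \<Lambda> f y" by (simp add: gibbs_avg_def)
qed

lemma local_fun_gibbs_avg: "finite \<Lambda> \<Longrightarrow> local_fun f \<Longrightarrow> local_fun (gibbs_avg \<Lambda> f)"
  by (metis finite_Diff finite_UnI finite_collar local_funE local_funI local_on_gibbs_avg)

lemma gibbs_avg_cong_off:
  assumes "\<And>g. g \<notin> \<Lambda> \<Longrightarrow> x g = y g"
  shows "gibbs_avg \<Lambda> f x = gibbs_avg \<Lambda> f y"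
proof -
  have "override_on x w \<Lambda> = override_on y w \<Lambda>" for w
    using assms by (auto simp: override_on_def)
  moreover have "spec \<Lambda> x w = spec \<Lambda> y w" for w by (rule spec_cong) (use assms in auto)
  ultimately show ?thesis by (simp add: gibbs_avg_def)
qed

lemma gibbs_avg_add: "gibbs_avg \<Lambda> (\<lambda>x. f x + h x) x = gibbs_avg \<Lambda> f x + gibbs_avg \<Lambda> h x"
  by (simp add: gibbs_avg_def algebra_simps sum.distrib)

lemma gibbs_avg_cmult: "gibbs_avg \<Lambda> (\<lambda>x. c * f x) x = c * gibbs_avg \<Lambda> f x"
  by (simp add: gibbs_avg_def algebra_simps sum_distrib_left)

lemma gibbs_avg_const: "finite \<Lambda> \<Longrightarrow> gibbs_avg \<Lambda> (\<lambda>x. c) x = c"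
  using sum_spec[of \<Lambda> x] by (simp add: gibbs_avg_def flip: sum_distrib_right)

lemma gibbs_avg_mono: "finite \<Lambda> \<Longrightarrow> (\<And>x. f x \<le> h x) \<Longrightarrow> gibbs_avg \<Lambda> f x \<le> gibbs_avg \<Lambda> h x"
  by (auto simp: gibbs_avg_def intro!: sum_mono mult_left_mono less_imp_le[OF spec_pos])

lemma gibbs_avg_sum:
  "gibbs_avg \<Lambda> (\<lambda>x. \<Sum>i\<in>I. f i x) x = (\<Sum>i\<in>I. gibbs_avg \<Lambda> (f i) x)"
  unfolding gibbs_avg_def sum_distrib_left by (rule sum.swap)

lemma gibbs_avg_nonneg: "finite \<Lambda> \<Longrightarrow> (\<And>x. f x \<ge> 0) \<Longrightarrow> gibbs_avg \<Lambda> f x \<ge> 0"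
  by (auto simp: gibbs_avg_def intro!: sum_nonneg mult_nonneg_nonneg less_imp_le[OF spec_pos])

lemma gibbs_avg_mult_off:
  assumes "\<And>y. (\<And>g. g \<notin> \<Lambda> \<Longrightarrow> y g = x g) \<Longrightarrow> h y = h x"
  shows "gibbs_avg \<Lambda> (\<lambda>x. h x * f x) x = h x * gibbs_avg \<Lambda> f x"
proof -
  have "h (override_on x w \<Lambda>) = h x" for w by (rule assms) (auto simp: override_on_def)
  then show ?thesis by (simp add: gibbs_avg_def sum_distrib_left mult.left_commute)
qed

text \<open>Consistency of the specification: given the outside of \<open>\<Lambda>\<close>, the distribution \<open>\<pi>\<^sub>F(x)\<close> is already
  \<open>\<pi>\<^sub>\<Lambda>\<close>, so resampling \<open>\<Lambda>\<close> once more leaves it invariant.\<close>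

lemma gibbs_avg_gibbs_avg:
  assumes F: "finite F" "\<Lambda> \<subseteq> F"
  shows "gibbs_avg F (gibbs_avg \<Lambda> f) x = gibbs_avg F f x"
proof -
  let ?m = "\<lambda>u. weight F (override_on x u F)" and ?R = "\<lambda>w u. override_on u w \<Lambda>"
  have fin: "finite \<Lambda>" using F finite_subset by auto
  have sp: "spec \<Lambda> (override_on x u F) w = ?m (?R w u) / (\<Sum>w'\<in>patterns \<Lambda>. ?m (?R w' u))"
    if "u \<in> patterns F" for u w
  proof -
    let ?y = "override_on x u F"
    have *: "weight F (override_on ?y w' \<Lambda>) = weight F ?y / weight \<Lambda> ?y * weight \<Lambda> (override_on ?y w' \<Lambda>)" for w'
      using weight_ratio[OF F, of "override_on ?y w' \<Lambda>" ?y] weight_pos[of \<Lambda> ?y]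
      by (auto simp: override_on_def field_simps)
    have nz: "weight F ?y / weight \<Lambda> ?y \<noteq> 0" using weight_pos by (metis divide_pos_pos less_irrefl)
    show ?thesis unfolding spec_def
      by (simp only: override_on_override_on[OF F(2), symmetric] * sum_distrib_left[symmetric]
           mult_divide_mult_cancel_left[OF nz])
  qed
  have "(\<Sum>u\<in>patterns F. ?m u * gibbs_avg \<Lambda> f (override_on x u F))
     = (\<Sum>u\<in>patterns F. ?m u * (\<Sum>w\<in>patterns \<Lambda>. ?m (?R w u) / (\<Sum>w'\<in>patterns \<Lambda>. ?m (?R w' u))
          * f (override_on x (?R w u) F)))"
    unfolding gibbs_avg_def by (intro sum.cong) (auto simp: sp override_on_override_on[OF F(2)])
  also have "\<dots> = (\<Sum>u\<in>patterns F. ?m u * f (override_on x u F))"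
    by (rule sum_resampling[where c = "\<lambda>u. restrict u \<Lambda>"])
       (use F fin in \<open>simp_all add: override_on_patterns override_on_override_on_superset
          override_on_restrict_self restrict_override_on weight_pos\<close>, auto simp: override_on_def)
  finally have "(\<Sum>u\<in>patterns F. ?m u * gibbs_avg \<Lambda> f (override_on x u F))
     = (\<Sum>u\<in>patterns F. ?m u * f (override_on x u F))" .
  moreover have "gibbs_avg F h x = (\<Sum>u\<in>patterns F. ?m u * h (override_on x u F)) / (\<Sum>u\<in>patterns F. ?m u)"
    for h by (simp add: gibbs_avg_def spec_def sum_divide_distrib)
  ultimately show ?thesis by (simp only:)
qed

end

section \<open>The configuration space and its Borel sets\<close>

lemma compact_configurations: "compact (UNIV :: ('g \<Rightarrow> 'a::{finite,discrete_topology}) set)"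
proof -
  have "compactin (product_topology (\<lambda>_. euclidean) UNIV) (Pi\<^sub>E (UNIV :: 'g set) (\<lambda>_. UNIV :: 'a set))"
    unfolding compactin_PiE by (simp add: finite_imp_compact)
  then show ?thesis by (simp add: euclidean_product_topology)
qed

lemma open_local:
  fixes C :: "('g \<Rightarrow> 'a::discrete_topology) set"
  assumes "local_fun (\<lambda>x. x \<in> C)" shows "open C"
proof -
  obtain W where W: "finite W" "local_on W (\<lambda>x. x \<in> C)" using assms by (rule local_funE)
  define B where "B x = Pi\<^sub>E UNIV (\<lambda>g. if g \<in> W then {x g} else UNIV :: 'a set)" for x :: "'g \<Rightarrow> 'a"
  have "finite {g. (if g \<in> W then {x g} else UNIV :: 'a set) \<noteq> UNIV}" for x
    by (rule finite_subset[OF _ W(1)]) auto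
  then have "open (B x)" for x unfolding B_def by (intro open_PiE) (simp_all add: Topological_Spaces.open_discrete)
  moreover have "C = (\<Union>x\<in>C. B x)"
  proof (intro equalityI subsetI)
    fix y assume "y \<in> (\<Union>x\<in>C. B x)"
    then obtain x where "x \<in> C" "y \<in> B x" by auto
    moreover from this have "\<And>g. g \<in> W \<Longrightarrow> x g = y g" by (force simp: B_def PiE_iff split: if_splits)
    ultimately show "y \<in> C" using local_onD[OF W(2), of x y] by auto
  qed (auto simp: B_def)
  ultimately show ?thesis by (metis open_UN)
qed

lemma local_fun_Compl: "local_fun (\<lambda>x. x \<in> C) \<Longrightarrow> local_fun (\<lambda>x. x \<in> - C)"
  by (simp add: local_fun_comp[where h = Not])

lemma closed_local:
  fixes C :: "('g \<Rightarrow> 'a::discrete_topology) set"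
  assumes "local_fun (\<lambda>x. x \<in> C)" shows "closed C"
  using open_local[OF local_fun_Compl[OF assms]] by (simp add: closed_def)

lemma open_contains_cylinder:
  fixes U :: "('g \<Rightarrow> 'a::topological_space) set"
  assumes "open U" "x \<in> U"
  obtains W where "finite W" "\<And>y. (\<And>g. g \<in> W \<Longrightarrow> y g = x g) \<Longrightarrow> y \<in> U"
proof -
  obtain T where T: "finite {i. T i \<noteq> (UNIV :: 'a set)}" "x \<in> Pi\<^sub>E UNIV T" "Pi\<^sub>E UNIV T \<subseteq> U"
    using assms unfolding open_fun_def openin_product_topology_alt by fastforce
  have "y \<in> U" if "\<And>g. g \<in> {i. T i \<noteq> UNIV} \<Longrightarrow> y g = x g" for y
  proof -
    have "y g \<in> T g" for g
      using that[of g] T(2) by (cases "T g = UNIV") (auto simp: PiE_iff)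
    then show ?thesis using T(3) by auto
  qed
  with T(1) show ?thesis by (rule that)
qed

lemma local_cylinder: "finite W \<Longrightarrow> local_fun (\<lambda>x. x \<in> {x. restrict x W = u})"
  by (rule local_funI[of W]) (auto simp: local_on_def fun_eq_iff restrict_def)

lemma local_fun_Int:
  assumes "local_fun (\<lambda>x. x \<in> A)" "local_fun (\<lambda>x. x \<in> B)" shows "local_fun (\<lambda>x. x \<in> A \<inter> B)"
  using local_fun_comp2[OF assms, of "(\<and>)"] by simp

text \<open>There are only countably many cylinders, since the group is countable and the alphabet finite;
  so every open set is a countable union of cylinders.\<close>

lemma sets_borel_configurations:
  "sets (borel :: ('g::countable \<Rightarrow> 'a::{finite,discrete_topology}) measure)
     = sigma_sets UNIV {C. local_fun (\<lambda>x. x \<in> C)}" (is "_ = sigma_sets UNIV ?L")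
proof
  have "?L \<subseteq> sets borel" by (auto intro!: borel_open open_local)
  then show "sigma_sets UNIV ?L \<subseteq> sets borel" using sets.sigma_sets_subset[of ?L borel] by simp
  have "U \<in> sigma_sets UNIV ?L" if "open U" for U :: "('g \<Rightarrow> 'a) set"
  proof -
    define K where "K = {(W, u). finite W \<and> u \<in> (patterns W :: ('g \<Rightarrow> 'a) set) \<and> {x. restrict x W = u} \<subseteq> U}"
    have "countable (SIGMA W:{W :: 'g set. finite W}. (patterns W :: ('g \<Rightarrow> 'a) set))"
      by (intro countable_SIGMA countable_Collect_finite) (auto intro: countable_finite)
    then have K: "countable K" by (rule countable_subset[rotated]) (auto simp: K_def)
    have U: "U = (\<Union>(W, u)\<in>K. {x. restrict x W = u})"
    proof (intro equalityI subsetI)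
      fix x assume "x \<in> U"
      then obtain W where W: "finite W" "\<And>y. (\<And>g. g \<in> W \<Longrightarrow> y g = x g) \<Longrightarrow> y \<in> U"
        using open_contains_cylinder \<open>open U\<close> by metis
      have "y \<in> U" if "restrict y W = restrict x W" for y
        by (rule W(2)) (metis that restrict_apply')
      then have "(W, restrict x W) \<in> K" using W(1) by (auto simp: K_def)
      then show "x \<in> (\<Union>(W, u)\<in>K. {x. restrict x W = u})" by force
    qed (auto simp: K_def)
    show ?thesis unfolding U
      using K local_cylinder by (intro sigma_sets_UNION) (auto simp: K_def intro!: sigma_sets.Basic)
  qed
  then show "sets borel \<subseteq> sigma_sets UNIV ?L"
    unfolding borel_def by (simp, intro sigma_sets_mono) auto
qed

lemma measurable_local:
  fixes f :: "('g \<Rightarrow> 'a::discrete_topology) \<Rightarrow> 'b::topological_space"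
  assumes "local_fun f" shows "f \<in> borel_measurable borel"
proof (rule borel_measurableI)
  fix B :: "'b set"
  have "open (f -` B)" by (rule open_local) (simp add: local_fun_comp[OF assms, of "\<lambda>z. z \<in> B"])
  then show "f -` B \<inter> space borel \<in> sets borel" by simp
qed

text \<open>By compactness finitely many cylinders on which \<open>f\<close> oscillates by less than \<open>\<delta>\<close> cover the space, and
  the coordinates they use determine \<open>f\<close> up to \<open>\<delta>\<close>.\<close>

lemma continuous_local_approximation:
  fixes f :: "('g \<Rightarrow> 'a::{finite,discrete_topology}) \<Rightarrow> real"
  assumes "continuous_on UNIV f" "\<delta> > 0"
  obtains h where "local_fun h" "\<And>x. \<bar>f x - h x\<bar> < \<delta>"
proof -
  have "\<exists>W. finite W \<and> (\<forall>y. (\<forall>g\<in>W. y g = x g) \<longrightarrow> \<bar>f y - f x\<bar> < \<delta> / 2)" for x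
  proof -
    have "open (f -` ball (f x) (\<delta> / 2))"
      using assms(1) by (intro open_vimage) auto
    moreover have "x \<in> f -` ball (f x) (\<delta> / 2)" using assms(2) by simp
    ultimately obtain W where "finite W" "\<And>y. (\<And>g. g \<in> W \<Longrightarrow> y g = x g) \<Longrightarrow> y \<in> f -` ball (f x) (\<delta> / 2)"
      using open_contains_cylinder by metis
    then show ?thesis by (intro exI[of _ W]) (auto simp: dist_real_def abs_minus_commute)
  qed
  then obtain W where W: "\<And>x. finite (W x)"
    "\<And>x y. (\<And>g. g \<in> W x \<Longrightarrow> y g = x g) \<Longrightarrow> \<bar>f y - f x\<bar> < \<delta> / 2" by metis
  define B where "B x = {y. restrict y (W x) = restrict x (W x)}" for x
  have op: "open (B x)" for x unfolding B_def by (intro open_local local_cylinder W)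
  obtain X where X: "finite X" "UNIV \<subseteq> (\<Union>x\<in>X. B x)"
    using compactE_image[OF compact_configurations, of UNIV B] op by (force simp: B_def)
  define V where "V = (\<Union>x\<in>X. W x)"
  have osc: "\<bar>f y - f z\<bar> < \<delta>" if "\<And>g. g \<in> V \<Longrightarrow> y g = z g" for y z
  proof -
    obtain x where x: "x \<in> X" "y \<in> B x" using X by auto
    then have yx: "y g = x g" if "g \<in> W x" for g using that by (auto simp: B_def) (metis restrict_apply')
    have "\<bar>f y - f x\<bar> < \<delta> / 2" by (rule W(2)) (rule yx)
    moreover have "\<bar>f z - f x\<bar> < \<delta> / 2"
      by (rule W(2)) (use yx that x in \<open>force simp: V_def\<close>)
    ultimately show ?thesis by linarith
  qed
  show ?thesis
  proof (rule that[of "\<lambda>x. f (restrict x V)"])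
    show "local_fun (\<lambda>x. f (restrict x V))"
      by (rule local_funI[of V]) (use X W in \<open>auto simp: V_def local_on_def fun_eq_iff restrict_def intro!: arg_cong[of _ _ f]\<close>)
    show "\<bar>f x - f (restrict x V)\<bar> < \<delta>" for x by (rule osc) auto
  qed
qed

text \<open>A normalised, finitely additive, nonnegative function on the clopen sets extends to a Borel
  probability measure: continuity at the empty set is automatic, since a decreasing sequence of
  clopen sets with empty intersection is eventually empty.\<close>

lemma extend_local_content:
  fixes p :: "('g::countable \<Rightarrow> 'a::{finite,discrete_topology}) set \<Rightarrow> real"
  assumes nonneg: "\<And>C. local_fun (\<lambda>x. x \<in> C) \<Longrightarrow> p C \<ge> 0"
    and add: "\<And>A B. local_fun (\<lambda>x. x \<in> A) \<Longrightarrow> local_fun (\<lambda>x. x \<in> B) \<Longrightarrow> A \<inter> B = {} \<Longrightarrow>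
        p (A \<union> B) = p A + p B"
    and one: "p UNIV = 1"
  obtains \<nu> where "\<nu> \<in> space (prob_algebra borel)" "\<And>C. local_fun (\<lambda>x. x \<in> C) \<Longrightarrow> measure \<nu> C = p C"
proof -
  let ?L = "{C :: ('g \<Rightarrow> 'a) set. local_fun (\<lambda>x. x \<in> C)}"
  have zero: "p {} = 0" using add[of "{}" "{}"] by simp
  have Un: "local_fun (\<lambda>x. x \<in> A \<union> B)" if "local_fun (\<lambda>x. x \<in> A)" "local_fun (\<lambda>x. x \<in> B)"
    for A B :: "('g \<Rightarrow> 'a) set" using local_fun_comp2[OF that, of "(\<or>)"] by simp
  have alg: "algebra UNIV ?L"
    unfolding algebra_iff_Un using local_fun_Compl Un by (auto simp: Compl_eq_Diff_UNIV[symmetric])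
  interpret algebra UNIV ?L by (rule alg)
  have "\<exists>m. (\<forall>s\<in>?L. m s = ennreal (p s)) \<and> measure_space UNIV (sigma_sets UNIV ?L) m"
  proof (rule caratheodory_empty_continuous)
    show "positive ?L (\<lambda>C. ennreal (p C))" by (simp add: positive_def zero)
    show "additive ?L (\<lambda>C. ennreal (p C))"
      by (auto simp: additive_def add nonneg ennreal_plus)
    show "ennreal (p C) \<noteq> \<infinity>" for C by simp
    fix C :: "nat \<Rightarrow> ('g \<Rightarrow> 'a) set"
    assume C: "range C \<subseteq> ?L" "decseq C" "(\<Inter>i. C i) = {}"
    have "\<exists>n. C n = {}"
    proof (rule ccontr)
      assume ne: "\<nexists>n. C n = {}"
      have "UNIV \<inter> (\<Inter>i\<in>UNIV. C i) \<noteq> {}"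
      proof (rule compact_imp_fip_image[OF compact_configurations])
        show "closed (C i)" for i using C(1) by (auto intro: closed_local)
        fix I :: "nat set" assume I: "finite I"
        show "UNIV \<inter> (\<Inter>i\<in>I. C i) \<noteq> {}"
        proof (cases "I = {}")
          case False
          have "C (Max I) \<subseteq> (\<Inter>i\<in>I. C i)" using I C(2) by (auto simp: decseq_def) (meson Max_ge subsetD)
          with ne show ?thesis by auto
        qed auto
      qed
      with C(3) show False by simp
    qed
    then obtain n where n: "C n = {}" by auto
    have "ennreal (p (C i)) = 0" if "i \<ge> n" for i
      using C(2) n that by (auto simp: decseq_def zero) (metis ennreal_0 subset_empty zero)
    then show "(\<lambda>i. ennreal (p (C i))) \<longlonglongrightarrow> 0"
      by (intro tendsto_eventually) (auto simp: eventually_sequentially)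
  qed
  then obtain m where m: "\<And>s. s \<in> ?L \<Longrightarrow> m s = ennreal (p s)" "measure_space UNIV (sigma_sets UNIV ?L) m"
    by auto
  define \<nu> where "\<nu> = measure_of UNIV (sigma_sets UNIV ?L) m"
  have sets: "sets \<nu> = sets borel"
    unfolding sets_borel_configurations \<nu>_def by (simp add: sigma_sets_sigma_sets_eq)
  have em: "emeasure \<nu> C = m C" if "C \<in> sigma_sets UNIV ?L" for C
    unfolding \<nu>_def using m(2) that by (intro emeasure_measure_of_sigma) (auto simp: measure_space_def)
  then have em': "emeasure \<nu> C = ennreal (p C)" if "C \<in> ?L" for C
    using m(1) that by (simp add: sigma_sets.Basic)
  have "space \<nu> = UNIV" using sets_eq_imp_space_eq[OF sets] by simp
  then have "prob_space \<nu>" by (intro prob_spaceI) (simp add: em' one)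
  then show ?thesis
    by (intro that[of \<nu>]) (auto simp: space_prob_algebra sets measure_def em' nonneg)
qed

text \<open>Clopen sets generate the Borel sets and are closed under intersections.\<close>

lemma measure_eqI_local:
  fixes \<mu> \<nu> :: "('g::countable \<Rightarrow> 'a::{finite,discrete_topology}) measure"
  assumes "\<mu> \<in> space (prob_algebra borel)" "\<nu> \<in> space (prob_algebra borel)"
    and eq: "\<And>C. local_fun (\<lambda>x. x \<in> C) \<Longrightarrow> measure \<mu> C = measure \<nu> C"
  shows "\<mu> = \<nu>"
proof -
  let ?L = "{C :: ('g \<Rightarrow> 'a) set. local_fun (\<lambda>x. x \<in> C)}"
  interpret \<mu>: prob_space \<mu> using assms(1) by (simp add: space_prob_algebra)
  interpret \<nu>: prob_space \<nu> using assms(2) by (simp add: space_prob_algebra)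
  show ?thesis
  proof (rule measure_eqI_generator_eq[of ?L UNIV _ _ "\<lambda>_. UNIV"])
    show "Int_stable ?L" by (auto simp: Int_stable_def intro: local_fun_Int[simplified])
    show "emeasure \<mu> C = emeasure \<nu> C" if "C \<in> ?L" for C
      using that eq by (simp add: \<mu>.emeasure_eq_measure \<nu>.emeasure_eq_measure)
  qed (use assms in \<open>auto simp: space_prob_algebra sets_borel_configurations\<close>)
qed

section \<open>Gibbs measures and finite-volume averages\<close>

lemma agreeing_off_eq: "agreeing_off \<Lambda> x = (\<lambda>w. override_on x w \<Lambda>) ` patterns \<Lambda>"
proof (intro set_eqI iffI)
  fix y assume "y \<in> agreeing_off \<Lambda> x"
  then have "y = override_on x (restrict y \<Lambda>) \<Lambda>"
    by (auto simp: agreeing_off_def override_on_def fun_eq_iff)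
  then show "y \<in> (\<lambda>w. override_on x w \<Lambda>) ` patterns \<Lambda>" by (metis image_eqI restrict_patterns)
qed (auto simp: agreeing_off_def)

lemma inj_on_override_on: "inj_on (\<lambda>w. override_on x w \<Lambda>) (patterns \<Lambda>)"
  by (rule inj_on_inverseI[of _ "\<lambda>y. restrict y \<Lambda>"]) (simp add: restrict_override_on)

lemma measurable_override_on:
  "(\<lambda>x :: 'g::countable \<Rightarrow> 'a::{finite,discrete_topology}. override_on x w \<Lambda>) \<in> measurable borel borel"
proof (rule measurable_sigma_sets[OF sets_borel_configurations])
  fix C :: "('g \<Rightarrow> 'a) set" assume "C \<in> {C. local_fun (\<lambda>x. x \<in> C)}"
  then obtain W where W: "finite W" "local_on W (\<lambda>x. x \<in> C)" by (auto elim: local_funE)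
  have "local_fun (\<lambda>x. x \<in> (\<lambda>x. override_on x w \<Lambda>) -` C)"
  proof (rule local_funI[OF W(1)], rule local_onI)
    fix x y :: "'g \<Rightarrow> 'a" assume "\<And>g. g \<in> W \<Longrightarrow> x g = y g"
    then show "(x \<in> (\<lambda>x. override_on x w \<Lambda>) -` C) = (y \<in> (\<lambda>x. override_on x w \<Lambda>) -` C)"
      using local_onD[OF W(2), of "override_on x w \<Lambda>" "override_on y w \<Lambda>"] by (simp add: override_on_def)
  qed
  then have "open ((\<lambda>x. override_on x w \<Lambda>) -` C)" by (rule open_local)
  then show "(\<lambda>x. override_on x w \<Lambda>) -` C \<inter> space borel \<in> sets borel" by simp
qed auto

context
  fixes \<phi> :: "('g::{countable,group_add} \<Rightarrow> 'a::{finite,discrete_topology}) \<Rightarrow> real" and D :: "'g set"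
  assumes finite_range: "finite_range_potential \<phi> D"
begin

interpretation finite_range_potential \<phi> D by (rule finite_range)

lemma measurable_gibbs_avg:
  assumes "finite \<Lambda>" "f \<in> borel_measurable borel" shows "gibbs_avg \<Lambda> f \<in> borel_measurable borel"
proof -
  have "local_fun (\<lambda>x. spec \<Lambda> x w)" for w
    by (rule local_funI[of "collar \<Lambda> - \<Lambda>"]) (use assms in \<open>auto simp: finite_collar local_on_def intro!: spec_cong\<close>)
  then have "(\<lambda>x. spec \<Lambda> x w * f (override_on x w \<Lambda>)) \<in> borel_measurable borel" for w
    by (intro borel_measurable_times measurable_local measurable_compose[OF measurable_override_on assms(2)])
  then show ?thesis unfolding gibbs_avg_def[abs_def] by (intro borel_measurable_sum)
qed

lemma integral_gibbs_kernel:
  assumes "finite \<Lambda>" "f \<in> borel_measurable borel"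
  shows "(\<integral>y. f y \<partial>gibbs_kernel \<phi> D \<Lambda> x) = gibbs_avg \<Lambda> f x"
proof -
  have sum: "(\<Sum>z\<in>agreeing_off \<Lambda> x. h z) = (\<Sum>w\<in>patterns \<Lambda>. h (override_on x w \<Lambda>))" for h :: "_ \<Rightarrow> real"
    by (simp add: agreeing_off_eq sum.reindex inj_on_override_on)
  have fin: "finite (agreeing_off \<Lambda> x)" using assms(1) by (simp add: agreeing_off_eq)
  let ?p = "\<lambda>y. weight \<Lambda> y / (\<Sum>z\<in>agreeing_off \<Lambda> x. weight \<Lambda> z)"
  have "?p y \<ge> 0" for y
    by (intro divide_nonneg_nonneg sum_nonneg) (auto intro: less_imp_le weight_pos)
  then have "(\<integral>y. f y \<partial>gibbs_kernel \<phi> D \<Lambda> x) = (\<Sum>y\<in>agreeing_off \<Lambda> x. ?p y * f y)"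
    unfolding gibbs_kernel_def
    by (subst integral_distr) (auto simp: lebesgue_integral_point_measure_finite fin assms(2)
          measurable_def[of "point_measure _ _"] sets_point_measure space_point_measure)
  also have "\<dots> = gibbs_avg \<Lambda> f x"
    by (simp add: sum gibbs_avg_def spec_def)
  finally show ?thesis .
qed

lemma prob_space_gibbs_kernel:
  assumes "finite \<Lambda>" shows "prob_space (gibbs_kernel \<phi> D \<Lambda> x)"
proof -
  let ?w = "weight \<Lambda>" and ?A = "agreeing_off \<Lambda> x"
  let ?p = "\<lambda>y. ennreal (?w y / (\<Sum>z\<in>?A. ?w z))"
  have fin: "finite ?A" using assms by (simp add: agreeing_off_eq)
  have ne: "?A \<noteq> {}" by (simp add: agreeing_off_eq)
  have pos: "(\<Sum>z\<in>?A. ?w z) > 0" by (intro sum_pos fin ne weight_pos)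
  have nn: "?w y / (\<Sum>z\<in>?A. ?w z) \<ge> 0" for y using weight_pos[of \<Lambda> y] pos by simp
  have "(\<Sum>y\<in>?A. ?w y / (\<Sum>z\<in>?A. ?w z)) = 1" using pos by (simp add: sum_divide_distrib[symmetric])
  then have "prob_space (point_measure ?A ?p)"
    by (intro prob_spaceI) (simp add: emeasure_point_measure_finite fin nn space_point_measure sum_ennreal)
  then show ?thesis unfolding gibbs_kernel_def
    by (rule prob_space.prob_space_distr) (simp add: measurable_def space_point_measure sets_point_measure)
qed

lemma measurable_gibbs_kernel:
  assumes "finite \<Lambda>" shows "gibbs_kernel \<phi> D \<Lambda> \<in> measurable borel (subprob_algebra borel)"
proof (rule measurable_subprob_algebra)
  interpret prob_space "gibbs_kernel \<phi> D \<Lambda> x" for x by (rule prob_space_gibbs_kernel[OF assms])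
  show "subprob_space (gibbs_kernel \<phi> D \<Lambda> x)" for x by unfold_locales
  show "sets (gibbs_kernel \<phi> D \<Lambda> x) = sets borel" for x by (simp add: gibbs_kernel_def)
  fix A :: "('g \<Rightarrow> 'a) set" assume A: "A \<in> sets borel"
  have "emeasure (gibbs_kernel \<phi> D \<Lambda> x) A = ennreal (gibbs_avg \<Lambda> (indicator A) x)" for x
  proof -
    have "space (gibbs_kernel \<phi> D \<Lambda> x) = UNIV" by (simp add: gibbs_kernel_def)
    then have "measure (gibbs_kernel \<phi> D \<Lambda> x) A = gibbs_avg \<Lambda> (indicator A) x"
      using integral_gibbs_kernel[OF assms, of "indicator A" x] A by simp
    then show ?thesis by (simp add: emeasure_eq_measure)
  qed
  moreover have "gibbs_avg \<Lambda> (indicator A) \<in> borel_measurable borel"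
    using A by (intro measurable_gibbs_avg assms) auto
  ultimately show "(\<lambda>x. emeasure (gibbs_kernel \<phi> D \<Lambda> x) A) \<in> borel_measurable borel" by simp
qed

lemma integral_bind_gibbs_kernel:
  assumes "\<nu> \<in> space (prob_algebra borel)" "finite \<Lambda>"
    and "f \<in> borel_measurable borel" "\<And>x. \<bar>f x\<bar> \<le> b"
  shows "(\<integral>x. f x \<partial>bind \<nu> (gibbs_kernel \<phi> D \<Lambda>)) = (\<integral>x. gibbs_avg \<Lambda> f x \<partial>\<nu>)"
proof -
  interpret prob_space \<nu> using assms(1) by (simp add: space_prob_algebra)
  have sets: "sets \<nu> = sets borel" using assms(1) by (simp add: space_prob_algebra)
  have "(\<integral>x. f x \<partial>bind \<nu> (gibbs_kernel \<phi> D \<Lambda>)) = (\<integral>x. (\<integral>y. f y \<partial>gibbs_kernel \<phi> D \<Lambda> x) \<partial>\<nu>)"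
  proof (rule integral_bind[where B' = 1])
    show "gibbs_kernel \<phi> D \<Lambda> \<in> measurable \<nu> (subprob_algebra borel)"
      using measurable_gibbs_kernel[OF assms(2)] by (simp add: measurable_cong_sets[OF sets refl])
    show "AE x in \<nu>. emeasure (gibbs_kernel \<phi> D \<Lambda> x) (space (gibbs_kernel \<phi> D \<Lambda> x)) \<le> ennreal 1"
      using prob_space.emeasure_space_1[OF prob_space_gibbs_kernel[OF assms(2)]] by simp
  qed (use assms in \<open>auto intro: finite_measure_axioms\<close>)
  then show ?thesis by (simp add: integral_gibbs_kernel assms)
qed

lemma integral_gibbs_measure:
  assumes "gibbs_measure \<phi> D \<mu>" "finite \<Lambda>" "f \<in> borel_measurable borel" "\<And>x. \<bar>f x\<bar> \<le> b"
  shows "(\<integral>x. gibbs_avg \<Lambda> f x \<partial>\<mu>) = (\<integral>x. f x \<partial>\<mu>)"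
  using integral_bind_gibbs_kernel[of \<mu> \<Lambda> f b] assms by (auto simp: gibbs_measure_def)

text \<open>Local functions suffice to recognise a Gibbs measure, because clopen sets determine a Borel
  probability measure.\<close>

lemma gibbs_measureI_local:
  assumes \<nu>: "\<nu> \<in> space (prob_algebra borel)"
    and inv: "\<And>\<Lambda> f. finite \<Lambda> \<Longrightarrow> local_fun f \<Longrightarrow> (\<integral>x. gibbs_avg \<Lambda> f x \<partial>\<nu>) = (\<integral>x. f x \<partial>\<nu>)"
  shows "gibbs_measure \<phi> D \<nu>"
  unfolding gibbs_measure_def
proof (intro conjI allI impI)
  fix \<Lambda> :: "'g set" assume \<Lambda>: "finite \<Lambda>"
  interpret prob_space \<nu> using \<nu> by (simp add: space_prob_algebra)
  have sets: "sets \<nu> = sets borel" using \<nu> by (simp add: space_prob_algebra)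
  have K: "gibbs_kernel \<phi> D \<Lambda> \<in> measurable \<nu> (subprob_algebra borel)"
    using measurable_gibbs_kernel[OF \<Lambda>] by (simp add: measurable_cong_sets[OF sets refl])
  have sets': "sets (bind \<nu> (gibbs_kernel \<phi> D \<Lambda>)) = sets borel"
    by (rule sets_bind) (simp_all add: gibbs_kernel_def not_empty)
  show "bind \<nu> (gibbs_kernel \<phi> D \<Lambda>) = \<nu>"
  proof (rule measure_eqI_local[OF _ \<nu>])
    have "prob_space (bind \<nu> (gibbs_kernel \<phi> D \<Lambda>))"
      by (rule prob_space_bind[OF _ K]) (simp add: prob_space_gibbs_kernel \<Lambda>)
    then show "bind \<nu> (gibbs_kernel \<phi> D \<Lambda>) \<in> space (prob_algebra borel)"
      by (simp add: space_prob_algebra sets')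
    fix C :: "('g \<Rightarrow> 'a) set" assume C: "local_fun (\<lambda>x. x \<in> C)"
    then have ind: "local_fun (indicator C :: _ \<Rightarrow> real)"
      using local_fun_comp[OF C, of of_bool] by (simp add: indicator_def[abs_def] of_bool_def)
    have Cs: "C \<in> sets borel" using open_local[OF C] by simp
    have "(\<integral>x. indicator C x \<partial>bind \<nu> (gibbs_kernel \<phi> D \<Lambda>)) = (\<integral>x. indicator C x \<partial>\<nu> :: real)"
      using integral_bind_gibbs_kernel[OF \<nu> \<Lambda>, of "indicator C" 1] inv[OF \<Lambda> ind] Cs
      by (simp add: indicator_def)
    moreover have "space \<nu> = UNIV" "space (bind \<nu> (gibbs_kernel \<phi> D \<Lambda>)) = UNIV"
      using sets_eq_imp_space_eq[OF sets] sets_eq_imp_space_eq[OF sets'] by simp_all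
    ultimately show "measure (bind \<nu> (gibbs_kernel \<phi> D \<Lambda>)) C = measure \<nu> C" by simp
  qed
qed (fact \<nu>)

end

section \<open>Uniqueness forces decay of boundary influence\<close>

lemma closed_eventually_cluster:
  assumes "inf (nhds p) F \<noteq> bot" "closed Q" "eventually (\<lambda>x. x \<in> Q) F"
  shows "p \<in> Q"
proof (rule ccontr)
  assume "p \<notin> Q"
  then have "eventually (\<lambda>x. x \<in> - Q) (nhds p)"
    using assms(2) by (intro eventually_nhds_in_open) auto
  with assms(3) have "eventually (\<lambda>_. False) (inf (nhds p) F)"
    unfolding eventually_inf by fastforce
  with assms(1) show False by (simp add: eventually_False)
qed

text \<open>If the boundary influence did not decay, then any accumulation point of the functionals
  \<open>f \<mapsto> \<integral> f d\<pi>\<^sub>F(x\<^sub>F)\<close>, with \<open>F\<close> growing and \<open>x\<^sub>F\<close> a bad boundary condition, would be a Gibbs measure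
  other than \<open>\<mu>\<close>.  By consistency each of these functionals is invariant under resampling any
  \<open>\<Lambda> \<subseteq> F\<close>; this passes to the accumulation point, as does the failure at \<open>f\<close>.\<close>

lemma unique_gibbs_uniform_convergence:
  fixes \<phi> :: "('g::{countable,group_add} \<Rightarrow> 'a::{finite,discrete_topology}) \<Rightarrow> real"
  assumes "finite_range_potential \<phi> D"
    and unique: "\<And>\<nu>. gibbs_measure \<phi> D \<nu> \<Longrightarrow> \<nu> = \<mu>"
    and f: "local_fun f" and "\<epsilon> > 0"
  obtains F where "finite F"
    "\<And>x. \<bar>finite_range_potential.gibbs_avg \<phi> D F f x - (\<integral>y. f y \<partial>\<mu>)\<bar> < \<epsilon>"
proof -
  interpret finite_range_potential \<phi> D by fact
  have "\<exists>F. finite F \<and> (\<forall>x. \<bar>gibbs_avg F f x - (\<integral>y. f y \<partial>\<mu>)\<bar> < \<epsilon>)"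
  proof (rule ccontr)
    assume "\<nexists>F. finite F \<and> (\<forall>x. \<bar>gibbs_avg F f x - (\<integral>y. f y \<partial>\<mu>)\<bar> < \<epsilon>)"
    then have "\<forall>F. finite F \<longrightarrow> (\<exists>x. \<bar>gibbs_avg F f x - (\<integral>y. f y \<partial>\<mu>)\<bar> \<ge> \<epsilon>)"
      by (meson not_le)
    then obtain x where x: "\<And>F. finite F \<Longrightarrow> \<bar>gibbs_avg F f (x F) - (\<integral>y. f y \<partial>\<mu>)\<bar> \<ge> \<epsilon>" by metis
    have "\<forall>h :: ('g \<Rightarrow> 'a) \<Rightarrow> real. \<exists>b. local_fun h \<longrightarrow> (\<forall>y. \<bar>h y\<bar> \<le> b)"
      using local_fun_bounded by metis
    \<comment> \<open>The functionals live in a product of compact intervals, which has a cluster point for the net.\<close>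
    from choice[OF this] obtain b
      where b: "\<And>h y. local_fun h \<Longrightarrow> \<bar>(h :: ('g \<Rightarrow> 'a) \<Rightarrow> real) y\<bar> \<le> b h" by blast
    define K where "K h = (if local_fun h then {- b h .. b h} else {0})" for h :: "('g \<Rightarrow> 'a) \<Rightarrow> real"
    define q where "q F h = (if local_fun h then gibbs_avg F h (x F) else 0)" for F h
    have "compactin (product_topology (\<lambda>_. euclidean) UNIV) (Pi\<^sub>E UNIV K)"
      unfolding compactin_PiE by (simp add: K_def)
    then have K: "compact (Pi\<^sub>E UNIV K)" by (simp add: euclidean_product_topology)
    define Fl where "Fl = filtermap q (finite_subsets_at_top UNIV)"
    have evq: "eventually R Fl" if "finite \<Lambda>" "\<And>F. finite F \<Longrightarrow> \<Lambda> \<subseteq> F \<Longrightarrow> R (q F)" for \<Lambda> R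
      unfolding Fl_def eventually_filtermap eventually_finite_subsets_at_top using that by auto
    have "gibbs_avg F h y \<in> K h" if "finite F" "local_fun h" for F h y
    proof -
      have "gibbs_avg F h y \<le> gibbs_avg F (\<lambda>_. b h) y"
        using b[OF that(2)] by (intro gibbs_avg_mono that) (simp add: abs_le_iff)
      moreover have "gibbs_avg F (\<lambda>_. - b h) y \<le> gibbs_avg F h y"
        using b[OF that(2)] by (intro gibbs_avg_mono that) (metis abs_le_D2 minus_le_iff)
      ultimately show ?thesis using that by (simp add: K_def gibbs_avg_const)
    qed
    then have "eventually (\<lambda>r. r \<in> Pi\<^sub>E UNIV K) Fl"
      by (intro evq[of "{}"]) (auto simp: q_def K_def)
    moreover have "Fl \<noteq> bot" by (simp add: Fl_def filtermap_bot_iff)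
    ultimately obtain p where p: "p \<in> Pi\<^sub>E UNIV K" "inf (nhds p) Fl \<noteq> bot"
      using K unfolding compact_filter by blast
    note cluster = closed_eventually_cluster[OF p(2)]
    have cont: "continuous_on UNIV (\<lambda>r :: (('g \<Rightarrow> 'a) \<Rightarrow> real) \<Rightarrow> real. r h)" for h
      by (rule continuous_on_product_coordinates)
    have p_add: "p (\<lambda>y. h y + k y) = p h + p k" if "local_fun h" "local_fun k" for h k
    proof -
      have "p \<in> {r. r (\<lambda>y. h y + k y) = r h + r k}"
        by (rule cluster, intro closed_Collect_eq continuous_intros cont, rule evq[of "{}"])
           (auto simp: q_def that gibbs_avg_add local_fun_comp2[OF that])
      then show ?thesis by simp
    qed
    have p_cmult: "p (\<lambda>y. c * h y) = c * p h" if "local_fun h" for c h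
    proof -
      have "p \<in> {r. r (\<lambda>y. c * h y) = c * r h}"
        by (rule cluster, intro closed_Collect_eq continuous_intros cont, rule evq[of "{}"])
           (auto simp: q_def that gibbs_avg_cmult local_fun_comp[OF that])
      then show ?thesis by simp
    qed
    have p_one: "p (\<lambda>y. 1) = 1"
    proof -
      have "p \<in> {r. r (\<lambda>y. 1) = 1}"
        by (rule cluster, intro closed_Collect_eq continuous_intros cont, rule evq[of "{}"])
           (auto simp: q_def gibbs_avg_const)
      then show ?thesis by simp
    qed
    have p_nonneg: "p h \<ge> 0" if "local_fun h" "\<And>y. h y \<ge> 0" for h
    proof -
      have "p \<in> {r. 0 \<le> r h}"
        by (rule cluster, intro closed_Collect_le continuous_intros cont, rule evq[of "{}"])
           (auto simp: q_def that gibbs_avg_nonneg)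
      then show ?thesis by simp
    qed
    have p_inv: "p (gibbs_avg \<Lambda> h) = p h" if "finite \<Lambda>" "local_fun h" for \<Lambda> h
    proof -
      have "p \<in> {r. r (gibbs_avg \<Lambda> h) = r h}"
        by (rule cluster, intro closed_Collect_eq continuous_intros cont, rule evq[of \<Lambda>])
           (auto simp: q_def that gibbs_avg_gibbs_avg local_fun_gibbs_avg)
      then show ?thesis by simp
    qed
    have p_bad: "\<bar>p f - (\<integral>y. f y \<partial>\<mu>)\<bar> \<ge> \<epsilon>"
    proof -
      have "p \<in> {r. \<epsilon> \<le> \<bar>r f - (\<integral>y. f y \<partial>\<mu>)\<bar>}"
        by (rule cluster, intro closed_Collect_le continuous_intros cont, rule evq[of "{}"])
           (auto simp: q_def f x)
      then show ?thesis by simp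
    qed
    have p_sum: "p (\<lambda>y. \<Sum>i\<in>I. h i y) = (\<Sum>i\<in>I. p (h i))"
      if "finite I" "\<And>i. i \<in> I \<Longrightarrow> local_fun (h i)" for I :: "('g \<Rightarrow> 'a) set" and h
      using that
    proof (induction rule: finite_induct)
      case empty
      then show ?case using p_cmult[of "\<lambda>_. 0" 0] by simp
    next
      case (insert i I)
      then show ?case using p_add[of "h i" "\<lambda>y. \<Sum>i\<in>I. h i y"] by (simp add: local_fun_sum)
    qed
    have ind: "local_fun (\<lambda>x. of_bool (x \<in> C) :: real)" if "local_fun (\<lambda>x. x \<in> C)" for C :: "('g \<Rightarrow> 'a) set"
      using that by (rule local_fun_comp)
    obtain \<nu> where \<nu>: "\<nu> \<in> space (prob_algebra borel)"
      "\<And>C. local_fun (\<lambda>x. x \<in> C) \<Longrightarrow> measure \<nu> C = p (\<lambda>x. of_bool (x \<in> C))"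
    proof (rule extend_local_content[of "\<lambda>C. p (\<lambda>x. of_bool (x \<in> C))"])
      show "p (\<lambda>x. of_bool (x \<in> C)) \<ge> 0" if "local_fun (\<lambda>x. x \<in> C)" for C
        by (rule p_nonneg) (auto intro: ind that)
      show "p (\<lambda>x. of_bool (x \<in> A \<union> B)) = p (\<lambda>x. of_bool (x \<in> A)) + p (\<lambda>x. of_bool (x \<in> B))"
        if "local_fun (\<lambda>x. x \<in> A)" "local_fun (\<lambda>x. x \<in> B)" "A \<inter> B = {}" for A B
      proof -
        have "(\<lambda>x. of_bool (x \<in> A \<union> B) :: real) = (\<lambda>x. of_bool (x \<in> A) + of_bool (x \<in> B))"
          using that(3) by (auto simp: fun_eq_iff)
        then show ?thesis using p_add[OF ind ind, OF that(1,2)] by simp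
      qed
    qed (use p_one in auto)
    interpret \<nu>: prob_space \<nu> using \<nu>(1) by (simp add: space_prob_algebra)
    have sets: "sets \<nu> = sets borel" using \<nu>(1) by (simp add: space_prob_algebra)
    have space: "space \<nu> = UNIV" using sets_eq_imp_space_eq[OF sets] by simp
    have int: "(\<integral>y. h y \<partial>\<nu>) = p h" if h: "local_fun h" for h
    proof -
      obtain W where W: "finite W" "local_on W h" using h by (rule local_funE)
      note cyl = local_cylinder[OF W(1)]
      let ?c = "\<lambda>u (y :: 'g \<Rightarrow> 'a). of_bool (restrict y W = u) :: real"
      have c: "local_fun (?c u)" for u using ind[OF cyl] by simp
      have hc: "local_fun (\<lambda>y. h u * ?c u y)" for u by (rule local_fun_comp[OF c])
      have cs: "{y :: 'g \<Rightarrow> 'a. restrict y W = u} \<in> sets \<nu>" for u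
        unfolding sets by (rule borel_open, rule open_local, rule cyl)
      have ci: "integrable \<nu> (?c u) \<and> (\<integral>y. ?c u y \<partial>\<nu>) = p (?c u)" for u
      proof -
        have eq: "?c u = indicator {y. restrict y W = u}" by (auto simp: indicator_def)
        have "(\<integral>y. ?c u y \<partial>\<nu>) = measure \<nu> {y. restrict y W = u}"
          unfolding eq by (simp add: space)
        then show ?thesis using \<nu>(2)[OF cyl, of u] cs[of u] by (simp add: eq \<nu>.emeasure_eq_measure)
      qed
      have hs: "h = (\<lambda>y. \<Sum>u\<in>patterns W. h u * ?c u y)"
        using local_on_sum_patterns[OF W] by blast
      have "(\<integral>y. h y \<partial>\<nu>) = (\<integral>y. (\<Sum>u\<in>patterns W. h u * ?c u y) \<partial>\<nu>)" using hs by metis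
      also have "\<dots> = (\<Sum>u\<in>patterns W. h u * p (?c u))" using ci by (subst Bochner_Integration.integral_sum) auto
      also have "\<dots> = p (\<lambda>y. \<Sum>u\<in>patterns W. h u * ?c u y)"
        using W(1) by (subst p_sum) (simp_all add: p_cmult c hc)
      also have "\<dots> = p h" using hs by metis
      finally show ?thesis .
    qed
    have "gibbs_measure \<phi> D \<nu>"
      by (rule gibbs_measureI_local[OF finite_range_potential_axioms \<nu>(1)])
         (simp add: int local_fun_gibbs_avg p_inv)
    with unique p_bad int[OF f] \<open>\<epsilon> > 0\<close> show False by auto
  qed
  with that show ?thesis by blast
qed

section \<open>Gibbs distributions on finite models\<close>

text \<open>At a faithful vertex \<open>v\<close> the map \<open>g \<mapsto> s g v\<close> behaves on \<open>B\<close> like the orbit map of a free action.\<close>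

definition faithful_at :: "('g::plus \<Rightarrow> 'v \<Rightarrow> 'v) \<Rightarrow> 'g set \<Rightarrow> 'v \<Rightarrow> bool" where
  "faithful_at s B v \<longleftrightarrow>
     inj_on (\<lambda>g. s g v) B \<and> (\<forall>g\<in>B. \<forall>h\<in>B. s g (s h v) = s (g + h) v)"

locale finite_model = finite_range_potential \<phi> D
  for \<phi> :: "('g::{countable,group_add} \<Rightarrow> 'a::{finite,discrete_topology}) \<Rightarrow> real" and D +
  fixes V :: "'v set" and s :: "'g \<Rightarrow> 'v \<Rightarrow> 'v"
  assumes finite_V: "finite V" and V_nonempty: "V \<noteq> {}" and permutes: "\<And>g. s g permutes V"
begin

definition model_weight :: "('v \<Rightarrow> 'a) \<Rightarrow> real" where
  "model_weight \<tau> = exp (- (\<Sum>u\<in>V. \<phi> (pullback_name s \<tau> u)))"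

definition model_prob :: "('v \<Rightarrow> 'a) \<Rightarrow> real" where
  "model_prob \<tau> = model_weight \<tau> / (\<Sum>\<tau>'\<in>patterns V. model_weight \<tau>')"

definition expect :: "(('v \<Rightarrow> 'a) \<Rightarrow> real) \<Rightarrow> real" where
  "expect F = (\<Sum>\<tau>\<in>patterns V. model_prob \<tau> * F \<tau>)"

text \<open>A vertex that is faithful on \<open>scope \<Lambda>\<close> represents \<open>\<Lambda>\<close>, the energy terms that see a change inside \<open>\<Lambda>\<close>
  and all coordinates they use without collisions; including \<open>D\<close> makes the products \<open>d + g\<close> with \<open>d \<in> D\<close> and
  \<open>g \<in> reach \<Lambda>\<close> agree with compositions of \<open>s\<close>.\<close>

definition scope :: "'g set \<Rightarrow> 'g set" where
  "scope \<Lambda> = D \<union> reach \<Lambda> \<union> collar \<Lambda> \<union> \<Lambda>"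

definition plant :: "'g set \<Rightarrow> 'v \<Rightarrow> ('g \<Rightarrow> 'a) \<Rightarrow> ('v \<Rightarrow> 'a) \<Rightarrow> 'v \<Rightarrow> 'a" where
  "plant \<Lambda> v w \<tau> u = (if u \<in> (\<lambda>g. s g v) ` \<Lambda> then w (the_inv_into \<Lambda> (\<lambda>g. s g v) u) else \<tau> u)"

lemma model_weight_pos: "model_weight \<tau> > 0"
  by (simp add: model_weight_def)

lemma model_weight_sum_pos: "(\<Sum>\<tau>\<in>patterns V. model_weight \<tau>) > 0"
  by (intro sum_pos) (auto simp: finite_V model_weight_pos)

lemma model_prob_pos: "model_prob \<tau> > 0"
  by (simp add: model_prob_def model_weight_pos model_weight_sum_pos)

lemma sum_model_prob: "(\<Sum>\<tau>\<in>patterns V. model_prob \<tau>) = 1"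
  using model_weight_sum_pos by (simp add: model_prob_def sum_divide_distrib[symmetric])

lemma expect_const [simp]: "expect (\<lambda>\<tau>. c) = c"
  using sum_model_prob by (simp add: expect_def sum_distrib_right[symmetric])

lemma expect_add: "expect (\<lambda>\<tau>. F \<tau> + H \<tau>) = expect F + expect H"
  by (simp add: expect_def algebra_simps sum.distrib)

lemma expect_diff: "expect (\<lambda>\<tau>. F \<tau> - H \<tau>) = expect F - expect H"
  by (simp add: expect_def algebra_simps sum_subtractf)

lemma expect_cmult: "expect (\<lambda>\<tau>. c * F \<tau>) = c * expect F"
  by (simp add: expect_def algebra_simps sum_distrib_left)

lemma expect_sum: "expect (\<lambda>\<tau>. \<Sum>i\<in>I. F i \<tau>) = (\<Sum>i\<in>I. expect (F i))"
  unfolding expect_def sum_distrib_left by (rule sum.swap)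

lemma expect_mono: "(\<And>\<tau>. \<tau> \<in> patterns V \<Longrightarrow> F \<tau> \<le> H \<tau>) \<Longrightarrow> expect F \<le> expect H"
  by (auto simp: expect_def intro!: sum_mono mult_left_mono less_imp_le[OF model_prob_pos])

lemma expect_cong: "(\<And>\<tau>. \<tau> \<in> patterns V \<Longrightarrow> F \<tau> = H \<tau>) \<Longrightarrow> expect F = expect H"
  by (auto simp: expect_def intro!: sum.cong)

lemma finite_scope: "finite \<Lambda> \<Longrightarrow> finite (scope \<Lambda>)"
  by (simp add: scope_def finite_window finite_reach finite_collar)

lemma s_in_V: "v \<in> V \<Longrightarrow> s g v \<in> V"
  using permutes_in_image[OF permutes] by simp

lemma s_inj: "s g u = s g v \<Longrightarrow> u = v"
  using permutes_inj[OF permutes] by (auto dest: injD)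

text \<open>Writing a pattern into the image of \<open>\<Lambda>\<close> around \<open>v\<close> is seen from \<open>v\<close> as overwriting \<open>\<Lambda>\<close>, on every
  window that is mapped injectively.\<close>

lemma plant_image:
  assumes "inj_on (\<lambda>g. s g v) B" "\<Lambda> \<subseteq> B" "h \<in> B"
  shows "plant \<Lambda> v w \<tau> (s h v) = override_on (pullback_name s \<tau> v) w \<Lambda> h"
proof (cases "h \<in> \<Lambda>")
  case True
  have "inj_on (\<lambda>g. s g v) \<Lambda>" using assms inj_on_subset by blast
  then have "the_inv_into \<Lambda> (\<lambda>g. s g v) (s h v) = h" by (rule the_inv_into_f_f) (rule True)
  with True show ?thesis by (auto simp: plant_def)
next
  case False
  then have "s h v \<notin> (\<lambda>g. s g v) ` \<Lambda>"
    using assms by (auto dest: inj_onD)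
  with False show ?thesis by (simp add: plant_def pullback_name_def)
qed

lemma plant_off: "u \<notin> (\<lambda>g. s g v) ` \<Lambda> \<Longrightarrow> plant \<Lambda> v w \<tau> u = \<tau> u"
  by (simp add: plant_def)

lemma plant_plant: "plant \<Lambda> v w' (plant \<Lambda> v w \<tau>) = plant \<Lambda> v w' \<tau>"
  by (auto simp: plant_def fun_eq_iff)

lemma plant_patterns: "v \<in> V \<Longrightarrow> \<tau> \<in> patterns V \<Longrightarrow> plant \<Lambda> v w \<tau> \<in> patterns V"
  using s_in_V by (auto simp: plant_def PiE_def extensional_def)

lemma plant_restrict:
  assumes "inj_on (\<lambda>g. s g v) \<Lambda>"
  shows "plant \<Lambda> v (restrict (pullback_name s \<tau> v) \<Lambda>) \<tau> = \<tau>"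
proof
  fix u show "plant \<Lambda> v (restrict (pullback_name s \<tau> v) \<Lambda>) \<tau> u = \<tau> u"
    using plant_image[OF assms subset_refl] plant_off
    by (cases "u \<in> (\<lambda>g. s g v) ` \<Lambda>") (auto simp: pullback_name_def)
qed

text \<open>Near a faithful vertex the finite model has the same conditional weights as the infinite
  configuration space: only the vertices \<open>s g v\<close> with \<open>g \<in> reach \<Lambda>\<close> contribute energy terms that see
  the change, and their local views are translates of the view from \<open>v\<close>.\<close>

lemma model_weight_ratio:
  assumes v: "v \<in> V" "faithful_at s B v" "scope \<Lambda> \<subseteq> B" and "finite \<Lambda>"
    and off: "\<And>u. u \<notin> (\<lambda>g. s g v) ` \<Lambda> \<Longrightarrow> \<tau>' u = \<tau> u"
  shows "model_weight \<tau>' * weight \<Lambda> (pullback_name s \<tau> v)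
       = model_weight \<tau> * weight \<Lambda> (pullback_name s \<tau>' v)"
proof -
  let ?K = "(\<lambda>g. s g v) ` reach \<Lambda>"
  have inj: "inj_on (\<lambda>g. s g v) B" and mult: "\<And>g h. g \<in> B \<Longrightarrow> h \<in> B \<Longrightarrow> s g (s h v) = s (g + h) v"
    using v(2) by (auto simp: faithful_at_def)
  have B: "D \<subseteq> B" "reach \<Lambda> \<subseteq> B" "\<Lambda> \<subseteq> B" using v(3) by (auto simp: scope_def)
  have injK: "inj_on (\<lambda>g. s g v) (reach \<Lambda>)" using inj B inj_on_subset by blast
  have KV: "?K \<subseteq> V" using s_in_V[OF v(1)] by auto
  have split: "(\<Sum>u\<in>V. \<phi> (pullback_name s \<rho> u)) =
      (\<Sum>u\<in>V - ?K. \<phi> (pullback_name s \<rho> u)) + (\<Sum>g\<in>reach \<Lambda>. \<phi> (shift g (pullback_name s \<rho> v)))" for \<rho>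
  proof -
    have "\<phi> (pullback_name s \<rho> (s g v)) = \<phi> (shift g (pullback_name s \<rho> v))" if "g \<in> reach \<Lambda>" for g
      by (rule potential_cong) (use that mult B in \<open>auto simp: pullback_name_def shift_def subset_iff\<close>)
    then have "(\<Sum>u\<in>?K. \<phi> (pullback_name s \<rho> u)) = (\<Sum>g\<in>reach \<Lambda>. \<phi> (shift g (pullback_name s \<rho> v)))"
      by (simp add: sum.reindex[OF injK])
    then show ?thesis using sum.subset_diff[OF KV finite_V] by metis
  qed
  have far: "(\<Sum>u\<in>V - ?K. \<phi> (pullback_name s \<tau>' u)) = (\<Sum>u\<in>V - ?K. \<phi> (pullback_name s \<tau> u))"
  proof (rule sum.cong)
    fix u assume u: "u \<in> V - ?K"
    have "s d u \<notin> (\<lambda>g. s g v) ` \<Lambda>" if d: "d \<in> D" for d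
    proof
      assume "s d u \<in> (\<lambda>g. s g v) ` \<Lambda>"
      then obtain k where k: "k \<in> \<Lambda>" "s d u = s k v" by auto
      let ?g = "- d + k"
      have dg: "d + ?g = k" by (simp add: add.assoc[symmetric])
      then have g: "?g \<in> reach \<Lambda>" using d k by (auto simp: reach_def)
      then have "s d (s ?g v) = s k v" using mult[of d ?g] B d dg by auto
      then have "u = s ?g v" using k(2) s_inj[of d] by simp
      with u g show False by auto
    qed
    then show "\<phi> (pullback_name s \<tau>' u) = \<phi> (pullback_name s \<tau> u)"
      by (intro potential_cong) (auto simp: pullback_name_def intro!: off)
  qed auto
  show ?thesis
    by (simp add: model_weight_def weight_eq split far exp_add[symmetric])
qed

lemma pullback_plant:
  assumes "faithful_at s B v" "\<Lambda> \<subseteq> B" "local_on W f" "W \<subseteq> B"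
  shows "f (pullback_name s (plant \<Lambda> v w \<tau>) v) = f (override_on (pullback_name s \<tau> v) w \<Lambda>)"
proof (rule local_onD[OF assms(3)])
  fix g assume "g \<in> W"
  then show "pullback_name s (plant \<Lambda> v w \<tau>) v g = override_on (pullback_name s \<tau> v) w \<Lambda> g"
    using plant_image[of v B \<Lambda> g w \<tau>] assms by (auto simp: faithful_at_def pullback_name_def)
qed

text \<open>The finite model satisfies the defining identity of a Gibbs measure at every faithful vertex: the
  image of \<open>\<Lambda>\<close> around \<open>v\<close> may be resampled from the infinite-volume specification.\<close>

lemma expect_plant:
  assumes v: "v \<in> V" "faithful_at s B v" "scope \<Lambda> \<subseteq> B" and fin: "finite \<Lambda>"
  shows "expect (\<lambda>\<tau>. \<Sum>w\<in>patterns \<Lambda>. spec \<Lambda> (pullback_name s \<tau> v) w * F (plant \<Lambda> v w \<tau>)) = expect F"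
proof -
  have \<Lambda>B: "\<Lambda> \<subseteq> B" using v(3) by (auto simp: scope_def)
  have inj: "inj_on (\<lambda>g. s g v) B" using v(2) by (auto simp: faithful_at_def)
  then have inj\<Lambda>: "inj_on (\<lambda>g. s g v) \<Lambda>" using \<Lambda>B inj_on_subset by blast
  let ?R = "\<lambda>w. plant \<Lambda> v w"
  have w: "weight \<Lambda> (pullback_name s (?R w \<tau>) v) = weight \<Lambda> (override_on (pullback_name s \<tau> v) w \<Lambda>)" for w \<tau>
    by (rule pullback_plant[OF v(2) \<Lambda>B local_on_weight]) (use v(3) in \<open>auto simp: scope_def\<close>)
  have sp: "spec \<Lambda> (pullback_name s \<tau> v) w =
      model_prob (?R w \<tau>) / (\<Sum>w'\<in>patterns \<Lambda>. model_prob (?R w' \<tau>))" for w \<tau>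
  proof -
    let ?c = "model_weight \<tau> / weight \<Lambda> (pullback_name s \<tau> v) / (\<Sum>\<tau>'\<in>patterns V. model_weight \<tau>')"
    have *: "model_prob (?R w' \<tau>) = ?c * weight \<Lambda> (override_on (pullback_name s \<tau> v) w' \<Lambda>)" for w'
    proof -
      have "model_weight (?R w' \<tau>) =
          model_weight \<tau> / weight \<Lambda> (pullback_name s \<tau> v) * weight \<Lambda> (override_on (pullback_name s \<tau> v) w' \<Lambda>)"
        using model_weight_ratio[OF v fin, of "?R w' \<tau>" \<tau>] plant_off[of _ v \<Lambda> w' \<tau>]
          weight_pos[of \<Lambda> "pullback_name s \<tau> v"]
        by (simp add: w field_simps)
      then show ?thesis by (simp add: model_prob_def)
    qed
    have nz: "?c \<noteq> 0"
      using model_weight_pos weight_pos model_weight_sum_pos by (metis divide_pos_pos less_irrefl)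
    show ?thesis unfolding spec_def
      by (simp only: * sum_distrib_left[symmetric] mult_divide_mult_cancel_left[OF nz])
  qed
  have "(\<Sum>\<tau>\<in>patterns V. model_prob \<tau> *
      (\<Sum>w\<in>patterns \<Lambda>. model_prob (?R w \<tau>) / (\<Sum>w'\<in>patterns \<Lambda>. model_prob (?R w' \<tau>)) * F (?R w \<tau>)))
    = (\<Sum>\<tau>\<in>patterns V. model_prob \<tau> * F \<tau>)"
  proof (rule sum_resampling[where c = "\<lambda>\<tau>. restrict (pullback_name s \<tau> v) \<Lambda>"])
    fix w :: "'g \<Rightarrow> 'a" and \<tau> :: "'v \<Rightarrow> 'a" assume "w \<in> patterns \<Lambda>" "\<tau> \<in> patterns V"
    then show "restrict (pullback_name s (?R w \<tau>) v) \<Lambda> = w"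
      using plant_image[OF inj\<Lambda> subset_refl]
      by (intro patterns_eqI[of _ \<Lambda>]) (auto simp: pullback_name_def)
  next
    show "?R (restrict (pullback_name s \<tau> v) \<Lambda>) \<tau> = \<tau>" for \<tau>
      by (rule plant_restrict[OF inj\<Lambda>])
  qed (use fin finite_V in \<open>auto simp: plant_patterns v plant_plant model_prob_pos\<close>)
  then show ?thesis by (simp add: expect_def sp)
qed

text \<open>Averaging over the pattern around \<open>v\<close> replaces \<open>f\<close> by its finite-volume Gibbs average, next to any
  factor that is unaffected by changes around \<open>v\<close>.\<close>

lemma expect_gibbs_avg:
  assumes v: "v \<in> V" "faithful_at s B v" "scope \<Lambda> \<subseteq> B" and fin: "finite \<Lambda>"
    and f: "local_on W f" "W \<subseteq> B" and H: "\<And>w \<tau>. H (plant \<Lambda> v w \<tau>) = H \<tau>"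
  shows "expect (\<lambda>\<tau>. f (pullback_name s \<tau> v) * H \<tau>)
       = expect (\<lambda>\<tau>. gibbs_avg \<Lambda> f (pullback_name s \<tau> v) * H \<tau>)"
proof -
  have \<Lambda>B: "\<Lambda> \<subseteq> B" using v(3) by (auto simp: scope_def)
  show ?thesis
    unfolding expect_plant[OF v fin, of "\<lambda>\<tau>. f (pullback_name s \<tau> v) * H \<tau>", symmetric]
    by (simp add: pullback_plant[OF v(2) \<Lambda>B f] H gibbs_avg_def sum_distrib_right mult.assoc)
qed

definition empirical_avg :: "(('g \<Rightarrow> 'a) \<Rightarrow> real) \<Rightarrow> ('v \<Rightarrow> 'a) \<Rightarrow> real" where
  "empirical_avg f \<tau> = (\<Sum>v\<in>V. f (pullback_name s \<tau> v)) / card V"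

text \<open>If the Gibbs averages of \<open>f\<close> over \<open>F\<close> hardly depend on the boundary condition, then the
  values of \<open>f\<close> seen from a faithful vertex and from any vertex that is far away from it are almost
  uncorrelated, so the empirical average has small variance around the common value \<open>c\<close>.\<close>

lemma empirical_avg_variance:
  assumes f: "local_on W f" "finite W" "\<And>x. \<bar>f x\<bar> \<le> b" and c: "\<bar>c\<bar> \<le> b" and "b \<ge> 0"
    and F: "finite F" "\<And>x. \<bar>gibbs_avg F f x - c\<bar> \<le> \<epsilon>"
    and B: "scope F \<union> W \<subseteq> B"
  shows "expect (\<lambda>\<tau>. (empirical_avg f \<tau> - c)\<^sup>2)
    \<le> 2 * b * \<epsilon> + 4 * b\<^sup>2 * (card {v \<in> V. \<not> faithful_at s B v} / card V + card W * card F / card V)"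
proof -
  define X where "X v \<tau> = f (pullback_name s \<tau> v) - c" for v \<tau>
  define n where "n = real (card V)"
  have n: "n > 0" using finite_V V_nonempty by (simp add: n_def card_gt_0_iff)
  have \<epsilon>: "\<epsilon> \<ge> 0" using F(2)[of undefined] by linarith
  have X_bound: "\<bar>X v \<tau>\<bar> \<le> 2 * b" for v \<tau>
    using f(3)[of "pullback_name s \<tau> v"] c by (simp add: X_def abs_le_iff)
  \<comment> \<open>The vertices whose window meets the image of \<open>F\<close> around \<open>v\<close>; their number is bounded uniformly in \<open>V\<close>.\<close>
  define near where "near v = {u \<in> V. (\<lambda>g. s g u) ` W \<inter> (\<lambda>g. s g v) ` F \<noteq> {}}" for v
  have near: "card (near v) \<le> card W * card F" for v
  proof -
    have "near v \<subseteq> (\<lambda>(g, h). inv (s g) (s h v)) ` (W \<times> F)"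
    proof
      fix u assume "u \<in> near v"
      then obtain g h where "g \<in> W" "h \<in> F" "s g u = s h v" by (auto simp: near_def)
      moreover from this have "u = inv (s g) (s h v)"
        using permutes_inverses(2)[OF permutes] by metis
      ultimately show "u \<in> (\<lambda>(g, h). inv (s g) (s h v)) ` (W \<times> F)" by force
    qed
    then have "card (near v) \<le> card (W \<times> F)"
      using F(1) f(2) by (meson card_image_le card_mono finite_SigmaI finite_imageI le_trans)
    then show ?thesis by (simp add: card_cartesian_product)
  qed
  have trivial: "expect (\<lambda>\<tau>. X v \<tau> * X u \<tau>) \<le> 4 * b\<^sup>2" for u v
  proof -
    have "X v \<tau> * X u \<tau> \<le> (2 * b) * (2 * b)" for \<tau>
      using mult_mono[OF X_bound[of v \<tau>] X_bound[of u \<tau>]] \<open>b \<ge> 0\<close>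
      by (simp add: abs_mult[symmetric])
    then have "expect (\<lambda>\<tau>. X v \<tau> * X u \<tau>) \<le> expect (\<lambda>\<tau>. (2 * b) * (2 * b))" by (rule expect_mono)
    then show ?thesis by (simp add: power2_eq_square)
  qed
  have decor: "expect (\<lambda>\<tau>. X v \<tau> * X u \<tau>) \<le> 2 * b * \<epsilon>"
    if v: "v \<in> V" "faithful_at s B v" and u: "u \<in> V - near v" for u v
  proof -
    have B': "scope F \<subseteq> B" "W \<subseteq> B" using B by auto
    have inv: "X u (plant F v w \<tau>) = X u \<tau>" for w \<tau>
    proof -
      have "f (pullback_name s (plant F v w \<tau>) u) = f (pullback_name s \<tau> u)"
        by (rule local_onD[OF f(1)]) (use u in \<open>auto simp: pullback_name_def near_def intro!: plant_off\<close>)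
      then show ?thesis by (simp add: X_def)
    qed
    have "expect (\<lambda>\<tau>. X v \<tau> * X u \<tau>) = expect (\<lambda>\<tau>. f (pullback_name s \<tau> v) * X u \<tau>) - c * expect (X u)"
      by (simp add: X_def[of v] algebra_simps expect_diff expect_cmult[symmetric])
    also have "\<dots> = expect (\<lambda>\<tau>. gibbs_avg F f (pullback_name s \<tau> v) * X u \<tau>) - c * expect (X u)"
      by (simp add: expect_gibbs_avg[OF v B'(1) F(1) f(1) B'(2) inv])
    also have "\<dots> = expect (\<lambda>\<tau>. (gibbs_avg F f (pullback_name s \<tau> v) - c) * X u \<tau>)"
      by (simp add: algebra_simps expect_diff expect_cmult[symmetric])
    also have "\<dots> \<le> expect (\<lambda>\<tau>. \<epsilon> * (2 * b))"
    proof (rule expect_mono)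
      fix \<tau>
      have "(gibbs_avg F f (pullback_name s \<tau> v) - c) * X u \<tau>
          \<le> \<bar>gibbs_avg F f (pullback_name s \<tau> v) - c\<bar> * \<bar>X u \<tau>\<bar>"
        by (simp add: abs_mult[symmetric])
      also have "\<dots> \<le> \<epsilon> * (2 * b)" by (intro mult_mono F(2) X_bound \<epsilon>) simp
      finally show "(gibbs_avg F f (pullback_name s \<tau> v) - c) * X u \<tau> \<le> \<epsilon> * (2 * b)" .
    qed
    finally show ?thesis by (simp add: mult.commute)
  qed
  have row: "(\<Sum>u\<in>V. expect (\<lambda>\<tau>. X v \<tau> * X u \<tau>))
      \<le> n * (2 * b * \<epsilon>) + 4 * b\<^sup>2 * (card W * card F) + of_bool (\<not> faithful_at s B v) * (4 * b\<^sup>2 * n)"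
    if v: "v \<in> V" for v
  proof (cases "faithful_at s B v")
    case True
    have "(\<Sum>u\<in>V. expect (\<lambda>\<tau>. X v \<tau> * X u \<tau>))
        = (\<Sum>u\<in>V - near v. expect (\<lambda>\<tau>. X v \<tau> * X u \<tau>)) + (\<Sum>u\<in>near v. expect (\<lambda>\<tau>. X v \<tau> * X u \<tau>))"
      by (rule sum.subset_diff) (auto simp: near_def finite_V)
    also have "\<dots> \<le> card (V - near v) * (2 * b * \<epsilon>) + card (near v) * (4 * b\<^sup>2)"
      using decor[OF v True] trivial by (intro add_mono sum_bounded_above) auto
    also have "\<dots> \<le> n * (2 * b * \<epsilon>) + real (card W * card F) * (4 * b\<^sup>2)"
      unfolding n_def using near[of v] \<epsilon> \<open>b \<ge> 0\<close> finite_V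
      by (intro add_mono mult_right_mono) (auto intro!: card_mono simp del: of_nat_mult)
    finally show ?thesis using True by (simp add: mult.commute)
  next
    case False
    have "(\<Sum>u\<in>V. expect (\<lambda>\<tau>. X v \<tau> * X u \<tau>)) \<le> n * (4 * b\<^sup>2)"
      unfolding n_def using trivial by (intro sum_bounded_above) auto
    moreover have "0 \<le> n * (2 * b * \<epsilon>) + 4 * b\<^sup>2 * (card W * card F)"
      using n \<epsilon> \<open>b \<ge> 0\<close> by simp
    ultimately show ?thesis using False by (simp add: algebra_simps)
  qed
  have "(empirical_avg f \<tau> - c)\<^sup>2 = (\<Sum>v\<in>V. \<Sum>u\<in>V. X v \<tau> * X u \<tau>) / n\<^sup>2" for \<tau>
  proof -
    have "(\<Sum>v\<in>V. X v \<tau>) / n = empirical_avg f \<tau> - c"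
      using n by (simp add: X_def sum_subtractf empirical_avg_def diff_divide_distrib n_def[symmetric])
    then show ?thesis by (metis power_divide power2_eq_square sum_product)
  qed
  then have "expect (\<lambda>\<tau>. (empirical_avg f \<tau> - c)\<^sup>2) = (\<Sum>v\<in>V. \<Sum>u\<in>V. expect (\<lambda>\<tau>. X v \<tau> * X u \<tau>)) / n\<^sup>2"
    by (simp add: expect_sum divide_inverse_commute expect_cmult)
  also have "\<dots> \<le> (\<Sum>v\<in>V. n * (2 * b * \<epsilon>) + 4 * b\<^sup>2 * (card W * card F)
      + of_bool (\<not> faithful_at s B v) * (4 * b\<^sup>2 * n)) / n\<^sup>2"
    by (intro divide_right_mono sum_mono row) auto
  also have "\<dots> = (n * (n * (2 * b * \<epsilon>)) + n * (4 * b\<^sup>2 * (card W * card F))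
      + card {v \<in> V. \<not> faithful_at s B v} * (4 * b\<^sup>2 * n)) / n\<^sup>2"
  proof -
    have "(\<Sum>v\<in>V. of_bool (\<not> faithful_at s B v) :: real) = card {v \<in> V. \<not> faithful_at s B v}"
      using finite_V by (simp add: sum.If_cases of_bool_def Int_def)
    then show ?thesis by (simp add: sum.distrib sum_distrib_right[symmetric] n_def[symmetric] distrib_left)
  qed
  also have "\<dots> = 2 * b * \<epsilon> + 4 * b\<^sup>2 * (card {v \<in> V. \<not> faithful_at s B v} / n + card W * card F / n)"
    using n by (simp add: field_simps power2_eq_square)
  finally show ?thesis by (simp only: n_def)
qed

end

section \<open>Entropy of the finite models\<close>

definition eta :: "real \<Rightarrow> real" where
  "eta t = - t * ln t"

lemma eta_nonneg: "0 \<le> t \<Longrightarrow> t \<le> 1 \<Longrightarrow> eta t \<ge> 0"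
  by (cases "t = 0") (auto simp: eta_def mult_nonneg_nonpos ln_le_zero_iff)

lemma eta_le_one: "0 \<le> t \<Longrightarrow> eta t \<le> 1"
proof (cases "t = 0")
  case False
  assume "0 \<le> t"
  with False have t: "t > 0" by simp
  have "ln (1 / t) \<le> 1 / t - 1" using t by (intro ln_le_minus_one) simp
  then have "t * ln (1 / t) \<le> t * (1 / t - 1)" using t by (intro mult_left_mono) auto
  with t show ?thesis by (simp add: eta_def ln_div algebra_simps)
qed (simp add: eta_def)

context finite_range_potential
begin

text \<open>For a Gibbs measure \<open>origin_prob \<Lambda> a\<close> is a version of the conditional probability of the symbol \<open>a\<close> at
  the identity given the coordinates outside \<open>\<Lambda>\<close>, and \<open>origin_entropy \<Lambda>\<close> is the entropy of this conditional
  distribution.  These versions are local functions.\<close>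

definition origin_prob :: "'g set \<Rightarrow> 'a \<Rightarrow> ('g \<Rightarrow> 'a) \<Rightarrow> real" where
  "origin_prob \<Lambda> a = gibbs_avg \<Lambda> (\<lambda>y. of_bool (y 0 = a))"

definition origin_entropy :: "'g set \<Rightarrow> ('g \<Rightarrow> 'a) \<Rightarrow> real" where
  "origin_entropy \<Lambda> x = (\<Sum>a\<in>UNIV. eta (origin_prob \<Lambda> a x))"

lemma local_on_origin_prob: "local_on (collar \<Lambda> \<union> {0} - \<Lambda>) (origin_prob \<Lambda> a)"
  unfolding origin_prob_def by (rule local_on_gibbs_avg) (auto simp: local_on_def)

lemma local_on_origin_entropy: "local_on (collar \<Lambda> \<union> {0} - \<Lambda>) (origin_entropy \<Lambda>)"
  unfolding origin_entropy_def[abs_def]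
  by (rule local_onI) (metis (no_types, lifting) local_onD[OF local_on_origin_prob])

lemma local_fun_origin_prob: "finite \<Lambda> \<Longrightarrow> local_fun (origin_prob \<Lambda> a)"
  by (rule local_funI[OF _ local_on_origin_prob]) (simp add: finite_collar)

lemma local_fun_origin_entropy: "finite \<Lambda> \<Longrightarrow> local_fun (origin_entropy \<Lambda>)"
  by (rule local_funI[OF _ local_on_origin_entropy]) (simp add: finite_collar)

lemma origin_prob_nonneg: "finite \<Lambda> \<Longrightarrow> origin_prob \<Lambda> a x \<ge> 0"
  unfolding origin_prob_def by (rule gibbs_avg_nonneg) auto

lemma gibbs_avg_function_of_origin:
  "gibbs_avg \<Lambda> (\<lambda>y. G (y 0)) x = (\<Sum>a\<in>UNIV. origin_prob \<Lambda> a x * G a)"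
proof -
  have "(\<lambda>y. G (y 0)) = (\<lambda>y. \<Sum>a\<in>UNIV. G a * of_bool (y 0 = a))"
    by (auto simp: fun_eq_iff of_bool_def if_distrib cong: if_cong)
  then have "gibbs_avg \<Lambda> (\<lambda>y. G (y 0)) x = gibbs_avg \<Lambda> (\<lambda>y. \<Sum>a\<in>UNIV. G a * of_bool (y 0 = a)) x"
    by (rule arg_cong)
  also have "\<dots> = (\<Sum>a\<in>UNIV. G a * gibbs_avg \<Lambda> (\<lambda>y. of_bool (y 0 = a)) x)"
    by (simp only: gibbs_avg_sum gibbs_avg_cmult)
  finally show ?thesis by (simp only: origin_prob_def mult.commute)
qed

lemma sum_origin_prob: "finite \<Lambda> \<Longrightarrow> (\<Sum>a\<in>UNIV. origin_prob \<Lambda> a x) = 1"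
  using gibbs_avg_function_of_origin[of \<Lambda> "\<lambda>_. 1" x] by (simp add: gibbs_avg_const)

lemma origin_prob_le_one: "finite \<Lambda> \<Longrightarrow> origin_prob \<Lambda> a x \<le> 1"
  using member_le_sum[of a UNIV "\<lambda>a. origin_prob \<Lambda> a x"] sum_origin_prob[of \<Lambda> x] origin_prob_nonneg
  by auto

lemma origin_prob_pos:
  assumes "finite \<Lambda>" "0 \<in> \<Lambda>" shows "origin_prob \<Lambda> a x > 0"
proof -
  let ?w = "restrict (\<lambda>_. a) \<Lambda>"
  have "0 < spec \<Lambda> x ?w * of_bool (override_on x ?w \<Lambda> 0 = a)" using assms by (simp add: spec_pos)
  also have "\<dots> \<le> origin_prob \<Lambda> a x"
    unfolding origin_prob_def gibbs_avg_def
    using assms by (intro member_le_sum) (auto intro: less_imp_le[OF spec_pos])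
  finally show ?thesis .
qed

lemma origin_entropy_nonneg: "finite \<Lambda> \<Longrightarrow> origin_entropy \<Lambda> x \<ge> 0"
  by (auto simp: origin_entropy_def intro!: sum_nonneg eta_nonneg origin_prob_nonneg origin_prob_le_one)

lemma origin_entropy_le: "finite \<Lambda> \<Longrightarrow> origin_entropy \<Lambda> x \<le> CARD('a)"
  unfolding origin_entropy_def
  using sum_bounded_above[of UNIV "\<lambda>a. eta (origin_prob \<Lambda> a x)" 1] by (simp add: eta_le_one origin_prob_nonneg)

end

context finite_model
begin

definition marginal :: "'v set \<Rightarrow> ('v \<Rightarrow> 'a) \<Rightarrow> real" where
  "marginal W \<tau> = expect (\<lambda>\<rho>. of_bool (\<forall>u\<in>W. \<rho> u = \<tau> u))"

definition entropy_on :: "'v set \<Rightarrow> real" where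
  "entropy_on W = expect (\<lambda>\<tau>. - ln (marginal W \<tau>))"

lemma marginal_cong:
  assumes "\<And>u. u \<in> W \<Longrightarrow> \<tau> u = \<tau>' u" shows "marginal W \<tau> = marginal W \<tau>'"
proof -
  have "(\<forall>u\<in>W. \<rho> u = \<tau> u) \<longleftrightarrow> (\<forall>u\<in>W. \<rho> u = \<tau>' u)" for \<rho> using assms by auto
  then show ?thesis by (simp add: marginal_def)
qed

lemma model_prob_le_marginal:
  assumes "\<tau> \<in> patterns V" shows "model_prob \<tau> \<le> marginal W \<tau>"
proof -
  have "model_prob \<tau> * of_bool (\<forall>u\<in>W. \<tau> u = \<tau> u) \<le> marginal W \<tau>"
    unfolding marginal_def expect_def using assms
    by (intro member_le_sum) (auto intro: less_imp_le[OF model_prob_pos] simp: finite_V)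
  then show ?thesis by simp
qed

lemma marginal_pos: "\<tau> \<in> patterns V \<Longrightarrow> marginal W \<tau> > 0"
  using model_prob_le_marginal model_prob_pos less_le_trans by blast

lemma marginal_antimono: "W \<subseteq> W' \<Longrightarrow> marginal W' \<tau> \<le> marginal W \<tau>"
  unfolding marginal_def by (rule expect_mono) auto

lemma marginal_empty: "marginal {} \<tau> = 1"
  by (simp add: marginal_def)

lemma marginal_all: assumes "\<tau> \<in> patterns V" shows "marginal V \<tau> = model_prob \<tau>"
proof -
  have "marginal V \<tau> = (\<Sum>\<rho>\<in>patterns V. if \<rho> = \<tau> then model_prob \<tau> else 0)"
    unfolding marginal_def expect_def using assms
    by (intro sum.cong) (auto intro: patterns_eqI)
  then show ?thesis using assms finite_V by (simp add: sum.delta)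
qed

lemma sum_marginal_insert:
  assumes "v \<notin> W"
  shows "(\<Sum>a\<in>UNIV. marginal (insert v W) (\<tau>(v := a))) = marginal W \<tau>"
proof -
  have "(\<Sum>a\<in>UNIV. of_bool (\<forall>u\<in>insert v W. \<rho> u = (\<tau>(v := a)) u)) = (of_bool (\<forall>u\<in>W. \<rho> u = \<tau> u) :: real)" for \<rho> :: "'v \<Rightarrow> 'a"
  proof -
    have "(\<forall>u\<in>insert v W. \<rho> u = (\<tau>(v := a)) u) \<longleftrightarrow> \<rho> v = a \<and> (\<forall>u\<in>W. \<rho> u = \<tau> u)" for a
      using assms by auto
    then show ?thesis by (simp add: of_bool_conj sum_distrib_right[symmetric] of_bool_def[of "_ = _"])
  qed
  then show ?thesis by (simp add: marginal_def expect_sum[symmetric])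
qed

text \<open>Removing the element of \<open>U\<close> with the largest label removes exactly one term of the sum and leaves the
  others unchanged, so the sum telescopes.\<close>

lemma entropy_chain_rule:
  fixes r :: "'v \<Rightarrow> real"
  assumes "finite U" "inj_on r U"
  shows "entropy_on U = (\<Sum>v\<in>U. entropy_on (insert v {u \<in> U. r u < r v}) - entropy_on {u \<in> U. r u < r v})"
  using assms
proof (induction U rule: finite_ranking_induct[where f = r])
  case empty
  show ?case by (simp add: entropy_on_def marginal_empty)
next
  case (insert x S)
  show ?case
  proof (cases "x \<in> S")
    case True
    then show ?thesis using insert by (simp add: insert_absorb)
  next
    case False
    have lt: "r y < r x" if "y \<in> S" for y
      using insert.hyps(2)[OF that] insert.prems that False by (auto simp: inj_on_def less_le)
    have "{u \<in> insert x S. r u < r x} = S" using lt by auto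
    moreover have "{u \<in> insert x S. r u < r v} = {u \<in> S. r u < r v}" if "v \<in> S" for v
      using lt[OF that] by auto
    moreover have "entropy_on S = (\<Sum>v\<in>S. entropy_on (insert v {u \<in> S. r u < r v}) - entropy_on {u \<in> S. r u < r v})"
      using insert by (auto simp: inj_on_def)
    ultimately show ?thesis using False insert.hyps(1) by simp
  qed
qed

lemma entropy_increment_nonneg: "entropy_on (insert v W) - entropy_on W \<ge> 0"
proof -
  have "entropy_on W \<le> entropy_on (insert v W)"
    unfolding entropy_on_def
    by (rule expect_mono) (simp add: marginal_pos marginal_antimono subset_insertI)
  then show ?thesis by simp
qed

text \<open>Conditioning on less increases entropy.  The conditional distribution at \<open>v\<close> given everything
  outside the image of \<open>\<Lambda>\<close> is \<open>origin_prob \<Lambda>\<close>, seen from \<open>v\<close>; comparing it with the conditional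
  distribution given \<open>W\<close> by means of \<open>ln t \<ge> 1 - 1 / t\<close>, the error term has expectation zero, because
  both are probability distributions on the alphabet.\<close>

lemma entropy_increment_ge:
  assumes v: "v \<in> V" "faithful_at s B v" "scope \<Lambda> \<subseteq> B" and \<Lambda>: "finite \<Lambda>" "0 \<in> \<Lambda>"
    and s0: "s 0 v = v" and W: "W \<inter> (\<lambda>g. s g v) ` \<Lambda> = {}"
  shows "expect (\<lambda>\<tau>. origin_entropy \<Lambda> (pullback_name s \<tau> v)) \<le> entropy_on (insert v W) - entropy_on W"
proof -
  let ?x = "\<lambda>\<tau>. pullback_name s \<tau> v"
  let ?R = "plant \<Lambda> v"
  define q where "q a \<tau> = origin_prob \<Lambda> a (?x \<tau>)" for a \<tau>
  have \<Lambda>B: "\<Lambda> \<subseteq> B" using v(3) by (auto simp: scope_def)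
  have inj: "inj_on (\<lambda>g. s g v) \<Lambda>" using v(2) \<Lambda>B inj_on_subset by (auto simp: faithful_at_def)
  have vW: "v \<notin> W"
  proof -
    have "v \<in> (\<lambda>g. s g v) ` \<Lambda>" using \<Lambda>(2) s0 by (metis imageI)
    with W show ?thesis by auto
  qed
  have qpos: "q a \<tau> > 0" for a \<tau> by (simp add: q_def origin_prob_pos \<Lambda>)
  have Rv: "?R w \<tau> v = w 0" for w \<tau>
    using plant_image[OF inj subset_refl \<Lambda>(2), of w \<tau>] \<Lambda>(2) by (simp add: s0)
  have Rq: "q a (?R w \<tau>) = q a \<tau>" for a w \<tau>
  proof -
    have "q a (?R w \<tau>) = origin_prob \<Lambda> a (override_on (?x \<tau>) w \<Lambda>)"
      unfolding q_def using v(3) \<Lambda>(2)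
      by (intro pullback_plant[OF v(2) \<Lambda>B local_on_origin_prob]) (auto simp: scope_def)
    also have "\<dots> = q a \<tau>"
      unfolding q_def by (rule local_onD[OF local_on_origin_prob]) auto
    finally show ?thesis .
  qed
  have RW: "marginal W (?R w \<tau>) = marginal W \<tau>" for w \<tau>
    by (rule marginal_cong, rule plant_off) (use W in auto)
  have RWv: "marginal (insert v W) (?R w \<tau>) = marginal (insert v W) (\<tau>(v := w 0))" for w \<tau>
    by (rule marginal_cong) (use W Rv vW in \<open>auto intro!: plant_off\<close>)
  \<comment> \<open>Resampling around \<open>v\<close> affects only the symbol at \<open>v\<close> here, and that symbol has law \<open>q\<close>.\<close>
  have resample: "expect (\<lambda>\<tau>. F (\<tau> v) \<tau>) = expect (\<lambda>\<tau>. \<Sum>a\<in>UNIV. q a \<tau> * G a \<tau>)"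
    if "\<And>w \<tau>. F (w 0) (?R w \<tau>) = G (w 0) \<tau>" for F G :: "'a \<Rightarrow> ('v \<Rightarrow> 'a) \<Rightarrow> real"
  proof -
    have "expect (\<lambda>\<tau>. F (\<tau> v) \<tau>) = expect (\<lambda>\<tau>. \<Sum>w\<in>patterns \<Lambda>. spec \<Lambda> (?x \<tau>) w * G (w 0) \<tau>)"
      unfolding expect_plant[OF v \<Lambda>(1), of "\<lambda>\<tau>. F (\<tau> v) \<tau>", symmetric] by (simp add: Rv that)
    also have "\<dots> = expect (\<lambda>\<tau>. gibbs_avg \<Lambda> (\<lambda>y. G (y 0) \<tau>) (?x \<tau>))"
      using \<Lambda>(2) by (simp add: gibbs_avg_def)
    also have "\<dots> = expect (\<lambda>\<tau>. \<Sum>a\<in>UNIV. q a \<tau> * G a \<tau>)"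
      using gibbs_avg_function_of_origin[of \<Lambda> "\<lambda>a. G a \<tau>" "?x \<tau>" for \<tau>] by (simp add: q_def)
    finally show ?thesis .
  qed
  have "expect (\<lambda>\<tau>. - ln (q (\<tau> v) \<tau>)) = expect (\<lambda>\<tau>. \<Sum>a\<in>UNIV. q a \<tau> * - ln (q a \<tau>))"
    by (rule resample[of "\<lambda>a \<tau>. - ln (q a \<tau>)" "\<lambda>a \<tau>. - ln (q a \<tau>)"]) (simp add: Rq)
  then have ent: "expect (\<lambda>\<tau>. origin_entropy \<Lambda> (?x \<tau>)) = expect (\<lambda>\<tau>. - ln (q (\<tau> v) \<tau>))"
    by (simp add: origin_entropy_def eta_def q_def)
  define F where "F a \<tau> = marginal (insert v W) \<tau> / (marginal W \<tau> * q a \<tau>)" for a \<tau>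
  have "expect (\<lambda>\<tau>. F (\<tau> v) \<tau>) =
      expect (\<lambda>\<tau>. \<Sum>a\<in>UNIV. q a \<tau> * (marginal (insert v W) (\<tau>(v := a)) / (marginal W \<tau> * q a \<tau>)))"
    by (rule resample[of F "\<lambda>a \<tau>. marginal (insert v W) (\<tau>(v := a)) / (marginal W \<tau> * q a \<tau>)"])
       (simp add: F_def RW RWv Rq del: fun_upd_apply)
  also have "\<dots> = expect (\<lambda>\<tau>. (\<Sum>a\<in>UNIV. marginal (insert v W) (\<tau>(v := a))) / marginal W \<tau>)"
    using qpos by (simp add: sum_divide_distrib less_imp_neq[symmetric])
  also have "\<dots> = expect (\<lambda>\<tau>. 1)"
    by (rule expect_cong) (use marginal_pos in \<open>auto simp: sum_marginal_insert[OF vW] less_imp_neq[symmetric]\<close>)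
  finally have F1: "expect (\<lambda>\<tau>. F (\<tau> v) \<tau>) = 1" by simp
  have "0 = expect (\<lambda>\<tau>. 1 - F (\<tau> v) \<tau>)" by (simp add: expect_diff F1)
  also have "\<dots> \<le> expect (\<lambda>\<tau>. (ln (marginal W \<tau>) - ln (marginal (insert v W) \<tau>)) + ln (q (\<tau> v) \<tau>))"
  proof (rule expect_mono)
    fix \<tau> :: "'v \<Rightarrow> 'a" assume \<tau>: "\<tau> \<in> patterns V"
    note pos = marginal_pos[OF \<tau>, of W] marginal_pos[OF \<tau>, of "insert v W"] qpos[of "\<tau> v" \<tau>]
    have "ln (F (\<tau> v) \<tau>) \<le> F (\<tau> v) \<tau> - 1" using pos by (intro ln_le_minus_one) (simp add: F_def)
    moreover have "ln (F (\<tau> v) \<tau>) = ln (marginal (insert v W) \<tau>) - (ln (marginal W \<tau>) + ln (q (\<tau> v) \<tau>))"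
      unfolding F_def using pos by (simp add: ln_div ln_mult)
    ultimately show "1 - F (\<tau> v) \<tau> \<le> (ln (marginal W \<tau>) - ln (marginal (insert v W) \<tau>)) + ln (q (\<tau> v) \<tau>)"
      by linarith
  qed
  also have "\<dots> = (entropy_on (insert v W) - entropy_on W) - expect (\<lambda>\<tau>. - ln (q (\<tau> v) \<tau>))"
    unfolding entropy_on_def expect_add expect_diff
    using expect_cmult[of "-1"] by simp
  finally show ?thesis by (simp add: ent)
qed

text \<open>A distribution that gives most of its mass to \<open>S\<close> has entropy not much larger than the logarithm
  of the cardinality of \<open>S\<close>: compare it with the weight that spreads at most one half uniformly over \<open>S\<close> and
  at most one half uniformly over the other configurations, by \<open>ln t \<le> t - 1\<close>.\<close>

lemma entropy_le_ln_card:
  assumes S: "S \<subseteq> patterns V" "S \<noteq> {}"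
  shows "entropy_on V \<le> ln 2 + ln (card S) + expect (\<lambda>\<tau>. of_bool (\<tau> \<notin> S)) * (card V * ln CARD('a))"
proof -
  define N where "N = card (patterns V :: ('v \<Rightarrow> 'a) set)"
  have fin: "finite (patterns V :: ('v \<Rightarrow> 'a) set)" by (simp add: finite_V)
  then have finS: "finite S" using S finite_subset by auto
  have N: "N = CARD('a) ^ card V" by (simp add: N_def card_PiE finite_V)
  have pos: "card S > 0" "N > 0" using S finS by (auto simp: card_gt_0_iff N)
  have SN: "card S \<le> N" unfolding N_def using S fin by (rule_tac card_mono)
  define r where "r \<tau> = (if \<tau> \<in> S then 1 / (2 * real (card S)) else 1 / (2 * real N))" for \<tau> :: "'v \<Rightarrow> 'a"
  have rpos: "r \<tau> > 0" for \<tau> using pos by (simp add: r_def)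
  have "(\<Sum>\<tau>\<in>patterns V. r \<tau>) = (\<Sum>\<tau>\<in>patterns V - S. r \<tau>) + (\<Sum>\<tau>\<in>S. r \<tau>)"
    using S fin by (intro sum.subset_diff)
  also have "\<dots> = card (patterns V - S) * (1 / (2 * real N)) + card S * (1 / (2 * real (card S)))"
    by (simp add: r_def)
  also have "\<dots> \<le> N * (1 / (2 * real N)) + card S * (1 / (2 * real (card S)))"
    unfolding N_def using fin by (intro add_right_mono mult_right_mono) (auto intro!: card_mono)
  also have "\<dots> = 1" using pos by simp
  finally have r1: "(\<Sum>\<tau>\<in>patterns V. r \<tau>) \<le> 1" .
  have "entropy_on V = expect (\<lambda>\<tau>. - ln (model_prob \<tau>))"
    unfolding entropy_on_def by (rule expect_cong) (simp add: marginal_all)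
  moreover have "expect (\<lambda>\<tau>. ln (r \<tau>) - ln (model_prob \<tau>)) \<le> 0"
  proof -
    have "expect (\<lambda>\<tau>. ln (r \<tau>) - ln (model_prob \<tau>)) \<le> expect (\<lambda>\<tau>. r \<tau> / model_prob \<tau> - 1)"
    proof (rule expect_mono)
      fix \<tau>
      have "ln (r \<tau> / model_prob \<tau>) \<le> r \<tau> / model_prob \<tau> - 1"
        using rpos model_prob_pos by (intro ln_le_minus_one) simp
      then show "ln (r \<tau>) - ln (model_prob \<tau>) \<le> r \<tau> / model_prob \<tau> - 1"
        using rpos[of \<tau>] model_prob_pos[of \<tau>] by (simp add: ln_div)
    qed
    also have "\<dots> = (\<Sum>\<tau>\<in>patterns V. r \<tau>) - 1"
      using model_prob_pos by (simp add: expect_diff) (simp add: expect_def less_imp_neq[symmetric])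
    finally show ?thesis using r1 by simp
  qed
  moreover have "expect (\<lambda>\<tau>. - ln (r \<tau>)) \<le>
      expect (\<lambda>\<tau>. (ln 2 + ln (card S)) + of_bool (\<tau> \<notin> S) * (card V * ln CARD('a)))"
  proof (rule expect_mono)
    fix \<tau>
    have "ln (real N) = card V * ln CARD('a)" by (simp add: N ln_realpow)
    moreover have "ln (real (card S)) \<ge> 0" using pos(1) by simp
    ultimately show "- ln (r \<tau>) \<le> (ln 2 + ln (card S)) + of_bool (\<tau> \<notin> S) * (card V * ln CARD('a))"
      using pos by (auto simp: r_def ln_div ln_mult)
  qed
  ultimately show ?thesis
    using expect_cmult[of "-1"] expect_cmult[of "card V * ln CARD('a)" "\<lambda>\<tau>. of_bool (\<tau> \<notin> S)"]
    by (simp add: expect_diff expect_add mult.commute)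
qed

end

section \<open>Uniform random orders\<close>

locale random_order = prob_space P for P :: "'w measure" +
  fixes \<xi> :: "'g::{countable,group_add} \<Rightarrow> 'w \<Rightarrow> real"
  assumes indep: "indep_vars (\<lambda>_. borel) \<xi> UNIV"
    and uniform: "\<And>g. distr P borel (\<xi> g) = uniform_measure lborel {0..1}"
begin

abbreviation unif :: "real measure" where
  "unif \<equiv> uniform_measure lborel {0..1}"

definition precursors :: "('i \<Rightarrow> 'g) \<Rightarrow> 'i set \<Rightarrow> 'i \<Rightarrow> 'w \<Rightarrow> 'i set" where
  "precursors e F i \<omega> = {j \<in> F. \<xi> (e j) \<omega> < \<xi> (e i) \<omega>}"

lemma measurable_xi [measurable]: "\<xi> g \<in> borel_measurable P"
  using indep by (simp add: indep_vars_def)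

lemma prob_space_unif: "prob_space unif"
  by (rule prob_space_uniform_measure) auto

text \<open>An injective relabelling of an independent uniform family is again independent and uniform, by
  reindexing the product measure.\<close>

lemma joint_law:
  assumes "inj_on e F"
  shows "distr P (Pi\<^sub>M F (\<lambda>_. borel)) (\<lambda>\<omega>. \<lambda>i\<in>F. \<xi> (e i) \<omega>) = Pi\<^sub>M F (\<lambda>_. unif)"
proof -
  interpret unif: prob_space unif by (rule prob_space_unif)
  let ?U = "Pi\<^sub>M UNIV (\<lambda>_ :: 'g. unif)"
  have "distr P (Pi\<^sub>M UNIV (\<lambda>_. borel)) (\<lambda>\<omega>. \<lambda>g\<in>UNIV. \<xi> g \<omega>) = ?U"
    using indep_vars_iff_distr_eq_PiM[where I = UNIV and M' = "\<lambda>_. borel" and X = \<xi>] indep uniform by simp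
  then have U: "?U = distr P (Pi\<^sub>M UNIV (\<lambda>_. borel)) (\<lambda>\<omega> g. \<xi> g \<omega>)"
    by (simp add: restrict_def)
  have "Pi\<^sub>M F (\<lambda>_. unif) = distr ?U (Pi\<^sub>M F (\<lambda>_. unif)) (\<lambda>z. \<lambda>i\<in>F. z (e i))"
    using distr_PiM_reindex[of UNIV "\<lambda>_. unif" e F] assms prob_space_unif by (simp add: comp_def)
  also have "\<dots> = distr ?U (Pi\<^sub>M F (\<lambda>_. borel)) (\<lambda>z. \<lambda>i\<in>F. z (e i))"
    by (intro distr_cong refl sets_PiM_cong) simp
  also have "\<dots> = distr P (Pi\<^sub>M F (\<lambda>_. borel)) (\<lambda>\<omega>. \<lambda>i\<in>F. \<xi> (e i) \<omega>)"
  proof -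
    have "(\<lambda>\<omega> g. \<xi> g \<omega>) \<in> measurable P (Pi\<^sub>M UNIV (\<lambda>_. borel))" by (rule measurable_PiM_single') auto
    then show ?thesis unfolding U by (subst distr_distr) (auto simp: comp_def)
  qed
  finally show ?thesis ..
qed

lemma measurable_precursors_pattern:
  assumes "finite F" "i \<in> F"
  shows "(\<lambda>z. {j \<in> F. z j < z i}) \<in> measurable (Pi\<^sub>M F (\<lambda>_. borel :: real measure)) (count_space (Pow F))"
  unfolding measurable_count_space_eq2[OF finite_Pow_iff[THEN iffD2, OF assms(1)]]
proof (intro conjI ballI)
  fix S assume "S \<in> Pow F"
  then have "(\<lambda>z. {j \<in> F. z j < z i}) -` {S} \<inter> space (Pi\<^sub>M F (\<lambda>_. borel :: real measure))
      = {z \<in> space (Pi\<^sub>M F (\<lambda>_. borel)). \<forall>j\<in>F. (z j < z i) = (j \<in> S)}" by auto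
  also have "\<dots> \<in> sets (Pi\<^sub>M F (\<lambda>_. borel))"
  proof (rule sets.sets_Collect_finite_All[OF _ assms(1)])
    fix j assume "j \<in> F"
    then show "{z \<in> space (Pi\<^sub>M F (\<lambda>_. borel :: real measure)). (z j < z i) = (j \<in> S)} \<in> sets (Pi\<^sub>M F (\<lambda>_. borel))"
      using assms(2) by measurable
  qed
  finally show "(\<lambda>z. {j \<in> F. z j < z i}) -` {S} \<inter> space (Pi\<^sub>M F (\<lambda>_. borel :: real measure)) \<in> sets (Pi\<^sub>M F (\<lambda>_. borel))" .
qed auto

text \<open>The right-hand side of the second claim does not mention \<open>e\<close>: the law of the set of precursors is the
  same for every injective labelling, since the labels used always form an independent uniform
  family.\<close>

lemma integral_precursors:
  fixes G :: "'i set \<Rightarrow> real"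
  assumes F: "finite F" "i \<in> F" and e: "inj_on e F"
  shows "integrable P (\<lambda>\<omega>. G (precursors e F i \<omega>))"
    and "(\<integral>\<omega>. G (precursors e F i \<omega>) \<partial>P) = (\<integral>z. G {j \<in> F. z j < z i} \<partial>Pi\<^sub>M F (\<lambda>_. unif))"
proof -
  let ?B = "Pi\<^sub>M F (\<lambda>_. borel :: real measure)"
  let ?\<Gamma> = "\<lambda>z. G {j \<in> F. z j < z i}"
  have \<Gamma>: "?\<Gamma> \<in> borel_measurable ?B"
    by (rule measurable_compose[OF measurable_precursors_pattern[OF F]]) simp
  have J: "(\<lambda>\<omega>. \<lambda>j\<in>F. \<xi> (e j) \<omega>) \<in> measurable P ?B" by measurable
  have eq: "?\<Gamma> (\<lambda>j\<in>F. \<xi> (e j) \<omega>) = G (precursors e F i \<omega>)" for \<omega>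
    unfolding precursors_def using F(2) by (intro arg_cong[of _ _ G]) auto
  have m: "(\<lambda>\<omega>. G (precursors e F i \<omega>)) \<in> borel_measurable P"
    using measurable_compose[OF J \<Gamma>] by (simp only: eq)
  have "finite (G ` Pow F)" using F(1) by simp
  then obtain b where b: "\<And>S. S \<in> Pow F \<Longrightarrow> norm (G S) \<le> b"
    using finite_imp_bounded[of "G ` Pow F"] unfolding bounded_iff by auto
  show "integrable P (\<lambda>\<omega>. G (precursors e F i \<omega>))"
  proof (rule integrable_const_bound[of _ b])
    have "norm (G (precursors e F i \<omega>)) \<le> b" for \<omega> by (rule b) (auto simp: precursors_def)
    then show "AE \<omega> in P. norm (G (precursors e F i \<omega>)) \<le> b" by simp
  qed (rule m)
  show "(\<integral>\<omega>. G (precursors e F i \<omega>) \<partial>P) = (\<integral>z. ?\<Gamma> z \<partial>Pi\<^sub>M F (\<lambda>_. unif))"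
    unfolding joint_law[OF e, symmetric] using integral_distr[OF J \<Gamma>] by (simp only: eq)
qed

text \<open>The joint law of two labels is a product of diffuse measures, which does not charge the diagonal.\<close>

lemma AE_xi_neq:
  assumes "g \<noteq> h" shows "AE \<omega> in P. \<xi> g \<omega> \<noteq> \<xi> h \<omega>"
proof -
  interpret unif: prob_space unif by (rule prob_space_unif)
  have "indep_var (Pi\<^sub>M {g} (\<lambda>_. borel)) (\<lambda>\<omega>. restrict (\<lambda>i. \<xi> i \<omega>) {g}) (Pi\<^sub>M {h} (\<lambda>_. borel)) (\<lambda>\<omega>. restrict (\<lambda>i. \<xi> i \<omega>) {h})"
    using assms by (intro indep_var_restrict[OF indep]) auto
  then have "indep_var borel ((\<lambda>x. x g) \<circ> (\<lambda>\<omega>. restrict (\<lambda>i. \<xi> i \<omega>) {g})) borel ((\<lambda>x. x h) \<circ> (\<lambda>\<omega>. restrict (\<lambda>i. \<xi> i \<omega>) {h}))"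
    by (rule indep_var_compose) measurable
  then have "indep_var borel (\<xi> g) borel (\<xi> h)" by (simp add: comp_def)
  then have law: "distr P (borel \<Otimes>\<^sub>M borel) (\<lambda>\<omega>. (\<xi> g \<omega>, \<xi> h \<omega>)) = unif \<Otimes>\<^sub>M unif"
    by (simp add: indep_var_distribution_eq uniform)
  have null: "emeasure unif {x} = 0" for x by (cases "x \<in> {0..1}") auto
  have diag: "{z \<in> space (borel \<Otimes>\<^sub>M borel). fst z = (snd z :: real)} \<in> sets (borel \<Otimes>\<^sub>M borel)" (is "?D \<in> _")
    by measurable
  have sets: "sets (unif \<Otimes>\<^sub>M unif) = sets (borel \<Otimes>\<^sub>M borel)" by (intro sets_pair_measure_cong) auto
  have "emeasure (unif \<Otimes>\<^sub>M unif) ?D = (\<integral>\<^sup>+x. emeasure unif (Pair x -` ?D) \<partial>unif)"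
    by (rule unif.emeasure_pair_measure_alt) (use diag sets in simp)
  also have "\<dots> = (\<integral>\<^sup>+x. 0 \<partial>unif)"
  proof (rule nn_integral_cong)
    fix x :: real
    have "Pair x -` ?D = {x}" by (auto simp: space_pair_measure)
    then show "emeasure unif (Pair x -` ?D) = 0" using null by simp
  qed
  finally have "emeasure (distr P (borel \<Otimes>\<^sub>M borel) (\<lambda>\<omega>. (\<xi> g \<omega>, \<xi> h \<omega>))) ?D = 0" unfolding law by simp
  then have "emeasure P ((\<lambda>\<omega>. (\<xi> g \<omega>, \<xi> h \<omega>)) -` ?D \<inter> space P) = 0"
    using diag by (subst (asm) emeasure_distr) auto
  moreover have "(\<lambda>\<omega>. (\<xi> g \<omega>, \<xi> h \<omega>)) -` ?D \<inter> space P = {\<omega> \<in> space P. \<xi> g \<omega> = \<xi> h \<omega>}"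
    by (auto simp: space_pair_measure)
  ultimately show ?thesis by (subst AE_iff_measurable[OF _ refl]) auto
qed

lemma AE_inj_xi: "AE \<omega> in P. inj (\<lambda>g. \<xi> g \<omega>)"
proof -
  have "AE \<omega> in P. \<forall>g h. g \<noteq> h \<longrightarrow> \<xi> g \<omega> \<noteq> \<xi> h \<omega>"
    using AE_xi_neq by (simp add: AE_all_countable)
  then show ?thesis by eventually_elim (auto simp: inj_on_def)
qed

end

section \<open>Coordinate algebras\<close>

lemma cylinder_borel: "{x :: 'g \<Rightarrow> 'a::discrete_topology. x g = a} \<in> sets borel"
  by (rule borel_open, rule open_local) (simp add: local_fun_coordinate[where h = "\<lambda>b. b = a"])

lemma translated_alphabet_partition:
  "translated_partition alphabet_partition g = range (\<lambda>a. {x :: 'g::group_add \<Rightarrow> 'a. x g = a})"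
  by (auto simp: translated_partition_def alphabet_partition_def shift_def image_image vimage_def)

lemma coordinate_algebra_borel: "(coordinate_algebra F :: ('g::group_add \<Rightarrow> 'a::discrete_topology) set set) \<subseteq> sets borel"
proof -
  have "(\<Union>g\<in>F. range (\<lambda>a. {x :: 'g \<Rightarrow> 'a. x g = a})) \<subseteq> sets borel" by (auto intro: cylinder_borel)
  from sets.sigma_sets_subset[OF this] show ?thesis
    unfolding coordinate_algebra_def translated_alphabet_partition by simp
qed

lemma sets_coordinate_algebra:
  "sets (sigma UNIV (coordinate_algebra F :: ('g::group_add \<Rightarrow> 'a) set set)) = coordinate_algebra F"
  by (simp add: coordinate_algebra_def sigma_sets_sigma_sets_eq)

lemma local_on_coordinate_algebra:
  assumes "B \<in> coordinate_algebra F" shows "local_on F (\<lambda>x :: 'g::group_add \<Rightarrow> 'a. x \<in> B)"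
  using assms unfolding coordinate_algebra_def translated_alphabet_partition
proof (induction rule: sigma_sets.induct)
  case (Union A)
  then show ?case unfolding local_on_def by blast
qed (auto simp: local_on_def)

lemma local_on_in_coordinate_algebra:
  assumes B: "local_on W (\<lambda>x. x \<in> B)" and W: "finite W" "W \<subseteq> F"
  shows "(B :: ('g::group_add \<Rightarrow> 'a::finite) set) \<in> coordinate_algebra F"
proof -
  let ?N = "sigma UNIV (coordinate_algebra F :: ('g \<Rightarrow> 'a) set set)"
  have cyl: "{x. x g = a} \<in> sets ?N" if "g \<in> W" for g a
    unfolding sets_coordinate_algebra unfolding coordinate_algebra_def translated_alphabet_partition
    using that W by (intro sigma_sets.Basic) auto
  have "B = (\<Union>u\<in>{u \<in> patterns W. u \<in> B}. {x \<in> space ?N. \<forall>g\<in>W. x \<in> {x. x g = u g}})"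
  proof (intro equalityI subsetI)
    fix x assume "x \<in> B"
    then have "restrict x W \<in> B" using local_onD[OF B, of x "restrict x W"] by auto
    then show "x \<in> (\<Union>u\<in>{u \<in> patterns W. u \<in> B}. {x \<in> space ?N. \<forall>g\<in>W. x \<in> {x. x g = u g}})"
      by (intro UN_I[of "restrict x W"]) auto
  next
    fix x assume "x \<in> (\<Union>u\<in>{u \<in> patterns W. u \<in> B}. {x \<in> space ?N. \<forall>g\<in>W. x \<in> {x. x g = u g}})"
    then obtain u where "u \<in> B" "\<forall>g\<in>W. x g = u g" by auto
    then show "x \<in> B" using local_onD[OF B, of x u] by auto
  qed
  also have "\<dots> \<in> sets ?N"
  proof (intro sets.finite_UN sets.sets_Collect_finite_All W(1))
    show "finite {u \<in> patterns W. u \<in> B}" using W(1) by (intro finite_subset[OF _ finite_patterns[OF W(1)]]) auto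
    show "{x \<in> space ?N. x \<in> {x. x g = u g}} \<in> sets ?N" if "g \<in> W" for g u
      using cyl[OF that, of "u g"] sets.Int_space_eq2[OF cyl[OF that, of "u g"]] by (simp add: Int_def conj_commute)
  qed
  finally show ?thesis unfolding sets_coordinate_algebra .
qed

lemma measurable_local_coordinate_algebra:
  fixes f :: "('g::group_add \<Rightarrow> 'a::finite) \<Rightarrow> real"
  assumes "local_on W f" "finite W" "W \<subseteq> F"
  shows "f \<in> borel_measurable (sigma UNIV (coordinate_algebra F))"
proof (rule measurableI)
  fix A :: "real set"
  have "f -` A \<in> coordinate_algebra F"
    by (rule local_on_in_coordinate_algebra[OF _ assms(2,3)]) (simp add: local_on_comp[OF assms(1), of "\<lambda>z. z \<in> A"])
  then show "f -` A \<inter> space (sigma UNIV (coordinate_algebra F)) \<in> sets (sigma UNIV (coordinate_algebra F))"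
    unfolding sets_coordinate_algebra by simp
qed simp

section \<open>Entropy of finite and countable partitions\<close>

text \<open>This controls \<open>eta\<close> at \<open>0\<close>, where continuity does not follow from that of the logarithm.\<close>

lemma eta_le_sqrt: "0 \<le> t \<Longrightarrow> eta t \<le> 2 * sqrt t"
proof (cases "t = 0")
  case False
  assume "0 \<le> t"
  with False have t: "t > 0" by simp
  have "ln (1 / sqrt t) \<le> 1 / sqrt t - 1" using t by (intro ln_le_minus_one) simp
  then have "- ln t \<le> 2 / sqrt t" using t by (simp add: ln_div ln_sqrt)
  then have "t * - ln t \<le> t * (2 / sqrt t)" using t by (intro mult_left_mono) auto
  also have "\<dots> = 2 * sqrt t" using t by (simp add: field_simps)
  finally show ?thesis by (simp add: eta_def)
qed (simp add: eta_def)

lemma continuous_on_eta: "continuous_on {0..1} eta"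
proof -
  have "continuous (at t within {0..1}) eta" if t: "t \<in> {0..1}" for t
  proof (cases "t = 0")
    case True
    have "((\<lambda>t. 2 * sqrt t) \<longlongrightarrow> 2 * sqrt 0) (at 0 within {0..1})" by (intro tendsto_intros)
    then have lim: "((\<lambda>t. 2 * sqrt t) \<longlongrightarrow> 0) (at 0 within {0..1})" by simp
    have "(eta \<longlongrightarrow> 0) (at 0 within {0..1})"
      by (rule tendsto_sandwich[OF _ _ tendsto_const lim])
         (auto simp: eventually_at_filter eta_nonneg eta_le_sqrt)
    then show ?thesis using True by (simp add: continuous_within eta_def)
  next
    case False
    with t have "t > 0" by simp
    then show ?thesis unfolding eta_def[abs_def] by (intro continuous_intros) auto
  qed
  then show ?thesis by (simp add: continuous_on_eq_continuous_within)
qed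

lemma entropy_term_eq: "entropy_term \<mu> B = eta (measure (completion \<mu>) B)"
  by (simp add: entropy_term_def eta_def)

context
  fixes \<mu> :: "('g::{countable,group_add} \<Rightarrow> 'a::{finite,discrete_topology}) measure"
  assumes \<mu>: "\<mu> \<in> space (prob_algebra borel)"
begin

interpretation \<mu>: prob_space \<mu> using \<mu> by (simp add: space_prob_algebra)
interpretation C: prob_space "completion \<mu>" by (rule \<mu>.prob_space_completion)

abbreviation (input) at_origin :: "'a \<Rightarrow> ('g \<Rightarrow> 'a) set" where
  "at_origin a \<equiv> {x. x 0 = a}"

lemma sets_\<mu>: "sets \<mu> = sets borel"
  using \<mu> by (simp add: space_prob_algebra)

lemma space_\<mu>: "space \<mu> = UNIV"
  using sets_eq_imp_space_eq[OF sets_\<mu>] by simp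

lemma at_origin_sets [simp]: "at_origin a \<in> sets (completion \<mu>)"
  using cylinder_borel by (simp add: sets_\<mu>)

lemma sum_measure_at_origin:
  assumes "C \<in> sets (completion \<mu>)"
  shows "(\<Sum>a\<in>UNIV. measure (completion \<mu>) (at_origin a \<inter> C)) = measure (completion \<mu>) C"
proof -
  have "C = (\<Union>a\<in>UNIV. at_origin a \<inter> C)" by auto
  moreover have "measure (completion \<mu>) (\<Union>a\<in>UNIV. at_origin a \<inter> C) = (\<Sum>a\<in>UNIV. measure (completion \<mu>) (at_origin a \<inter> C))"
    using assms by (intro C.finite_measure_finite_Union) (auto simp: disjoint_family_on_def)
  ultimately show ?thesis by simp
qed

text \<open>Splitting a cell \<open>C\<close> increases its contribution by the conditional entropy given \<open>C\<close>.\<close>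

lemma entropy_split_cell:
  assumes C: "C \<in> sets (completion \<mu>)"
  defines "m \<equiv> measure (completion \<mu>)"
  shows "(\<Sum>a\<in>UNIV. entropy_term \<mu> (at_origin a \<inter> C)) =
    entropy_term \<mu> C + m C * (\<Sum>a\<in>UNIV. eta (m (at_origin a \<inter> C) / m C))"
proof (cases "m C = 0")
  case True
  have "m (at_origin a \<inter> C) = 0" for a
  proof -
    have "m (at_origin a \<inter> C) \<le> m C" unfolding m_def using C by (intro C.finite_measure_mono) auto
    then show ?thesis using True by (simp add: m_def measure_le_0_iff)
  qed
  then show ?thesis using True by (simp add: entropy_term_eq m_def[symmetric] eta_def)
next
  case False
  then have pos: "m C > 0" by (simp add: m_def zero_less_measure_iff)
  let ?r = "\<lambda>a. m (at_origin a \<inter> C) / m C"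
  have r1: "(\<Sum>a\<in>UNIV. ?r a) = 1"
    using sum_measure_at_origin[OF C] False by (simp add: sum_divide_distrib[symmetric] m_def)
  have "eta (m (at_origin a \<inter> C)) = m C * eta (?r a) + ?r a * eta (m C)" for a
  proof (cases "m (at_origin a \<inter> C) = 0")
    case False
    then have "m (at_origin a \<inter> C) > 0" by (simp add: m_def zero_less_measure_iff)
    then show ?thesis using pos by (simp add: eta_def ln_div field_simps)
  qed (simp add: eta_def)
  then have "(\<Sum>a\<in>UNIV. eta (m (at_origin a \<inter> C))) = (\<Sum>a\<in>UNIV. m C * eta (?r a)) + (\<Sum>a\<in>UNIV. ?r a) * eta (m C)"
    by (simp add: sum.distrib sum_distrib_right)
  then show ?thesis by (simp add: r1 entropy_term_eq m_def[symmetric] sum_distrib_left)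
qed

lemma conditional_cell_bounds:
  assumes C: "C \<in> sets (completion \<mu>)"
  defines "m \<equiv> measure (completion \<mu>)"
  shows "0 \<le> eta (m (at_origin a \<inter> C) / m C)" "eta (m (at_origin a \<inter> C) / m C) \<le> 1"
proof -
  have "m (at_origin a \<inter> C) \<le> m C" unfolding m_def using C by (intro C.finite_measure_mono) auto
  then have "m (at_origin a \<inter> C) / m C \<le> 1" "0 \<le> m (at_origin a \<inter> C) / m C"
    by (auto simp: m_def divide_le_eq_1 zero_less_measure_iff)
  then show "0 \<le> eta (m (at_origin a \<inter> C) / m C)" "eta (m (at_origin a \<inter> C) / m C) \<le> 1"
    by (auto intro: eta_nonneg eta_le_one)
qed

lemma entropy_term_nonneg: "entropy_term \<mu> B \<ge> 0"
  by (simp add: entropy_term_eq eta_nonneg)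

lemma partition_join_eq:
  "partition_join alphabet_partition \<beta> = (\<lambda>(a, C). at_origin a \<inter> C) ` (UNIV \<times> \<beta>) - {{}}"
  by (auto simp: partition_join_def alphabet_partition_def image_iff)

text \<open>Two different pairs of cells have the same intersection only if it is empty, and the empty set
  contributes nothing; so the sum over the join can be written as a double sum.\<close>

lemma sum_over_join:
  assumes B: "finite B" "disjoint B"
  shows "(\<Sum>D\<in>(\<lambda>(a, C). at_origin a \<inter> C) ` (UNIV \<times> B). entropy_term \<mu> D)
       = (\<Sum>C\<in>B. \<Sum>a\<in>UNIV. entropy_term \<mu> (at_origin a \<inter> C))"
proof -
  have "(\<Sum>D\<in>(\<lambda>(a, C). at_origin a \<inter> C) ` (UNIV \<times> B). entropy_term \<mu> D)
      = (\<Sum>(a, C)\<in>UNIV \<times> B. entropy_term \<mu> (at_origin a \<inter> C))"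
  proof (subst sum.reindex_nontrivial)
    fix y z :: "'a \<times> ('g \<Rightarrow> 'a) set"
    assume yz: "y \<in> UNIV \<times> B" "z \<in> UNIV \<times> B" "y \<noteq> z"
      "(case y of (a, C) \<Rightarrow> at_origin a \<inter> C) = (case z of (a, C) \<Rightarrow> at_origin a \<inter> C)"
    obtain a C a' C' where [simp]: "y = (a, C)" "z = (a', C')" by (cases y, cases z)
    have "at_origin a \<inter> C = {}"
    proof (rule ccontr)
      assume "at_origin a \<inter> C \<noteq> {}"
      then obtain x where x: "x \<in> at_origin a \<inter> C" by auto
      also have "at_origin a \<inter> C = at_origin a' \<inter> C'" using yz(4) by simp
      finally have "a = a'" "C \<inter> C' \<noteq> {}" using x by auto
      moreover from this have "C = C'" using yz(1,2) \<open>C \<inter> C' \<noteq> {}\<close> B(2) by (auto simp: disjoint_def)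
      ultimately show False using yz(3) by simp
    qed
    then show "entropy_term \<mu> (case y of (a, C) \<Rightarrow> at_origin a \<inter> C) = 0"
      by (simp add: entropy_term_eq eta_def)
  qed (use B in \<open>auto simp: case_prod_unfold comp_def\<close>)
  also have "\<dots> = (\<Sum>a\<in>UNIV. \<Sum>C\<in>B. entropy_term \<mu> (at_origin a \<inter> C))"
    by (simp add: sum.cartesian_product)
  also have "\<dots> = (\<Sum>C\<in>B. \<Sum>a\<in>UNIV. entropy_term \<mu> (at_origin a \<inter> C))" by (rule sum.swap)
  finally show ?thesis .
qed

lemma entropy_difference_finite:
  assumes \<beta>: "finite \<beta>" "partition_on UNIV \<beta>" "\<beta> \<subseteq> sets (completion \<mu>)"
  defines "m \<equiv> measure (completion \<mu>)"
  shows "partition_entropy \<mu> (partition_join alphabet_partition \<beta>) - partition_entropy \<mu> \<beta>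
      = (\<Sum>C\<in>\<beta>. m C * (\<Sum>a\<in>UNIV. eta (m (at_origin a \<inter> C) / m C)))"
proof -
  let ?J = "(\<lambda>(a, C). at_origin a \<inter> C) ` (UNIV \<times> \<beta>)"
  have "partition_entropy \<mu> (partition_join alphabet_partition \<beta>) = (\<Sum>D\<in>?J - {{}}. entropy_term \<mu> D)"
    unfolding partition_entropy_def partition_join_eq using \<beta>(1) by (intro infsum_finite) auto
  also have "\<dots> = (\<Sum>D\<in>?J. entropy_term \<mu> D)"
    using \<beta>(1) by (intro sum.mono_neutral_left) (auto simp: entropy_term_eq eta_def)
  also have "\<dots> = (\<Sum>C\<in>\<beta>. \<Sum>a\<in>UNIV. entropy_term \<mu> (at_origin a \<inter> C))"
    using \<beta> by (intro sum_over_join) (auto simp: partition_on_def)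
  also have "\<dots> = (\<Sum>C\<in>\<beta>. entropy_term \<mu> C + m C * (\<Sum>a\<in>UNIV. eta (m (at_origin a \<inter> C) / m C)))"
    unfolding m_def using \<beta>(3) by (intro sum.cong refl entropy_split_cell) auto
  also have "\<dots> = partition_entropy \<mu> \<beta> + (\<Sum>C\<in>\<beta>. m C * (\<Sum>a\<in>UNIV. eta (m (at_origin a \<inter> C) / m C)))"
    using \<beta>(1) by (simp add: partition_entropy_def sum.distrib)
  finally show ?thesis by simp
qed

text \<open>Each cell gains a nonnegative amount.  For infinite partitions the terms of the join must also be
  summable, because \<open>infsum\<close> defaults to \<open>0\<close> otherwise; this holds because a cell gains at most its measure
  times \<open>CARD('a)\<close>.  The bound makes the set of differences in \<open>cond_partition_entropy\<close> bounded below, so that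
  its infimum is at most each member.\<close>

lemma entropy_difference_nonneg:
  assumes \<beta>: "partition_on UNIV \<beta>" "\<beta> \<subseteq> sets (completion \<mu>)" "entropy_term \<mu> summable_on \<beta>"
  shows "0 \<le> partition_entropy \<mu> (partition_join alphabet_partition \<beta>) - partition_entropy \<mu> \<beta>"
proof -
  let ?h = "\<lambda>(a, C). at_origin a \<inter> C" and ?m = "measure (completion \<mu>)"
  let ?J = "partition_join alphabet_partition \<beta>"
  have dis: "disjoint B" if "B \<subseteq> \<beta>" for B
    using \<beta>(1) that unfolding partition_on_def disjoint_def by (meson subsetD)
  have part: "(\<Sum>C\<in>B. entropy_term \<mu> C) \<le> partition_entropy \<mu> \<beta>" if "finite B" "B \<subseteq> \<beta>" for B
    unfolding partition_entropy_def by (rule finite_sum_le_infsum[OF \<beta>(3) that]) (rule entropy_term_nonneg)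
  have upper: "(\<Sum>D\<in>?h ` (UNIV \<times> B). entropy_term \<mu> D) \<le> partition_entropy \<mu> \<beta> + CARD('a)"
    if B: "finite B" "B \<subseteq> \<beta>" for B
  proof -
    have "(\<Sum>D\<in>?h ` (UNIV \<times> B). entropy_term \<mu> D)
        = (\<Sum>C\<in>B. entropy_term \<mu> C) + (\<Sum>C\<in>B. ?m C * (\<Sum>a\<in>UNIV. eta (?m (at_origin a \<inter> C) / ?m C)))"
      using B \<beta>(2) by (simp add: sum_over_join dis sum.distrib[symmetric] subset_iff entropy_split_cell)
    moreover have "(\<Sum>C\<in>B. ?m C * (\<Sum>a\<in>UNIV. eta (?m (at_origin a \<inter> C) / ?m C))) \<le> (\<Sum>C\<in>B. ?m C * CARD('a))"
    proof (intro sum_mono mult_left_mono)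
      fix C assume "C \<in> B"
      then have "C \<in> sets (completion \<mu>)" using B \<beta>(2) by auto
      then have "eta (?m (at_origin a \<inter> C) / ?m C) \<le> 1" for a by (rule conditional_cell_bounds)
      then show "(\<Sum>a\<in>UNIV. eta (?m (at_origin a \<inter> C) / ?m C)) \<le> CARD('a)"
        using sum_bounded_above[of UNIV "\<lambda>a. eta (?m (at_origin a \<inter> C) / ?m C)" 1] by simp
    qed simp
    moreover have "(\<Sum>C\<in>B. ?m C) \<le> 1"
    proof -
      have "(\<Sum>C\<in>B. ?m C) = ?m (\<Union>C\<in>B. C)"
        using B \<beta>(2) dis[OF B(2)]
        by (intro C.finite_measure_finite_Union[symmetric]) (auto simp: disjoint_family_on_def disjoint_def)
      then show ?thesis by simp
    qed
    then have "(\<Sum>C\<in>B. ?m C * CARD('a)) \<le> 1 * real CARD('a)"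
      unfolding sum_distrib_right[symmetric] by (rule mult_right_mono) simp
    ultimately show ?thesis using part[OF B] by simp
  qed
  have summ: "entropy_term \<mu> summable_on ?J"
  proof (rule nonneg_bdd_above_summable_on)
    show "bdd_above (sum (entropy_term \<mu>) ` {F. F \<subseteq> ?J \<and> finite F})"
    proof (rule bdd_aboveI2)
      fix X assume X: "X \<in> {F. F \<subseteq> ?J \<and> finite F}"
      then have "finite X" "X \<subseteq> ?J" by simp_all
      then have "X \<subseteq> ?h ` (UNIV \<times> \<beta>)" unfolding partition_join_eq by (meson Diff_subset subset_trans)
      from finite_subset_image[OF \<open>finite X\<close> this] obtain Y where Y: "Y \<subseteq> UNIV \<times> \<beta>" "finite Y" "X = ?h ` Y" by blast
      define B where "B = snd ` Y"
      have B: "finite B" "B \<subseteq> \<beta>" using Y by (auto simp: B_def)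
      have "Y \<subseteq> UNIV \<times> B" by (force simp: B_def)
      then have "X \<subseteq> ?h ` (UNIV \<times> B)" unfolding Y(3) by (rule image_mono)
      then have "sum (entropy_term \<mu>) X \<le> (\<Sum>D\<in>?h ` (UNIV \<times> B). entropy_term \<mu> D)"
        using B by (intro sum_mono2) (auto simp: entropy_term_nonneg)
      also have "\<dots> \<le> partition_entropy \<mu> \<beta> + CARD('a)" by (rule upper[OF B])
      finally show "sum (entropy_term \<mu>) X \<le> partition_entropy \<mu> \<beta> + CARD('a)" .
    qed
  qed (rule entropy_term_nonneg)
  have "partition_entropy \<mu> \<beta> \<le> partition_entropy \<mu> ?J"
    unfolding partition_entropy_def[of \<mu> \<beta>]
  proof (rule infsum_le_finite_sums[OF \<beta>(3)])
    fix B assume B: "finite B" "B \<subseteq> \<beta>"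
    have "(\<Sum>C\<in>B. entropy_term \<mu> C) \<le> (\<Sum>C\<in>B. \<Sum>a\<in>UNIV. entropy_term \<mu> (at_origin a \<inter> C))"
    proof (rule sum_mono)
      fix C assume "C \<in> B"
      then have C: "C \<in> sets (completion \<mu>)" using B \<beta>(2) by auto
      have "0 \<le> ?m C * (\<Sum>a\<in>UNIV. eta (?m (at_origin a \<inter> C) / ?m C))"
        by (intro mult_nonneg_nonneg sum_nonneg conditional_cell_bounds C) simp
      then show "entropy_term \<mu> C \<le> (\<Sum>a\<in>UNIV. entropy_term \<mu> (at_origin a \<inter> C))"
        by (simp add: entropy_split_cell[OF C])
    qed
    also have "\<dots> = (\<Sum>D\<in>?h ` (UNIV \<times> B). entropy_term \<mu> D)" by (simp add: sum_over_join B dis)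
    also have "\<dots> = (\<Sum>D\<in>?h ` (UNIV \<times> B) - {{}}. entropy_term \<mu> D)"
      using B by (intro sum.mono_neutral_right) (auto simp: entropy_term_eq eta_def)
    also have "\<dots> \<le> partition_entropy \<mu> ?J"
      unfolding partition_entropy_def using B
      by (intro finite_sum_le_infsum[OF summ]) (auto simp: partition_join_eq entropy_term_nonneg)
    finally show "sum (entropy_term \<mu>) B \<le> partition_entropy \<mu> ?J" .
  qed
  then show ?thesis by simp
qed

section \<open>Saturations\<close>

lemma saturation_completion: "saturation \<mu> (coordinate_algebra L) \<subseteq> sets (completion \<mu>)"
proof -
  have "coordinate_algebra F \<subseteq> sets (completion \<mu>)" for F
    using coordinate_algebra_borel[of F] sets_completionI_sets[of _ \<mu>] by (auto simp: sets_\<mu>)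
  then have "sigma_join (coordinate_algebra L) (coordinate_algebra F) \<subseteq> sets (completion \<mu>)" for F
    unfolding sigma_join_def using sets.sigma_sets_subset[of _ "completion \<mu>"] by (simp add: space_\<mu>)
  then have *: "sigma_join (coordinate_algebra L) (coordinate_algebra F) \<union> null_sets (completion \<mu>)
      \<subseteq> sets (completion \<mu>)" for F
    by (auto simp: null_sets_def)
  have "completed_algebra \<mu> (sigma_join (coordinate_algebra L) (coordinate_algebra F)) \<subseteq> sets (completion \<mu>)" for F
    using sets.sigma_sets_subset[OF *[of F]]
    unfolding completed_algebra_def sigma_join_def[of _ "null_sets _"] by (simp add: space_\<mu>)
  then show ?thesis unfolding saturation_def by blast
qed

lemma in_saturationI:
  assumes B: "\<And>n. B \<in> coordinate_algebra (- \<Lambda> n)"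
    and ex: "\<And>F. finite F \<Longrightarrow> \<exists>n. F - L \<subseteq> \<Lambda> n"
  shows "B \<in> saturation \<mu> (coordinate_algebra L)"
  unfolding saturation_def
proof safe
  fix F :: "'g set" assume "finite F"
  then obtain n where n: "F - L \<subseteq> \<Lambda> n" using ex by auto
  have "coordinate_algebra (- \<Lambda> n) \<subseteq> sigma_join (coordinate_algebra L) (coordinate_algebra (UNIV - F) :: ('g \<Rightarrow> 'a) set set)"
    unfolding sigma_join_def unfolding coordinate_algebra_def[of "- \<Lambda> n"]
  proof (rule sigma_sets_mono)
    show "(\<Union>g\<in>- \<Lambda> n. translated_partition alphabet_partition g)
      \<subseteq> sigma_sets UNIV (coordinate_algebra L \<union> coordinate_algebra (UNIV - F) :: ('g \<Rightarrow> 'a) set set)"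
    proof
      fix C :: "('g \<Rightarrow> 'a) set" assume "C \<in> (\<Union>g\<in>- \<Lambda> n. translated_partition alphabet_partition g)"
      then obtain g where g: "g \<notin> \<Lambda> n" "C \<in> translated_partition alphabet_partition g" by auto
      with n have "g \<in> L \<or> g \<in> UNIV - F" by auto
      then have "C \<in> coordinate_algebra L \<or> C \<in> coordinate_algebra (UNIV - F)"
        unfolding coordinate_algebra_def using g(2) by (auto intro: sigma_sets.Basic)
      then show "C \<in> sigma_sets UNIV (coordinate_algebra L \<union> coordinate_algebra (UNIV - F))"
        by (intro sigma_sets.Basic) auto
    qed
  qed
  then show "B \<in> completed_algebra \<mu> (sigma_join (coordinate_algebra L) (coordinate_algebra (UNIV - F)))"
    using B[of n] by (auto simp: completed_algebra_def sigma_join_def[of _ "null_sets _"] intro: sigma_sets.Basic)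
qed

lemma cond_entropy_saturation_le:
  assumes \<beta>: "finite \<beta>" "partition_on UNIV \<beta>" "\<beta> \<subseteq> saturation \<mu> (coordinate_algebra L)"
  shows "cond_partition_entropy \<mu> alphabet_partition (saturation \<mu> (coordinate_algebra L))
    \<le> partition_entropy \<mu> (partition_join alphabet_partition \<beta>) - partition_entropy \<mu> \<beta>"
  unfolding cond_partition_entropy_def
proof (rule cINF_lower)
  show "\<beta> \<in> finite_entropy_partitions \<mu> (saturation \<mu> (coordinate_algebra L))"
    using \<beta> by (simp add: finite_entropy_partitions_def countable_finite summable_on_finite)
  show "bdd_below ((\<lambda>\<beta>. partition_entropy \<mu> (partition_join alphabet_partition \<beta>) - partition_entropy \<mu> \<beta>)
      ` finite_entropy_partitions \<mu> (saturation \<mu> (coordinate_algebra L)))"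
    by (rule bdd_belowI2[of _ 0], rule entropy_difference_nonneg)
       (use saturation_completion in \<open>auto simp: finite_entropy_partitions_def\<close>)
qed

end

section \<open>Conditional probabilities along increasing volumes\<close>

text \<open>The increments have \<open>L\<^sup>2\<close>-norms at most \<open>(1 / 2) ^ j\<close>, so their absolute values have a finite sum in
  \<open>L\<^sup>1\<close> and hence almost everywhere.\<close>

lemma (in prob_space) AE_convergent_L2_increments:
  fixes X :: "nat \<Rightarrow> 'a \<Rightarrow> real"
  assumes [measurable]: "\<And>j. X j \<in> borel_measurable M" and bound: "\<And>j x. \<bar>X j x\<bar> \<le> 1"
    and inc: "\<And>j. (\<integral>x. (X j x - X (Suc j) x)\<^sup>2 \<partial>M) \<le> (1 / 4) ^ j"
  shows "AE x in M. convergent (\<lambda>j. X j x)"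
proof -
  define d where "d j x = \<bar>X (Suc j) x - X j x\<bar>" for j x
  have d_nonneg: "0 \<le> d j x" for j x by (simp add: d_def)
  have [measurable]: "d j \<in> borel_measurable M" for j unfolding d_def by measurable
  have d_bound: "\<bar>d j x\<bar> \<le> 2" for j x
    using bound[of j x] bound[of "Suc j" x] by (simp add: d_def)
  have int: "integrable M (d j)" "integrable M (\<lambda>x. (d j x)\<^sup>2)" for j
  proof -
    show "integrable M (d j)" by (rule integrable_const_bound[of _ 2]) (use d_bound in auto)
    have "(d j x)\<^sup>2 \<le> 2\<^sup>2" for x using d_bound[of j x] by (intro power2_le_iff_abs_le[THEN iffD2]) auto
    then show "integrable M (\<lambda>x. (d j x)\<^sup>2)" by (intro integrable_const_bound[of _ "2\<^sup>2"]) auto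
  qed
  have L1: "(\<integral>x. d j x \<partial>M) \<le> (1 / 2) ^ j" for j
  proof -
    \<comment> \<open>A weighted inequality of means, in place of the Cauchy-Schwarz inequality.\<close>
    have pw: "d j x \<le> ((1 / 2) ^ j + 2 ^ j * (d j x)\<^sup>2) / 2" for x
    proof -
      have "0 \<le> ((1 / 2) ^ j - d j x)\<^sup>2 * 2 ^ j" by simp
      also have "\<dots> = (1 / 2) ^ j + 2 ^ j * (d j x)\<^sup>2 - 2 * d j x"
        by (simp add: power2_diff algebra_simps power_divide power2_eq_square)
      finally show ?thesis by simp
    qed
    have sq: "(\<integral>x. (d j x)\<^sup>2 \<partial>M) \<le> (1 / 4) ^ j"
      using inc[of j] by (simp add: d_def power2_commute)
    have "(\<integral>x. d j x \<partial>M) \<le> (\<integral>x. ((1 / 2) ^ j + 2 ^ j * (d j x)\<^sup>2) / 2 \<partial>M)"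
      using int by (intro integral_mono pw) auto
    also have "\<dots> = ((1 / 2) ^ j + 2 ^ j * (\<integral>x. (d j x)\<^sup>2 \<partial>M)) / 2"
      using int by (simp add: prob_space)
    also have "\<dots> \<le> ((1 / 2) ^ j + 2 ^ j * (1 / 4) ^ j) / 2"
      using sq by simp
    also have "\<dots> = (1 / 2) ^ j" by (simp add: power_mult_distrib[symmetric])
    finally show "(\<integral>x. d j x \<partial>M) \<le> (1 / 2) ^ j" .
  qed
  have "(\<integral>\<^sup>+x. (\<Sum>j. ennreal (d j x)) \<partial>M) = (\<Sum>j. \<integral>\<^sup>+x. ennreal (d j x) \<partial>M)"
    by (rule nn_integral_suminf) simp
  also have "\<dots> \<le> (\<Sum>j. ennreal ((1 / 2) ^ j))"
  proof (rule suminf_le)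
    show "(\<integral>\<^sup>+x. ennreal (d j x) \<partial>M) \<le> ennreal ((1 / 2) ^ j)" for j
      using L1[of j] by (subst nn_integral_eq_integral[OF int(1)]) (auto simp: d_nonneg intro: ennreal_leI)
  qed auto
  also have "\<dots> < \<infinity>"
    by (simp add: suminf_ennreal2 summable_geometric)
  finally have "(\<integral>\<^sup>+x. (\<Sum>j. ennreal (d j x)) \<partial>M) \<noteq> \<infinity>" by simp
  then have "AE x in M. (\<Sum>j. ennreal (d j x)) \<noteq> \<infinity>"
    by (intro nn_integral_PInf_AE) simp
  then show ?thesis
  proof eventually_elim
    case (elim x)
    then have "summable (\<lambda>j. d j x)" by (intro summable_suminf_not_top) (auto simp: d_def)
    then have "summable (\<lambda>j. X (Suc j) x - X j x)" unfolding d_def by (rule summable_rabs_cancel)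
    then obtain l where "(\<lambda>n. \<Sum>j<n. X (Suc j) x - X j x) \<longlonglongrightarrow> l"
      by (auto simp: summable_def sums_def)
    then have "(\<lambda>n. X n x - X 0 x) \<longlonglongrightarrow> l" by (simp only: sum_lessThan_telescope[of "\<lambda>j. X j x"])
    then have "(\<lambda>n. (X n x - X 0 x) + X 0 x) \<longlonglongrightarrow> l + X 0 x" by (intro tendsto_intros)
    then show ?case by (auto simp: convergent_def)
  qed
qed

lemma exists_fast_subsequence:
  assumes "\<And>j. eventually (\<lambda>n. R j n) sequentially"
  obtains k :: "nat \<Rightarrow> nat" where "strict_mono k" "\<And>j. R j (k j)"
proof -
  have "\<exists>k. \<forall>j. R j (k j) \<and> k j < k (Suc j)"
  proof (rule dependent_nat_choice)
    show "\<exists>n. R 0 n" using assms[of 0] eventually_happens' sequentially_bot by blast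
    fix n j :: nat
    have "eventually (\<lambda>i. R (Suc j) i \<and> n < i) sequentially"
      using assms eventually_gt_at_top by (rule eventually_conj)
    then show "\<exists>i. R (Suc j) i \<and> n < i" using eventually_happens' sequentially_bot by blast
  qed
  then show ?thesis using that by (auto simp: strict_mono_Suc_iff)
qed

lemma lim_shift: "lim (\<lambda>j. X (j + m)) = lim (X :: nat \<Rightarrow> real)"
proof -
  have "(\<lambda>j. X (j + m)) \<longlonglongrightarrow> l \<longleftrightarrow> X \<longlonglongrightarrow> l" for l
    using LIMSEQ_offset[of X m l] LIMSEQ_ignore_initial_segment[of X l m] by blast
  then show ?thesis by (simp add: lim_def)
qed

text \<open>Since the sets \<open>\<Lambda> n\<close> exhaust the complement of \<open>L\<close>, an event that depends only on the coordinates outside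
  \<open>\<Lambda> n\<close> for every \<open>n\<close> belongs to the saturation of the coordinates in \<open>L\<close>.\<close>

locale exhausted_past = finite_range_potential \<phi> D
  for \<phi> :: "('g::{countable,group_add} \<Rightarrow> 'a::{finite,discrete_topology}) \<Rightarrow> real" and D +
  fixes \<mu> :: "('g \<Rightarrow> 'a) measure" and L :: "'g set" and \<Lambda> :: "nat \<Rightarrow> 'g set"
  assumes gibbs: "gibbs_measure \<phi> D \<mu>"
    and finite_\<Lambda>: "\<And>n. finite (\<Lambda> n)" and zero_\<Lambda>: "\<And>n. 0 \<in> \<Lambda> n"
    and incseq_\<Lambda>: "incseq \<Lambda>" and exhaust: "\<And>F. finite F \<Longrightarrow> \<exists>n. F - L \<subseteq> \<Lambda> n"
begin

lemma \<mu>_prob: "\<mu> \<in> space (prob_algebra borel)"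
  using gibbs by (simp add: gibbs_measure_def)

sublocale \<mu>: prob_space \<mu> using \<mu>_prob by (simp add: space_prob_algebra)

lemma sets_eq [measurable_cong]: "sets \<mu> = sets borel"
  using \<mu>_prob by (rule sets_\<mu>)

lemma space_eq: "space \<mu> = UNIV"
  using \<mu>_prob by (rule space_\<mu>)

abbreviation prob_at :: "nat \<Rightarrow> 'a \<Rightarrow> ('g \<Rightarrow> 'a) \<Rightarrow> real" where
  "prob_at n \<equiv> origin_prob (\<Lambda> n)"

lemma measurable_prob_at [measurable]: "prob_at n a \<in> borel_measurable borel"
  by (intro measurable_local local_fun_origin_prob finite_\<Lambda>)

lemma prob_at_range: "prob_at n a x \<in> {0..1}"
  by (simp add: origin_prob_nonneg origin_prob_le_one finite_\<Lambda>)

text \<open>Resampling \<open>\<Lambda> n\<close> does not change \<open>h\<close>, so the Gibbs property averages the other factor only.  Thus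
  \<open>prob_at n a\<close> is a version of the conditional probability of the symbol \<open>a\<close> at the identity given the
  coordinates outside \<open>\<Lambda> n\<close>.\<close>

lemma conditional_probability:
  assumes h: "h \<in> borel_measurable borel" "\<And>x. \<bar>h x\<bar> \<le> 1"
    and off: "\<And>x y. (\<And>g. g \<notin> \<Lambda> n \<Longrightarrow> y g = x g) \<Longrightarrow> h y = h x"
  shows "(\<integral>x. h x * of_bool (x 0 = a) \<partial>\<mu>) = (\<integral>x. h x * prob_at n a x \<partial>\<mu>)"
proof -
  have "(\<lambda>x. of_bool (x 0 = a) :: real) \<in> borel_measurable borel"
    by (rule measurable_local) (rule local_fun_coordinate)
  then have m: "(\<lambda>x. h x * of_bool (x 0 = a)) \<in> borel_measurable borel" using h(1) by measurable
  have "(\<integral>x. h x * of_bool (x 0 = a) \<partial>\<mu>) = (\<integral>x. gibbs_avg (\<Lambda> n) (\<lambda>x. h x * of_bool (x 0 = a)) x \<partial>\<mu>)"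
    by (rule integral_gibbs_measure[symmetric, OF finite_range_potential_axioms gibbs finite_\<Lambda> m, of 1])
       (simp add: h)
  moreover have "gibbs_avg (\<Lambda> n) (\<lambda>x. h x * of_bool (x 0 = a)) x = h x * prob_at n a x" for x
    unfolding origin_prob_def by (rule gibbs_avg_mult_off) (rule off)
  ultimately show ?thesis by simp
qed

lemma prob_at_off:
  assumes "m \<le> n" "\<And>g. g \<notin> \<Lambda> m \<Longrightarrow> y g = x g" shows "prob_at n a y = prob_at n a x"
  unfolding origin_prob_def
  by (rule gibbs_avg_cong_off) (use assms incseq_\<Lambda> in \<open>auto simp: incseq_def\<close>)

text \<open>Both conditional probabilities have the same correlation with \<open>prob_at n a\<close>, which does not see the
  coordinates in \<open>\<Lambda> n\<close>; so the increment is orthogonal to it.\<close>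

lemma prob_at_increment:
  assumes "m \<le> n"
  shows "(\<integral>x. (prob_at m a x - prob_at n a x)\<^sup>2 \<partial>\<mu>)
       = (\<integral>x. (prob_at m a x)\<^sup>2 \<partial>\<mu>) - (\<integral>x. (prob_at n a x)\<^sup>2 \<partial>\<mu>)"
proof -
  have b: "\<bar>prob_at i a x\<bar> \<le> 1" for i x using prob_at_range[of i a x] by simp
  have int: "integrable \<mu> (\<lambda>x. prob_at i a x * prob_at j a x)" for i j
  proof (rule \<mu>.integrable_const_bound[of _ 1])
    have "\<bar>prob_at i a x\<bar> * \<bar>prob_at j a x\<bar> \<le> 1 * 1" for x by (intro mult_mono b) auto
    then show "AE x in \<mu>. norm (prob_at i a x * prob_at j a x) \<le> 1" by (simp add: abs_mult)
  qed measurable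
  have "(\<integral>x. prob_at n a x * prob_at m a x \<partial>\<mu>) = (\<integral>x. prob_at n a x * of_bool (x 0 = a) \<partial>\<mu>)"
    by (rule conditional_probability[symmetric], rule measurable_prob_at, rule b, rule prob_at_off[OF assms])
  also have "\<dots> = (\<integral>x. prob_at n a x * prob_at n a x \<partial>\<mu>)"
    by (rule conditional_probability, rule measurable_prob_at, rule b, rule prob_at_off[OF order_refl])
  finally have orth: "(\<integral>x. prob_at n a x * prob_at m a x \<partial>\<mu>) = (\<integral>x. prob_at n a x * prob_at n a x \<partial>\<mu>)" .
  have "(\<integral>x. (prob_at m a x - prob_at n a x)\<^sup>2 \<partial>\<mu>) =
    (\<integral>x. prob_at m a x * prob_at m a x + prob_at n a x * prob_at n a x - 2 * (prob_at n a x * prob_at m a x) \<partial>\<mu>)"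
    by (rule Bochner_Integration.integral_cong) (auto simp: power2_eq_square algebra_simps)
  also have "\<dots> = (\<integral>x. prob_at m a x * prob_at m a x \<partial>\<mu>) + (\<integral>x. prob_at n a x * prob_at n a x \<partial>\<mu>)
      - 2 * (\<integral>x. prob_at n a x * prob_at m a x \<partial>\<mu>)"
    using int by simp
  finally show ?thesis by (simp add: orth power2_eq_square)
qed

text \<open>The squared \<open>L\<^sup>2\<close>-norms decrease by orthogonality, so they converge.  Along a subsequence on which
  their sum over the alphabet is within \<open>(1 / 4) ^ j\<close> of its limit, the increments are small enough for almost sure
  convergence.\<close>

lemma prob_at_converges:
  obtains k where "strict_mono k" "AE x in \<mu>. \<forall>a. convergent (\<lambda>j. prob_at (k j) a x)"
proof -
  define S where "S n = (\<Sum>a\<in>UNIV. \<integral>x. (prob_at n a x)\<^sup>2 \<partial>\<mu>)" for n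
  have inc: "(\<Sum>a\<in>UNIV. \<integral>x. (prob_at m a x - prob_at n a x)\<^sup>2 \<partial>\<mu>) = S m - S n" if "m \<le> n" for m n
    by (simp add: prob_at_increment[OF that] S_def sum_subtractf)
  have "decseq S"
  proof (rule decseq_SucI)
    fix n
    have "0 \<le> (\<Sum>a\<in>UNIV. \<integral>x. (prob_at n a x - prob_at (Suc n) a x)\<^sup>2 \<partial>\<mu>)" by (intro sum_nonneg) auto
    then show "S (Suc n) \<le> S n" by (simp add: inc)
  qed
  moreover have "0 \<le> S n" for n unfolding S_def by (intro sum_nonneg) auto
  ultimately obtain s where s: "S \<longlonglongrightarrow> s" "\<And>n. s \<le> S n"
    using decseq_convergent[of S 0] by blast
  have "eventually (\<lambda>n. S n < s + (1 / 4) ^ j) sequentially" for j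
    by (rule order_tendstoD(2)[OF s(1)]) simp
  then obtain k where k: "strict_mono k" "\<And>j. S (k j) < s + (1 / 4) ^ j"
    using exists_fast_subsequence[of "\<lambda>j n. S n < s + (1 / 4) ^ j"] by metis
  have "AE x in \<mu>. convergent (\<lambda>j. prob_at (k j) a x)" for a
  proof (rule \<mu>.AE_convergent_L2_increments)
    show "\<bar>prob_at (k j) a x\<bar> \<le> 1" for j x using prob_at_range[of "k j" a x] by simp
    fix j
    have "k j \<le> k (Suc j)" using k(1) by (simp add: strict_mono_Suc_iff less_imp_le)
    have "(\<integral>x. (prob_at (k j) a x - prob_at (k (Suc j)) a x)\<^sup>2 \<partial>\<mu>)
        \<le> (\<Sum>a\<in>UNIV. \<integral>x. (prob_at (k j) a x - prob_at (k (Suc j)) a x)\<^sup>2 \<partial>\<mu>)"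
      by (rule member_le_sum[of a UNIV "\<lambda>a. \<integral>x. (prob_at (k j) a x - prob_at (k (Suc j)) a x)\<^sup>2 \<partial>\<mu>"]) auto
    also have "\<dots> = S (k j) - S (k (Suc j))" by (rule inc) fact
    also have "\<dots> \<le> (1 / 4) ^ j" using k(2)[of j] s(2)[of "k (Suc j)"] by simp
    finally show "(\<integral>x. (prob_at (k j) a x - prob_at (k (Suc j)) a x)\<^sup>2 \<partial>\<mu>) \<le> (1 / 4) ^ j" .
  qed measurable
  then have "AE x in \<mu>. \<forall>a. convergent (\<lambda>j. prob_at (k j) a x)"
    by (simp add: AE_all_countable)
  with k(1) show ?thesis by (rule that)
qed

text \<open>A subsequence of the conditional probabilities converges almost surely.  The limit depends only
  on the tail of the sequence, so it is measurable for every \<open>coordinate_algebra (- \<Lambda> n)\<close>.  Rounding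
  the limit to multiples of \<open>1 / N\<close> gives a finite partition in the saturation, and on each of its cells
  the conditional distribution of the symbol at the identity is within \<open>1 / N\<close> of the limit.\<close>

lemma cond_entropy_saturation_le_limit:
  obtains k c where "strict_mono k" "(\<lambda>j. \<integral>x. origin_entropy (\<Lambda> (k j)) x \<partial>\<mu>) \<longlonglongrightarrow> c"
    "cond_partition_entropy \<mu> alphabet_partition (saturation \<mu> (coordinate_algebra L)) \<le> c"
proof -
  let ?\<Psi> = "cond_partition_entropy \<mu> alphabet_partition (saturation \<mu> (coordinate_algebra L))"
  obtain k where k: "strict_mono k" "AE x in \<mu>. \<forall>a. convergent (\<lambda>j. prob_at (k j) a x)"
    by (rule prob_at_converges)
  define q where "q a x = lim (\<lambda>j. prob_at (k j) a x)" for a x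
  have AE_q: "AE x in \<mu>. \<forall>a. (\<lambda>j. prob_at (k j) a x) \<longlonglongrightarrow> q a x"
    using k(2) by eventually_elim (simp add: q_def convergent_LIMSEQ_iff)
  have q_range: "q a x \<in> {0..1}" if "(\<lambda>j. prob_at (k j) a x) \<longlonglongrightarrow> q a x" for a x
    using that by (rule Lim_in_closed_set[rotated 3]) (use prob_at_range in auto)
  let ?N = "\<lambda>n. sigma UNIV (coordinate_algebra (- \<Lambda> n) :: ('g \<Rightarrow> 'a) set set)"
  have q_meas: "q a \<in> borel_measurable (?N n)" for a n
  proof -
    have "prob_at (k (j + n)) a \<in> borel_measurable (?N n)" for j
    proof (rule measurable_local_coordinate_algebra[OF local_on_origin_prob])
      have "n \<le> k (j + n)" using seq_suble[OF k(1), of "j + n"] by simp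
      then have "\<Lambda> n \<subseteq> \<Lambda> (k (j + n))" using incseq_\<Lambda> by (auto simp: incseq_def)
      then show "collar (\<Lambda> (k (j + n))) \<union> {0} - \<Lambda> (k (j + n)) \<subseteq> - \<Lambda> n" by auto
    qed (simp add: finite_collar finite_\<Lambda>)
    then have "(\<lambda>x. lim (\<lambda>j. prob_at (k (j + n)) a x)) \<in> borel_measurable (?N n)"
      by (rule borel_measurable_lim_metric)
    moreover have "lim (\<lambda>j. prob_at (k (j + n)) a x) = q a x" for x
      using lim_shift[of "\<lambda>j. prob_at (k j) a x" n] by (simp add: q_def)
    ultimately show ?thesis by simp
  qed
  have q_borel [measurable]: "q a \<in> borel_measurable borel" for a
    unfolding q_def by (rule borel_measurable_lim_metric) measurable
  let ?H = "\<lambda>x. \<Sum>a\<in>UNIV. eta (q a x)"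
  define c where "c = (\<integral>x. ?H x \<partial>\<mu>)"
  have AE_eta: "AE x in \<mu>. (\<lambda>j. origin_entropy (\<Lambda> (k j)) x) \<longlonglongrightarrow> ?H x"
    using AE_q
  proof eventually_elim
    case (elim x)
    show ?case unfolding origin_entropy_def
    proof (rule tendsto_sum)
      fix a
      show "(\<lambda>j. eta (prob_at (k j) a x)) \<longlonglongrightarrow> eta (q a x)"
        by (rule continuous_on_tendsto_compose[OF continuous_on_eta])
           (use elim q_range prob_at_range in auto)
    qed
  qed
  have meas_eta: "?H \<in> borel_measurable borel"
    unfolding eta_def by measurable
  have int_bound: "norm (origin_entropy (\<Lambda> n) x) \<le> CARD('a)" for n x
    using origin_entropy_nonneg[OF finite_\<Lambda>] origin_entropy_le[OF finite_\<Lambda>] by auto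
  have meas_ent: "origin_entropy (\<Lambda> n) \<in> borel_measurable borel" for n
    by (intro measurable_local local_fun_origin_entropy finite_\<Lambda>)
  have bound: "AE x in \<mu>. norm (origin_entropy (\<Lambda> (k j)) x) \<le> CARD('a)" for j
    using int_bound by simp
  have meas: "?H \<in> borel_measurable \<mu>"
    "\<And>j. origin_entropy (\<Lambda> (k j)) \<in> borel_measurable \<mu>" "integrable \<mu> (\<lambda>_. real CARD('a))"
    using meas_eta meas_ent by (simp_all add: measurable_cong_sets[OF sets_eq refl])
  have int_eta: "integrable \<mu> ?H"
    by (rule integrable_dominated_convergence[OF meas AE_eta bound])
  have lim: "(\<lambda>j. \<integral>x. origin_entropy (\<Lambda> (k j)) x \<partial>\<mu>) \<longlonglongrightarrow> c"
    unfolding c_def by (rule integral_dominated_convergence[OF meas AE_eta bound])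
  have "?\<Psi> \<le> c + \<epsilon>"
    if "\<epsilon> > 0" for \<epsilon>
  proof -
    let ?e = "\<epsilon> / CARD('a)"
    have e: "?e > 0" using that by simp
    have "uniformly_continuous_on {0..1} eta"
      by (rule compact_uniformly_continuous[OF continuous_on_eta]) simp
    then obtain \<delta> where \<delta>: "\<delta> > 0"
      "\<And>s t. s \<in> {0..1} \<Longrightarrow> t \<in> {0..1} \<Longrightarrow> dist s t < \<delta> \<Longrightarrow> dist (eta s) (eta t) < ?e"
      unfolding uniformly_continuous_on_def using e by meson
    obtain N :: nat where N: "N > 0" "1 / N < \<delta>"
      using reals_Archimedean[OF \<delta>(1)] by (auto simp: inverse_eq_divide) (metis of_nat_Suc zero_less_Suc)
    \<comment> \<open>Clamping gives \<open>J\<close> finite range; it has no effect where the limit exists.\<close>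
    define J where "J x a = max 0 (min (int N) \<lfloor>N * q a x\<rfloor>)" for x a
    define \<beta> where "\<beta> = (\<lambda>f. J -` {f}) ` range J"
    have "range J \<subseteq> Pi\<^sub>E UNIV (\<lambda>_. {0..int N})" by (auto simp: J_def)
    then have fin_range: "finite (range J)" by (rule finite_subset) (auto intro!: finite_PiE)
    then have fin: "finite \<beta>" by (simp add: \<beta>_def)
    have part: "partition_on UNIV \<beta>"
      by (rule partition_onI) (auto simp: \<beta>_def disjnt_def)
    have cell: "J -` {f} \<in> coordinate_algebra (- \<Lambda> n)" for f n
    proof -
      have [measurable]: "q a \<in> borel_measurable (?N n)" for a by (rule q_meas)
      have "(\<lambda>x. J x a) \<in> measurable (?N n) (count_space UNIV)" for a unfolding J_def by measurable
      then have "{x \<in> space (?N n). J x a = f a} \<in> sets (?N n)" for a by measurable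
      then have "{x \<in> space (?N n). \<forall>a\<in>UNIV. J x a = f a} \<in> sets (?N n)"
        by (intro sets.sets_Collect_finite_All) auto
      moreover have "{x \<in> space (?N n). \<forall>a\<in>UNIV. J x a = f a} = J -` {f}" by (auto simp: fun_eq_iff)
      ultimately show ?thesis unfolding sets_coordinate_algebra by simp
    qed
    have sat: "\<beta> \<subseteq> saturation \<mu> (coordinate_algebra L)"
      unfolding \<beta>_def using in_saturationI[OF \<mu>_prob cell exhaust] by auto
    have borel: "C \<in> sets borel" if "C \<in> \<beta>" for C
      using that cell coordinate_algebra_borel by (auto simp: \<beta>_def)
    then have borel': "\<beta> \<subseteq> sets (completion \<mu>)" using sets_eq by (auto intro: sets_completionI_sets)
    let ?m = "measure (completion \<mu>)"
    \<comment> \<open>On each cell the limit is almost constant, and its mean is the conditional probability.\<close>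
    have cell_bound: "?m C * (\<Sum>a\<in>UNIV. eta (?m ({x. x 0 = a} \<inter> C) / ?m C))
        \<le> (\<integral>x. indicator C x * (?H x + \<epsilon>) \<partial>\<mu>)" if C: "C \<in> \<beta>" for C
    proof (cases "?m C = 0")
      case True
      have "AE x in \<mu>. 0 \<le> indicator C x * (?H x + \<epsilon>)"
        using AE_q
      proof eventually_elim
        case (elim x)
        have "0 \<le> ?H x"
          using q_range elim by (intro sum_nonneg eta_nonneg) auto
        then show ?case using that \<open>\<epsilon> > 0\<close> by simp
      qed
      then show ?thesis using True integral_nonneg_AE by fastforce
    next
      case False
      obtain f where f: "C = J -` {f}" using C by (auto simp: \<beta>_def)
      have Cb [measurable]: "C \<in> sets borel" by (rule borel[OF C])
      have mC: "?m C = measure \<mu> C" using Cb sets_eq by (simp add: measure_completion)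
      then have pos: "measure \<mu> C > 0" using False by (simp add: zero_less_measure_iff)
      have loc: "local_on (- \<Lambda> n) (\<lambda>x. x \<in> C)" for n
        using cell[of f n] f by (intro local_on_coordinate_algebra) simp
      define r where "r a = ?m ({x. x 0 = a} \<inter> C) / ?m C" for a
      have mean: "(\<integral>x. indicator C x * q a x \<partial>\<mu>) = r a * measure \<mu> C" for a
      proof -
        have aC: "{x. x 0 = a} \<inter> C \<in> sets borel" using cylinder_borel[of 0 a] Cb by auto
        have "(\<integral>x. indicator C x * prob_at (k j) a x \<partial>\<mu>) = measure \<mu> ({x. x 0 = a} \<inter> C)" for j
        proof -
          have "(\<integral>x. indicator C x * prob_at (k j) a x \<partial>\<mu>) = (\<integral>x. indicator C x * of_bool (x 0 = a) \<partial>\<mu>)"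
          proof (rule conditional_probability[symmetric])
            fix x y :: "'g \<Rightarrow> 'a" assume "\<And>g. g \<notin> \<Lambda> (k j) \<Longrightarrow> y g = x g"
            then have "(y \<in> C) = (x \<in> C)" by (intro local_onD[OF loc[of "k j"]]) auto
            then show "indicator C y = (indicator C x :: real)" by (simp add: indicator_def)
          qed (auto simp: indicator_def)
          also have "\<dots> = (\<integral>x. indicator ({x. x 0 = a} \<inter> C) x \<partial>\<mu>)"
            by (rule Bochner_Integration.integral_cong) (auto simp: indicator_def)
          finally show ?thesis by (simp add: space_eq)
        qed
        moreover have "(\<lambda>j. \<integral>x. indicator C x * prob_at (k j) a x \<partial>\<mu>) \<longlonglongrightarrow> (\<integral>x. indicator C x * q a x \<partial>\<mu>)"
        proof (rule integral_dominated_convergence[where w = "\<lambda>_. 1"])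
          show "AE x in \<mu>. (\<lambda>j. indicator C x * prob_at (k j) a x) \<longlonglongrightarrow> indicator C x * q a x"
            using AE_q by eventually_elim (auto intro: tendsto_mult_left)
          show "AE x in \<mu>. norm (indicator C x * prob_at (k j) a x) \<le> 1" for j
            using prob_at_range[of "k j" a] by (auto simp: indicator_def)
        qed (simp_all add: measurable_cong_sets[OF sets_eq refl])
        ultimately have "(\<integral>x. indicator C x * q a x \<partial>\<mu>) = measure \<mu> ({x. x 0 = a} \<inter> C)"
          by (simp add: LIMSEQ_const_iff)
        then show ?thesis using aC sets_eq mC pos by (simp add: r_def measure_completion)
      qed
      have close: "AE x in \<mu>. x \<in> C \<longrightarrow> (\<forall>a. q a x \<in> {0..1} \<and> q a x \<in> {f a / N .. (f a + 1) / N})"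
        using AE_q
      proof eventually_elim
        case (elim x)
        have "q a x \<in> {0..1} \<and> q a x \<in> {f a / N .. (f a + 1) / N}" if "x \<in> C" for a
        proof -
          have q01: "q a x \<in> {0..1}" using q_range elim by auto
          then have "0 \<le> N * q a x" "N * q a x \<le> N" using N(1) by (auto simp: mult_le_cancel_left1)
          then have "0 \<le> \<lfloor>N * q a x\<rfloor>" "\<lfloor>N * q a x\<rfloor> \<le> int N" by (auto simp: floor_le_iff)
          then have "f a = \<lfloor>N * q a x\<rfloor>" using that f by (auto simp: J_def)
          then have "f a \<le> N * q a x" "N * q a x \<le> f a + 1" by linarith+
          then show ?thesis using q01 N(1) by (auto simp: field_simps)
        qed
        then show ?case by blast
      qed
      have int_ind: "integrable \<mu> (\<lambda>x. indicator C x * b)" for b :: real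
        using sets_eq by (intro integrable_mult_left integrable_real_indicator) (auto simp: \<mu>.emeasure_eq_measure)
      have int_q: "integrable \<mu> (\<lambda>x. indicator C x * q a x)" for a
      proof (rule \<mu>.integrable_const_bound[of _ 1])
        show "AE x in \<mu>. norm (indicator C x * q a x) \<le> 1"
          using close by eventually_elim (auto simp: indicator_def)
      qed (simp add: measurable_cong_sets[OF sets_eq refl])
      have ind_int: "(\<integral>x. indicator C x * b \<partial>\<mu>) = b * measure \<mu> C" for b :: real
        by (simp add: space_eq)
      have r_close: "r a \<in> {f a / N .. (f a + 1) / N} \<and> r a \<in> {0..1}" for a
      proof -
        have "(\<integral>x. indicator C x * b \<partial>\<mu>) \<le> (\<integral>x. indicator C x * q a x \<partial>\<mu>)"
          if "AE x in \<mu>. x \<in> C \<longrightarrow> b \<le> q a x" for b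
          by (rule integral_mono_AE[OF int_ind int_q]) (use that in eventually_elim, auto simp: indicator_def)
        then have lower: "b \<le> r a" if "AE x in \<mu>. x \<in> C \<longrightarrow> b \<le> q a x" for b
          using that pos by (simp add: ind_int mean mult_le_cancel_right)
        have "(\<integral>x. indicator C x * q a x \<partial>\<mu>) \<le> (\<integral>x. indicator C x * b \<partial>\<mu>)"
          if "AE x in \<mu>. x \<in> C \<longrightarrow> q a x \<le> b" for b
          by (rule integral_mono_AE[OF int_q int_ind]) (use that in eventually_elim, auto simp: indicator_def)
        then have upper: "r a \<le> b" if "AE x in \<mu>. x \<in> C \<longrightarrow> q a x \<le> b" for b
          using that pos by (simp add: ind_int mean mult_le_cancel_right)
        have "f a / N \<le> r a" by (rule lower) (use close in eventually_elim, auto)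
        moreover have "0 \<le> r a" by (rule lower) (use close in eventually_elim, auto)
        moreover have "r a \<le> (f a + 1) / N" by (rule upper) (use close in eventually_elim, auto)
        moreover have "r a \<le> 1" by (rule upper) (use close in eventually_elim, auto)
        ultimately show ?thesis by simp
      qed
      have "?m C * (\<Sum>a\<in>UNIV. eta (r a)) = (\<integral>x. indicator C x * (\<Sum>a\<in>UNIV. eta (r a)) \<partial>\<mu>)"
        by (simp add: ind_int mC mult.commute)
      also have "\<dots> \<le> (\<integral>x. indicator C x * (?H x + \<epsilon>) \<partial>\<mu>)"
      proof (rule integral_mono_AE[OF int_ind])
        have "integrable \<mu> (\<lambda>x. indicator C x *\<^sub>R (?H x + \<epsilon>))"
          using int_eta sets_eq by (intro integrable_mult_indicator) auto
        then show "integrable \<mu> (\<lambda>x. indicator C x * (?H x + \<epsilon>))" by simp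
        show "AE x in \<mu>. indicator C x * (\<Sum>a\<in>UNIV. eta (r a)) \<le> indicator C x * (?H x + \<epsilon>)"
          using close
        proof eventually_elim
          case (elim x)
          have "(\<Sum>a\<in>UNIV. eta (r a)) \<le> ?H x + \<epsilon>" if "x \<in> C"
          proof -
            have "eta (r a) \<le> eta (q a x) + ?e" for a
            proof -
              have qa: "q a x \<in> {0..1}" "q a x \<in> {f a / N .. (f a + 1) / N}" using elim that by auto
              have "\<bar>r a - q a x\<bar> \<le> 1 / N" using r_close[of a] qa(2) by (simp add: add_divide_distrib) linarith
              then have "dist (eta (r a)) (eta (q a x)) < ?e"
                using r_close[of a] qa N(2) by (intro \<delta>(2)) (auto simp: dist_real_def)
              then show ?thesis by (simp add: dist_real_def)
            qed
            then have "(\<Sum>a\<in>UNIV. eta (r a)) \<le> (\<Sum>a\<in>UNIV. eta (q a x) + ?e)" by (intro sum_mono)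
            then show ?thesis by (simp add: sum.distrib)
          qed
          then show ?case by (simp add: indicator_def)
        qed
      qed
      finally show ?thesis by (simp add: r_def)
    qed
    have "?\<Psi>
        \<le> partition_entropy \<mu> (partition_join alphabet_partition \<beta>) - partition_entropy \<mu> \<beta>"
      by (rule cond_entropy_saturation_le[OF \<mu>_prob fin part sat])
    also have "\<dots> = (\<Sum>C\<in>\<beta>. ?m C * (\<Sum>a\<in>UNIV. eta (?m ({x. x 0 = a} \<inter> C) / ?m C)))"
      by (rule entropy_difference_finite[OF \<mu>_prob fin part borel'])
    also have "\<dots> \<le> (\<Sum>C\<in>\<beta>. \<integral>x. indicator C x * (?H x + \<epsilon>) \<partial>\<mu>)"
      by (intro sum_mono cell_bound)
    also have "\<dots> = (\<integral>x. (\<Sum>C\<in>\<beta>. indicator C x * (?H x + \<epsilon>)) \<partial>\<mu>)"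
    proof (rule Bochner_Integration.integral_sum[symmetric])
      fix C assume "C \<in> \<beta>"
      then have "integrable \<mu> (\<lambda>x. indicator C x *\<^sub>R (?H x + \<epsilon>))"
        using int_eta sets_eq borel by (intro integrable_mult_indicator) auto
      then show "integrable \<mu> (\<lambda>x. indicator C x * (?H x + \<epsilon>))" by simp
    qed
    also have "\<dots> = (\<integral>x. ?H x + \<epsilon> \<partial>\<mu>)"
    proof (rule Bochner_Integration.integral_cong[OF refl])
      fix x
      have "(\<Sum>C\<in>\<beta>. indicator C x) = (\<Sum>f\<in>range J. indicator (J -` {f}) x :: real)"
        unfolding \<beta>_def by (subst sum.reindex) (auto simp: inj_on_def)
      also have "\<dots> = (\<Sum>f\<in>range J. if f = J x then 1 else 0)"
        by (intro sum.cong) (auto simp: indicator_def)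
      also have "\<dots> = 1" using fin_range by simp
      finally show "(\<Sum>C\<in>\<beta>. indicator C x * (?H x + \<epsilon>)) = ?H x + \<epsilon>"
        by (simp add: sum_distrib_right[symmetric])
    qed
    also have "\<dots> = c + \<epsilon>" using int_eta by (simp add: c_def \<mu>.prob_space)
    finally show ?thesis .
  qed
  then have "?\<Psi> \<le> c"
    by (rule field_le_epsilon)
  with k(1) lim show ?thesis by (rule that)
qed

end

section \<open>The weak* topology and local functions\<close>

text \<open>Subbasic open sets are given by continuous functions, which are uniform limits of local ones.\<close>

lemma weak_star_open_local:
  fixes \<mu> :: "('g \<Rightarrow> 'a::{finite,discrete_topology}) measure"
  assumes "openin weak_star_topology U" "\<mu> \<in> U"
  shows "\<exists>(\<F> :: (('g \<Rightarrow> 'a) \<Rightarrow> real) set) \<delta>. finite \<F> \<and> (\<forall>f\<in>\<F>. local_fun f) \<and> \<delta> > 0 \<and>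
    (\<forall>\<nu>\<in>space (prob_algebra borel). (\<forall>f\<in>\<F>. \<bar>(\<integral>x. f x \<partial>\<nu>) - (\<integral>x. f x \<partial>\<mu>)\<bar> < \<delta>) \<longrightarrow> \<nu> \<in> U)"
    (is "\<exists>\<F> \<delta>. ?P \<mu> U \<F> \<delta>")
proof -
  have "generate_topology_on {{\<nu> \<in> space (prob_algebra borel). (\<integral>x. f x \<partial>\<nu>) \<in> W} |
      (f :: ('g \<Rightarrow> 'a) \<Rightarrow> real) W. continuous_on UNIV f \<and> open W} U"
    using assms(1) by (simp add: weak_star_topology_def openin_topology_generated_by_iff)
  then show ?thesis using assms(2)
  proof (induction arbitrary: \<mu> rule: generate_topology_on.induct)
    case (Int A B)
    from Int.IH(1)[OF IntD1[OF Int.prems]] obtain \<F> \<delta> where 1: "?P \<mu> A \<F> \<delta>" by (elim exE)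
    from Int.IH(2)[OF IntD2[OF Int.prems]] obtain \<F>' \<delta>' where 2: "?P \<mu> B \<F>' \<delta>'" by (elim exE)
    have "?P \<mu> (A \<inter> B) (\<F> \<union> \<F>') (min \<delta> \<delta>')" using 1 2 by (auto simp: ball_Un)
    then show ?case by (intro exI)
  next
    case (UN K)
    then obtain A where A: "A \<in> K" "\<mu> \<in> A" by auto
    from UN.IH[OF this] obtain \<F> \<delta> where "?P \<mu> A \<F> \<delta>" by (elim exE)
    then have "?P \<mu> (\<Union>K) \<F> \<delta>" using A by auto
    then show ?case by (intro exI)
  next
    case (Basis A)
    then obtain f :: "('g \<Rightarrow> 'a) \<Rightarrow> real" and W where f: "continuous_on UNIV f" and W: "open W"
      and A: "A = {\<nu> \<in> space (prob_algebra borel). (\<integral>x. f x \<partial>\<nu>) \<in> W}" by auto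
    have "(\<integral>x. f x \<partial>\<mu>) \<in> W" and \<mu>: "\<mu> \<in> space (prob_algebra borel)" using Basis A by auto
    then obtain e where e: "e > 0" "ball (\<integral>x. f x \<partial>\<mu>) e \<subseteq> W" using W openE by metis
    obtain h where h: "local_fun h" "\<And>x. \<bar>f x - h x\<bar> < e / 3"
      using continuous_local_approximation[OF f, of "e / 3"] e(1) by auto
    obtain b where b: "\<And>x. \<bar>h x\<bar> \<le> b" using local_fun_bounded[OF h(1)] by blast
    have close: "\<bar>(\<integral>x. f x \<partial>\<nu>) - (\<integral>x. h x \<partial>\<nu>)\<bar> \<le> e / 3" if \<nu>: "\<nu> \<in> space (prob_algebra borel)" for \<nu>
    proof -
      interpret \<nu>: prob_space \<nu> using \<nu> by (simp add: space_prob_algebra)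
      have sets: "sets \<nu> = sets borel" using \<nu> by (simp add: space_prob_algebra)
      have hi: "integrable \<nu> h"
        by (rule \<nu>.integrable_const_bound[of _ b])
           (use b measurable_local[OF h(1)] in \<open>auto simp: measurable_cong_sets[OF sets refl]\<close>)
      have "\<bar>f x\<bar> \<le> b + e / 3" for x using b[of x] h(2)[of x] by linarith
      then have fi: "integrable \<nu> f"
        by (intro \<nu>.integrable_const_bound[of _ "b + e / 3"])
           (use borel_measurable_continuous_onI[OF f] in \<open>auto simp: measurable_cong_sets[OF sets refl]\<close>)
      have "\<bar>(\<integral>x. f x \<partial>\<nu>) - (\<integral>x. h x \<partial>\<nu>)\<bar> = \<bar>\<integral>x. f x - h x \<partial>\<nu>\<bar>" using fi hi by simp
      also have "\<dots> \<le> (\<integral>x. \<bar>f x - h x\<bar> \<partial>\<nu>)" by (rule integral_abs_bound)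
      also have "\<dots> \<le> (\<integral>x. e / 3 \<partial>\<nu>)"
        using fi hi h(2) by (intro integral_mono) (auto intro: less_imp_le)
      finally show ?thesis by (simp add: \<nu>.prob_space)
    qed
    have "\<nu> \<in> A" if \<nu>: "\<nu> \<in> space (prob_algebra borel)" and "\<bar>(\<integral>x. h x \<partial>\<nu>) - (\<integral>x. h x \<partial>\<mu>)\<bar> < e / 3" for \<nu>
    proof -
      have "dist (\<integral>x. f x \<partial>\<mu>) (\<integral>x. f x \<partial>\<nu>) < e"
        using close[OF \<nu>] close[OF \<mu>] that(2) unfolding dist_real_def by linarith
      then show ?thesis using e(2) \<nu> by (auto simp: A)
    qed
    then have "?P \<mu> A {h} (e / 3)" using h(1) e(1) by auto
    then show ?case by (intro exI)
  qed simp
qed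

lemma weak_star_ball_local:
  fixes \<mu> :: "('g \<Rightarrow> 'a::{finite,discrete_topology}) measure"
  assumes "weak_star_metric l" "\<mu> \<in> space (prob_algebra borel)" "\<epsilon> > 0"
  obtains \<F> :: "(('g \<Rightarrow> 'a) \<Rightarrow> real) set" and \<delta> where "finite \<F>" "\<And>f. f \<in> \<F> \<Longrightarrow> local_fun f" "\<delta> > 0"
    "\<And>\<nu>. \<nu> \<in> space (prob_algebra borel) \<Longrightarrow> (\<And>f. f \<in> \<F> \<Longrightarrow> \<bar>(\<integral>x. f x \<partial>\<nu>) - (\<integral>x. f x \<partial>\<mu>)\<bar> < \<delta>)
      \<Longrightarrow> l \<nu> \<mu> < \<epsilon>"
proof -
  interpret Metric_space "space (prob_algebra borel)" l
    using assms(1) by (simp add: weak_star_metric_def)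
  have U: "openin weak_star_topology (mball \<mu> \<epsilon>)"
    using openin_mball[of \<mu> \<epsilon>] assms(1) unfolding weak_star_metric_def by metis
  have "\<mu> \<in> mball \<mu> \<epsilon>" using assms(2,3) by simp
  from weak_star_open_local[OF U this] obtain \<F> :: "(('g \<Rightarrow> 'a) \<Rightarrow> real) set" and \<delta>
    where "finite \<F>" "\<forall>f\<in>\<F>. local_fun f" "\<delta> > 0"
    "\<forall>\<nu>\<in>space (prob_algebra borel). (\<forall>f\<in>\<F>. \<bar>(\<integral>x. f x \<partial>\<nu>) - (\<integral>x. f x \<partial>\<mu>)\<bar> < \<delta>) \<longrightarrow> \<nu> \<in> mball \<mu> \<epsilon>"
    by (elim exE conjE)
  then show ?thesis by (intro that[of \<F> \<delta>]) (auto simp: commute)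
qed

section \<open>Sofic approximations by Gibbs distributions\<close>

locale sofic_gibbs = finite_range_potential \<phi> D
  for \<phi> :: "('g::{countable,group_add} \<Rightarrow> 'a::{finite,discrete_topology}) \<Rightarrow> real" and D +
  fixes \<mu> :: "('g \<Rightarrow> 'a) measure" and V :: "nat \<Rightarrow> 'v set" and \<sigma> :: "nat \<Rightarrow> 'g \<Rightarrow> 'v \<Rightarrow> 'v"
  assumes infinite_group: "infinite (UNIV :: 'g set)"
    and sofic: "sofic_approximation V \<sigma>"
    and gibbs: "gibbs_measure \<phi> D \<mu>"
    and unique: "\<And>\<nu>. gibbs_measure \<phi> D \<nu> \<Longrightarrow> \<nu> = \<mu>"
begin

sublocale model: finite_model \<phi> D "V i" "\<sigma> i" for i
  by unfold_locales (use sofic in \<open>auto simp: sofic_approximation_def\<close>)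

lemma \<mu>_prob: "\<mu> \<in> space (prob_algebra borel)"
  using gibbs by (simp add: gibbs_measure_def)

lemma sets_eq: "sets \<mu> = sets borel"
  using \<mu>_prob by (rule sets_\<mu>)

sublocale \<mu>: prob_space \<mu> using \<mu>_prob by (simp add: space_prob_algebra)

lemma card_V_pos: "card (V i) > 0"
  using model.finite_V[of i] model.V_nonempty[of i] by (simp add: card_gt_0_iff)

definition unfaithful :: "'g set \<Rightarrow> nat \<Rightarrow> real" where
  "unfaithful B i = card {v \<in> V i. \<not> faithful_at (\<sigma> i) B v} / card (V i)"

text \<open>A vertex that is not faithful on \<open>B\<close> is exceptional for one of finitely many pairs of group elements, and
  the definition of a sofic approximation makes each exceptional set small.\<close>

lemma unfaithful_tendsto:
  assumes "finite B" shows "unfaithful B \<longlonglongrightarrow> 0"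
proof -
  let ?E = "\<lambda>(g, h) i. if g = h then {} else {v \<in> V i. \<sigma> i g v = \<sigma> i h v}"
  let ?M = "\<lambda>(g, h) i. {v \<in> V i. (\<sigma> i g \<circ> \<sigma> i h) v \<noteq> \<sigma> i (g + h) v}"
  have E: "(\<lambda>i. card (?E gh i) / card (V i)) \<longlonglongrightarrow> 0" for gh
  proof (cases "fst gh = snd gh")
    case False
    obtain g h where [simp]: "gh = (g, h)" by (cases gh)
    have "real (card {v \<in> V i. \<sigma> i g v = \<sigma> i h v}) / card (V i) = 1 - normalized_hamming (V i) (\<sigma> i g) (\<sigma> i h)" for i
    proof -
      have "card (V i) = card {v \<in> V i. \<sigma> i g v = \<sigma> i h v} + card {v \<in> V i. \<sigma> i g v \<noteq> \<sigma> i h v}"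
        using model.finite_V[of i] by (subst card_Un_disjoint[symmetric]) (auto intro!: arg_cong[of _ _ card])
      then have r: "real (card {v \<in> V i. \<sigma> i g v = \<sigma> i h v}) = card (V i) - real (card {v \<in> V i. \<sigma> i g v \<noteq> \<sigma> i h v})"
        by simp
      show ?thesis unfolding r using card_V_pos[of i] by (simp add: normalized_hamming_def diff_divide_distrib)
    qed
    moreover have "(\<lambda>i. 1 - normalized_hamming (V i) (\<sigma> i g) (\<sigma> i h)) \<longlonglongrightarrow> 1 - 1"
      using sofic False by (intro tendsto_intros) (auto simp: sofic_approximation_def)
    ultimately show ?thesis using False by simp
  qed (simp add: case_prod_unfold)
  have M: "(\<lambda>i. card (?M gh i) / card (V i)) \<longlonglongrightarrow> 0" for gh
    using sofic by (cases gh) (simp add: sofic_approximation_def normalized_hamming_def)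
  have "(\<lambda>i. \<Sum>gh\<in>B \<times> B. card (?E gh i) / card (V i) + card (?M gh i) / card (V i)) \<longlonglongrightarrow> (\<Sum>gh\<in>B \<times> B. 0 + 0)"
    by (intro tendsto_sum tendsto_add E M)
  then have lim: "(\<lambda>i. \<Sum>gh\<in>B \<times> B. card (?E gh i) / card (V i) + card (?M gh i) / card (V i)) \<longlonglongrightarrow> 0" by simp
  have le: "unfaithful B i \<le> (\<Sum>gh\<in>B \<times> B. card (?E gh i) / card (V i) + card (?M gh i) / card (V i))" for i
  proof -
    have "{v \<in> V i. \<not> faithful_at (\<sigma> i) B v} \<subseteq> (\<Union>gh\<in>B \<times> B. ?E gh i \<union> ?M gh i)"
      by (auto simp: faithful_at_def inj_on_def)
    then have "card {v \<in> V i. \<not> faithful_at (\<sigma> i) B v} \<le> card (\<Union>gh\<in>B \<times> B. ?E gh i \<union> ?M gh i)"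
      using model.finite_V[of i] assms by (intro card_mono) (auto split: if_splits)
    also have "\<dots> \<le> (\<Sum>gh\<in>B \<times> B. card (?E gh i \<union> ?M gh i))"
      using assms by (intro card_UN_le) auto
    also have "\<dots> \<le> (\<Sum>gh\<in>B \<times> B. card (?E gh i) + card (?M gh i))"
      by (intro sum_mono card_Un_le)
    finally have "real (card {v \<in> V i. \<not> faithful_at (\<sigma> i) B v}) \<le> (\<Sum>gh\<in>B \<times> B. real (card (?E gh i)) + real (card (?M gh i)))"
      by (simp only: of_nat_le_iff[where 'a = real, symmetric] of_nat_sum of_nat_add)
    then show ?thesis
      unfolding unfaithful_def add_divide_distrib[symmetric] sum_divide_distrib[symmetric]
      by (rule divide_right_mono) simp
  qed
  show ?thesis
    by (rule tendsto_sandwich[OF _ _ tendsto_const lim]) (use le in \<open>auto simp: unfaithful_def\<close>)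
qed

text \<open>A vertex that is faithful on \<open>B\<close> has \<open>card B\<close> distinct images, and \<open>B\<close> can be arbitrarily large.\<close>

lemma card_V_at_top: "filterlim (\<lambda>i. real (card (V i))) at_top sequentially"
  unfolding filterlim_at_top
proof
  fix Z :: real
  obtain B :: "'g set" where B: "finite B" "card B = nat \<lceil>Z\<rceil>"
    using infinite_arbitrarily_large[OF infinite_group] by metis
  have "eventually (\<lambda>i. unfaithful B i < 1) sequentially"
    by (rule order_tendstoD(2)[OF unfaithful_tendsto[OF B(1)]]) simp
  then show "eventually (\<lambda>i. Z \<le> real (card (V i))) sequentially"
  proof eventually_elim
    case (elim i)
    have "{v \<in> V i. \<not> faithful_at (\<sigma> i) B v} \<noteq> V i"
    proof
      assume "{v \<in> V i. \<not> faithful_at (\<sigma> i) B v} = V i"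
      then have "unfaithful B i = card (V i) / card (V i)" by (simp only: unfaithful_def)
      with elim card_V_pos[of i] show False by simp
    qed
    then obtain v where v: "v \<in> V i" "inj_on (\<lambda>g. \<sigma> i g v) B" by (auto simp: faithful_at_def)
    have "card B = card ((\<lambda>g. \<sigma> i g v) ` B)" using v(2) by (simp add: card_image)
    also have "\<dots> \<le> card (V i)"
      using model.finite_V[of i] model.s_in_V[OF v(1)] by (intro card_mono) auto
    finally show ?case using B(2) by linarith
  qed
qed

lemma const_over_card_V: "(\<lambda>i. c / real (card (V i))) \<longlonglongrightarrow> 0"
  by (rule tendsto_divide_0[OF tendsto_const]) (rule filterlim_at_top_imp_at_infinity[OF card_V_at_top])

text \<open>Decay of boundary influence gives concentration of empirical averages around \<open>\<mu>\<close>.\<close>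

lemma empirical_avg_L2:
  assumes f: "local_fun f"
  shows "(\<lambda>i. model.expect i (\<lambda>\<tau>. (model.empirical_avg i f \<tau> - (\<integral>x. f x \<partial>\<mu>))\<^sup>2)) \<longlonglongrightarrow> 0" (is "?E \<longlonglongrightarrow> 0")
proof (rule order_tendstoI)
  fix e :: real assume "0 < e"
  obtain b where b: "b \<ge> 0" "\<And>x. \<bar>f x\<bar> \<le> b" using local_fun_bounded[OF f] by blast
  obtain W where W: "finite W" "local_on W f" using f by (rule local_funE)
  \<comment> \<open>The choice of the tolerance makes \<open>2 * b * ?\<epsilon>\<close>, the limit of the variance bound, smaller than \<open>e\<close>.\<close>
  let ?c = "\<integral>x. f x \<partial>\<mu>" and ?\<epsilon> = "e / (2 * b + 1) / 2"
  have fi: "integrable \<mu> f"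
    by (rule \<mu>.integrable_const_bound[of _ b])
       (use b measurable_local[OF f] in \<open>auto simp: measurable_cong_sets[OF sets_eq refl]\<close>)
  have "\<bar>?c\<bar> \<le> (\<integral>x. \<bar>f x\<bar> \<partial>\<mu>)" by (rule integral_abs_bound)
  also have "\<dots> \<le> (\<integral>x. b \<partial>\<mu>)" using fi b by (intro integral_mono) auto
  finally have c: "\<bar>?c\<bar> \<le> b" by (simp add: \<mu>.prob_space)
  have \<epsilon>: "?\<epsilon> > 0" using \<open>0 < e\<close> b(1) by simp
  obtain F where F: "finite F" "\<And>x. \<bar>gibbs_avg F f x - ?c\<bar> < ?\<epsilon>"
    using unique_gibbs_uniform_convergence[OF finite_range_potential_axioms unique f \<epsilon>] by blast
  let ?B = "model.scope F \<union> W"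
  have fin: "finite ?B" using F(1) W(1) by (simp add: model.finite_scope)
  have bound: "?E i \<le> 2 * b * ?\<epsilon> + 4 * b\<^sup>2 * (unfaithful ?B i + (card W * card F) / card (V i))" for i
    unfolding unfaithful_def of_nat_mult
    using model.empirical_avg_variance[OF W(2,1) b(2) c b(1) F(1) less_imp_le[OF F(2)] subset_refl, of i] by simp
  have "(\<lambda>i. 2 * b * ?\<epsilon> + 4 * b\<^sup>2 * (unfaithful ?B i + (card W * card F) / card (V i)))
      \<longlonglongrightarrow> 2 * b * ?\<epsilon> + 4 * b\<^sup>2 * (0 + 0)"
    by (intro tendsto_intros unfaithful_tendsto[OF fin] const_over_card_V)
  moreover have "2 * b * ?\<epsilon> + 4 * b\<^sup>2 * (0 + 0) < e"
    using \<open>0 < e\<close> b(1) by (simp add: field_simps) (smt (verit) mult_nonneg_nonneg)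
  ultimately have "eventually (\<lambda>i. 2 * b * ?\<epsilon> + 4 * b\<^sup>2 * (unfaithful ?B i + (card W * card F) / card (V i)) < e) sequentially"
    by (rule order_tendstoD(2))
  then show "eventually (\<lambda>i. ?E i < e) sequentially"
    by eventually_elim (use bound le_less_trans in blast)
next
  fix e :: real assume "e < 0"
  moreover have "0 \<le> ?E i" for i
    using model.expect_mono[of i "\<lambda>_. 0" "\<lambda>\<tau>. (model.empirical_avg i f \<tau> - (\<integral>x. f x \<partial>\<mu>))\<^sup>2"] by simp
  ultimately have "e < ?E i" for i using less_le_trans by blast
  then show "eventually (\<lambda>i. e < ?E i) sequentially" by (rule always_eventually[OF allI])
qed

text \<open>The square of a mean is at most the mean of the square, so convergence in \<open>L\<^sup>2\<close> gives convergence of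
  means.\<close>

lemma expect_empirical_avg:
  assumes f: "local_fun f"
  shows "(\<lambda>i. model.expect i (model.empirical_avg i f)) \<longlonglongrightarrow> (\<integral>x. f x \<partial>\<mu>)"
proof -
  let ?c = "\<integral>x. f x \<partial>\<mu>"
  have le: "\<bar>model.expect i (model.empirical_avg i f) - ?c\<bar>
      \<le> sqrt (model.expect i (\<lambda>\<tau>. (model.empirical_avg i f \<tau> - ?c)\<^sup>2))" for i
  proof -
    define Y where "Y \<tau> = model.empirical_avg i f \<tau> - ?c" for \<tau>
    define y where "y = model.expect i Y"
    have "0 \<le> model.expect i (\<lambda>\<tau>. (Y \<tau> - y)\<^sup>2)"
      using model.expect_mono[of i "\<lambda>_. 0" "\<lambda>\<tau>. (Y \<tau> - y)\<^sup>2"] by simp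
    also have "\<dots> = model.expect i (\<lambda>\<tau>. (Y \<tau>)\<^sup>2 - 2 * y * Y \<tau> + y\<^sup>2)"
      by (simp add: power2_diff algebra_simps)
    also have "\<dots> = model.expect i (\<lambda>\<tau>. (Y \<tau>)\<^sup>2) - 2 * y * y + y\<^sup>2"
      by (simp add: model.expect_add model.expect_diff model.expect_cmult y_def del: power2_eq_square)
    finally have "y\<^sup>2 \<le> model.expect i (\<lambda>\<tau>. (Y \<tau>)\<^sup>2)" by (simp add: power2_eq_square)
    then have "\<bar>y\<bar> \<le> sqrt (model.expect i (\<lambda>\<tau>. (Y \<tau>)\<^sup>2))" by (rule real_le_rsqrt[OF order_trans, rotated]) simp
    moreover have "y = model.expect i (model.empirical_avg i f) - ?c"
      by (simp add: y_def Y_def[abs_def] model.expect_diff)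
    ultimately show ?thesis by (simp add: Y_def)
  qed
  have "(\<lambda>i. sqrt (model.expect i (\<lambda>\<tau>. (model.empirical_avg i f \<tau> - ?c)\<^sup>2))) \<longlonglongrightarrow> sqrt 0"
    by (intro tendsto_intros empirical_avg_L2 f)
  then have lim: "(\<lambda>i. sqrt (model.expect i (\<lambda>\<tau>. (model.empirical_avg i f \<tau> - ?c)\<^sup>2))) \<longlonglongrightarrow> 0"
    by (simp only: real_sqrt_zero)
  have "(\<lambda>i. model.expect i (model.empirical_avg i f) - ?c) \<longlonglongrightarrow> 0"
    by (rule Lim_null_comparison[OF _ lim]) (use le in auto)
  then show ?thesis by (simp add: LIM_zero_iff)
qed

lemma integral_empirical_measure:
  assumes "f \<in> borel_measurable borel"
  shows "(\<integral>x. f x \<partial>empirical_measure (V i) (\<sigma> i) \<tau>) = model.empirical_avg i f \<tau>"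
proof -
  have "(\<integral>x. f x \<partial>empirical_measure (V i) (\<sigma> i) \<tau>) = (\<integral>v. f (pullback_name (\<sigma> i) \<tau> v) \<partial>uniform_count_measure (V i))"
    unfolding empirical_measure_def
    by (rule integral_distr) (use assms in \<open>auto simp: measurable_def space_uniform_count_measure sets_uniform_count_measure\<close>)
  then show ?thesis
    by (simp add: integral_uniform_count_measure model.finite_V model.empirical_avg_def)
qed

lemma empirical_measure_prob: "empirical_measure (V i) (\<sigma> i) \<tau> \<in> space (prob_algebra borel)"
proof -
  have "prob_space (uniform_count_measure (V i))"
    by (rule prob_space_uniform_count_measure[OF model.finite_V model.V_nonempty])
  then have "prob_space (empirical_measure (V i) (\<sigma> i) \<tau>)"
    unfolding empirical_measure_def
    by (rule prob_space.prob_space_distr) (auto simp: measurable_def space_uniform_count_measure sets_uniform_count_measure)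
  then show ?thesis by (simp add: space_prob_algebra empirical_measure_def)
qed

text \<open>A weak* neighbourhood of \<open>\<mu>\<close> contains one given by finitely many local functions; by Chebyshev's
  inequality each of them has an atypical empirical average with small probability only.\<close>

lemma good_models_probable:
  assumes "weak_star_metric l" "\<epsilon> > 0"
  shows "(\<lambda>i. model.expect i (\<lambda>\<tau>. of_bool (\<tau> \<notin> good_models l (V i) (\<sigma> i) \<mu> \<epsilon>))) \<longlonglongrightarrow> 0" (is "?E \<longlonglongrightarrow> 0")
proof -
  obtain \<F> :: "(('g \<Rightarrow> 'a) \<Rightarrow> real) set" and \<delta> where \<F>: "finite \<F>" "\<And>f. f \<in> \<F> \<Longrightarrow> local_fun f" and \<delta>: "\<delta> > 0"
    and ball: "\<And>\<nu>. \<nu> \<in> space (prob_algebra borel) \<Longrightarrow>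
      (\<And>f. f \<in> \<F> \<Longrightarrow> \<bar>(\<integral>x. f x \<partial>\<nu>) - (\<integral>x. f x \<partial>\<mu>)\<bar> < \<delta>) \<Longrightarrow> l \<nu> \<mu> < \<epsilon>"
    by (rule weak_star_ball_local[OF assms(1) \<mu>_prob assms(2)]) blast
  let ?Y = "\<lambda>i f \<tau>. (model.empirical_avg i f \<tau> - (\<integral>x. f x \<partial>\<mu>))\<^sup>2"
  have le: "?E i \<le> (\<Sum>f\<in>\<F>. model.expect i (?Y i f) / \<delta>\<^sup>2)" for i
  proof -
    have pw: "of_bool (\<tau> \<notin> good_models l (V i) (\<sigma> i) \<mu> \<epsilon>) \<le> (\<Sum>f\<in>\<F>. inverse (\<delta>\<^sup>2) * ?Y i f \<tau>)"
      if \<tau>: "\<tau> \<in> patterns (V i)" for \<tau>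
    proof (cases "\<tau> \<in> good_models l (V i) (\<sigma> i) \<mu> \<epsilon>")
      case False
      then have "\<not> l (empirical_measure (V i) (\<sigma> i) \<tau>) \<mu> < \<epsilon>" using \<tau> by (simp add: good_models_def)
      then obtain f where f: "f \<in> \<F>" "\<not> \<bar>(\<integral>x. f x \<partial>empirical_measure (V i) (\<sigma> i) \<tau>) - (\<integral>x. f x \<partial>\<mu>)\<bar> < \<delta>"
        using ball[OF empirical_measure_prob] by blast
      then have "\<delta> \<le> \<bar>model.empirical_avg i f \<tau> - (\<integral>x. f x \<partial>\<mu>)\<bar>"
        using measurable_local[OF \<F>(2)[OF f(1)]] by (simp add: integral_empirical_measure)
      then have "\<delta>\<^sup>2 \<le> ?Y i f \<tau>" using \<delta> by (metis abs_of_pos abs_le_square_iff)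
      then have "1 \<le> inverse (\<delta>\<^sup>2) * ?Y i f \<tau>" using \<delta> by (simp add: field_simps)
      also have "\<dots> \<le> (\<Sum>f\<in>\<F>. inverse (\<delta>\<^sup>2) * ?Y i f \<tau>)"
        by (rule member_le_sum) (use f \<F>(1) in auto)
      finally show ?thesis using False by simp
    qed (auto intro!: sum_nonneg)
    have "?E i \<le> model.expect i (\<lambda>\<tau>. \<Sum>f\<in>\<F>. inverse (\<delta>\<^sup>2) * ?Y i f \<tau>)"
      by (rule model.expect_mono) (rule pw)
    also have "\<dots> = (\<Sum>f\<in>\<F>. model.expect i (?Y i f) / \<delta>\<^sup>2)"
      by (simp add: model.expect_sum model.expect_cmult divide_inverse mult.commute)
    finally show ?thesis .
  qed
  have "(\<lambda>i. \<Sum>f\<in>\<F>. model.expect i (?Y i f) / \<delta>\<^sup>2) \<longlonglongrightarrow> (\<Sum>f\<in>\<F>. 0 / \<delta>\<^sup>2)"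
    using \<delta> by (intro tendsto_intros empirical_avg_L2 \<F>) auto
  then have lim: "(\<lambda>i. \<Sum>f\<in>\<F>. model.expect i (?Y i f) / \<delta>\<^sup>2) \<longlonglongrightarrow> 0" by simp
  have "0 \<le> ?E i" for i
    using model.expect_mono[of i "\<lambda>_. 0" "\<lambda>\<tau>. of_bool (\<tau> \<notin> good_models l (V i) (\<sigma> i) \<mu> \<epsilon>)"] by simp
  then show ?thesis
    by (intro tendsto_sandwich[OF _ _ tendsto_const lim]) (use le in auto)
qed

end

section \<open>Revealing the symbols in random order\<close>

locale ordered_sofic_gibbs = sofic_gibbs \<phi> D \<mu> V \<sigma> + random_order P \<xi>
  for \<phi> :: "('g::{countable,group_add} \<Rightarrow> 'a::{finite,discrete_topology}) \<Rightarrow> real" and D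
    and \<mu> :: "('g \<Rightarrow> 'a) measure" and V :: "nat \<Rightarrow> 'v set" and \<sigma> :: "nat \<Rightarrow> 'g \<Rightarrow> 'v \<Rightarrow> 'v"
    and P :: "'w measure" and \<xi> :: "'g \<Rightarrow> 'w \<Rightarrow> real"
begin

definition past :: "'g set \<Rightarrow> 'w \<Rightarrow> 'g set" where
  "past F = precursors (\<lambda>g. g) F 0"

definition window_entropy :: "'g set \<Rightarrow> real" where
  "window_entropy \<Lambda> = (\<integral>x. origin_entropy \<Lambda> x \<partial>\<mu>)"

definition mean_window_entropy :: "'g set \<Rightarrow> real" where
  "mean_window_entropy F = (\<integral>\<omega>. window_entropy (F - past F \<omega>) \<partial>P)"

text \<open>The part of the chain rule that faithful vertices contribute if each of them has past \<open>S\<close> in \<open>F\<close> and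
  everything outside the image of \<open>F\<close> is known.\<close>

definition faithful_entropy :: "'g set \<Rightarrow> nat \<Rightarrow> 'g set \<Rightarrow> 'g set \<Rightarrow> real" where
  "faithful_entropy B i F S = (\<Sum>v | v \<in> V i \<and> faithful_at (\<sigma> i) B v.
     model.expect i (\<lambda>\<tau>. origin_entropy (F - S) (pullback_name (\<sigma> i) \<tau> v)))"

lemma integrable_past:
  assumes "finite F" "0 \<in> F" shows "integrable P (\<lambda>\<omega>. (G :: 'g set \<Rightarrow> real) (past F \<omega>))"
  unfolding past_def by (rule integral_precursors(1)) (use assms in auto)

lemma past_subset: "past F \<omega> \<subseteq> F - {0}"
  by (auto simp: past_def precursors_def)

text \<open>The vertices of a finite model are revealed in the order of the labels that an embedding of
  \<open>V i\<close> into the group assigns to them.  A faithful vertex \<open>v\<close> sees the set of those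
  \<open>g \<in> F\<close> whose images come earlier; what is revealed before \<open>v\<close> misses the image of the rest of
  \<open>F\<close>.  The set of earlier \<open>g\<close> has the same law as \<open>past F\<close>.\<close>

lemma entropy_ge_faithful_entropy:
  assumes F: "finite F" "0 \<in> F" and B: "\<And>\<Lambda>. \<Lambda> \<subseteq> F \<Longrightarrow> model.scope \<Lambda> \<subseteq> B" "0 \<in> B"
  shows "(\<integral>\<omega>. faithful_entropy B i F (past F \<omega>) \<partial>P) \<le> model.entropy_on i (V i)"
proof -
  let ?V = "V i" and ?s = "\<sigma> i"
  let ?good = "{v. v \<in> V i \<and> faithful_at (\<sigma> i) B v}"
  let ?G = "\<lambda>v S. model.expect i (\<lambda>\<tau>. origin_entropy (F - S) (pullback_name (\<sigma> i) \<tau> v))"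
  have FB: "F \<subseteq> B" using B(1)[of F] by (auto simp: model.scope_def)
  obtain j :: "'v \<Rightarrow> 'g" where j: "inj_on j ?V"
  proof -
    obtain X :: "'g set" where "finite X" "card X = card ?V"
      using infinite_arbitrarily_large[OF infinite_group] by metis
    then obtain j where "bij_betw j ?V X"
      using finite_same_card_bij[OF model.finite_V[of i]] by metis
    then show ?thesis using that by (auto simp: bij_betw_def)
  qed
  have inj_v: "inj_on (\<lambda>g. j (?s g v)) F" if "v \<in> ?good" for v
  proof (rule inj_onI)
    fix g h assume gh: "g \<in> F" "h \<in> F" "j (?s g v) = j (?s h v)"
    then have "?s g v = ?s h v"
      using j model.s_in_V[of v i] that by (auto dest: inj_onD)
    then show "g = h" using that gh FB by (auto simp: faithful_at_def dest: inj_onD)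
  qed
  let ?past = "\<lambda>v. precursors (\<lambda>g. j (?s g v)) F 0"
  have good: "finite ?good" using model.finite_V[of i] by simp
  have step: "(\<Sum>v\<in>?good. ?G v (?past v \<omega>)) \<le> model.entropy_on i ?V" if inj: "inj (\<lambda>g. \<xi> g \<omega>)" for \<omega>
  proof -
    define r where "r v = \<xi> (j v) \<omega>" for v
    define W where "W v = {u \<in> ?V. r u < r v}" for v
    have "inj_on r ?V" using j inj by (auto simp: r_def inj_on_def)
    then have chain: "model.entropy_on i ?V = (\<Sum>v\<in>?V. model.entropy_on i (insert v (W v)) - model.entropy_on i (W v))"
      unfolding W_def using model.finite_V by (intro model.entropy_chain_rule)
    have "?G v (?past v \<omega>) \<le> model.entropy_on i (insert v (W v)) - model.entropy_on i (W v)" if v: "v \<in> ?good" for v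
    proof -
      let ?\<Lambda> = "F - ?past v \<omega>"
      have "?s 0 (?s 0 v) = ?s (0 + 0) v" using v B(2) by (auto simp: faithful_at_def)
      then have s0: "?s 0 v = v" using model.s_inj[of i 0 "?s 0 v" v] by simp
      have "W v \<inter> (\<lambda>g. ?s g v) ` ?\<Lambda> = {}"
        by (auto simp: W_def r_def precursors_def s0)
      then show ?thesis
        using v F by (intro model.entropy_increment_ge[where B = B] s0 B(1)) (auto simp: precursors_def)
    qed
    then have "(\<Sum>v\<in>?good. ?G v (?past v \<omega>)) \<le> (\<Sum>v\<in>?good. model.entropy_on i (insert v (W v)) - model.entropy_on i (W v))"
      by (rule sum_mono)
    also have "\<dots> \<le> (\<Sum>v\<in>?V. model.entropy_on i (insert v (W v)) - model.entropy_on i (W v))"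
      using model.finite_V[of i] model.entropy_increment_nonneg by (intro sum_mono2) auto
    finally show ?thesis by (simp add: chain)
  qed
  have int: "integrable P (\<lambda>\<omega>. ?G v (?past v \<omega>))" if "v \<in> ?good" for v
    by (rule integral_precursors(1)[OF F inj_v[OF that]])
  have law: "(\<integral>\<omega>. ?G v (?past v \<omega>) \<partial>P) = (\<integral>\<omega>. ?G v (past F \<omega>) \<partial>P)" if "v \<in> ?good" for v
    unfolding past_def
    using integral_precursors(2)[OF F inj_v[OF that], of "?G v"] integral_precursors(2)[OF F, of "\<lambda>g. g" "?G v"] by simp
  have "(\<integral>\<omega>. faithful_entropy B i F (past F \<omega>) \<partial>P) = (\<Sum>v\<in>?good. \<integral>\<omega>. ?G v (past F \<omega>) \<partial>P)"
    unfolding faithful_entropy_def by (rule Bochner_Integration.integral_sum) (rule integrable_past[OF F])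
  also have "\<dots> = (\<integral>\<omega>. (\<Sum>v\<in>?good. ?G v (?past v \<omega>)) \<partial>P)"
    using int law by (subst Bochner_Integration.integral_sum) auto
  also have "\<dots> \<le> (\<integral>\<omega>. model.entropy_on i ?V \<partial>P)"
  proof (rule integral_mono_AE)
    show "integrable P (\<lambda>\<omega>. \<Sum>v\<in>?good. ?G v (?past v \<omega>))" using int by (intro Bochner_Integration.integrable_sum) auto
    show "AE \<omega> in P. (\<Sum>v\<in>?good. ?G v (?past v \<omega>)) \<le> model.entropy_on i ?V"
      using AE_inj_xi by eventually_elim (rule step)
  qed simp
  finally show ?thesis by (simp add: prob_space)
qed

text \<open>Up to the few vertices that are not faithful, the sum is an expected empirical average of a local
  function.\<close>

lemma faithful_entropy_ge:
  assumes "finite F" "finite B" "\<delta> > 0"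
  shows "eventually (\<lambda>i. window_entropy (F - S) - \<delta> \<le> faithful_entropy B i F S / card (V i)) sequentially"
proof -
  let ?f = "origin_entropy (F - S)"
  have fin: "finite (F - S)" using assms(1) by simp
  have le: "model.expect i (model.empirical_avg i ?f) - CARD('a) * unfaithful B i \<le> faithful_entropy B i F S / card (V i)" for i
  proof -
    let ?E = "\<lambda>v. model.expect i (\<lambda>\<tau>. ?f (pullback_name (\<sigma> i) \<tau> v))"
    let ?good = "{v. v \<in> V i \<and> faithful_at (\<sigma> i) B v}" and ?bad = "{v \<in> V i. \<not> faithful_at (\<sigma> i) B v}"
    have "?E v \<le> CARD('a)" for v
      using model.expect_mono[of i "\<lambda>\<tau>. ?f (pullback_name (\<sigma> i) \<tau> v)" "\<lambda>_. CARD('a)"] origin_entropy_le[OF fin] by simp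
    then have "(\<Sum>v\<in>?bad. ?E v) \<le> card ?bad * CARD('a)"
      using sum_bounded_above[of ?bad ?E "CARD('a)"] by simp
    moreover have "(\<Sum>v\<in>V i. ?E v) = (\<Sum>v\<in>?good. ?E v) + (\<Sum>v\<in>?bad. ?E v)"
      using model.finite_V[of i] by (subst sum.union_disjoint[symmetric]) (auto intro!: sum.cong)
    ultimately have "(\<Sum>v\<in>V i. ?E v) - card ?bad * CARD('a) \<le> faithful_entropy B i F S"
      by (simp add: faithful_entropy_def)
    then have "((\<Sum>v\<in>V i. ?E v) - card ?bad * CARD('a)) / card (V i) \<le> faithful_entropy B i F S / card (V i)"
      by (rule divide_right_mono) simp
    moreover have "model.expect i (model.empirical_avg i ?f) = (\<Sum>v\<in>V i. ?E v) / card (V i)"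
      unfolding model.empirical_avg_def[abs_def] divide_inverse_commute
      by (simp add: model.expect_cmult model.expect_sum)
    ultimately show ?thesis by (simp add: unfaithful_def diff_divide_distrib mult.commute)
  qed
  have "(\<lambda>i. model.expect i (model.empirical_avg i ?f) - CARD('a) * unfaithful B i) \<longlonglongrightarrow> window_entropy (F - S) - real CARD('a) * 0"
    unfolding window_entropy_def
    by (intro tendsto_intros expect_empirical_avg local_fun_origin_entropy fin unfaithful_tendsto assms)
  then have "eventually (\<lambda>i. window_entropy (F - S) - \<delta> < model.expect i (model.empirical_avg i ?f) - CARD('a) * unfaithful B i) sequentially"
    by (rule order_tendstoD(1)) (use assms(3) in simp)
  then show ?thesis by eventually_elim (use le less_le_trans less_imp_le in blast)
qed

text \<open>Only finitely many pasts \<open>S \<subseteq> F\<close> occur, so the asymptotic bounds hold for all of them at once and can be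
  averaged over the random order.\<close>

lemma entropy_rate_ge:
  assumes F: "finite F" "0 \<in> F" and "\<delta> > 0"
  shows "eventually (\<lambda>i. mean_window_entropy F - \<delta> \<le> model.entropy_on i (V i) / card (V i)) sequentially"
proof -
  define B where "B = insert 0 (\<Union>\<Lambda>\<in>Pow F. model.scope \<Lambda>)"
  have fin: "finite B" unfolding B_def using F(1) by (auto intro: model.finite_scope finite_subset)
  have "eventually (\<lambda>i. \<forall>S\<in>Pow F. window_entropy (F - S) - \<delta> \<le> faithful_entropy B i F S / card (V i)) sequentially"
    by (rule eventually_ball_finite) (use F(1) fin assms(3) faithful_entropy_ge in auto)
  then show ?thesis
  proof eventually_elim
    case (elim i)
    have sub: "past F \<omega> \<in> Pow F" for \<omega> using past_subset by blast
    have "mean_window_entropy F - \<delta> = (\<integral>\<omega>. window_entropy (F - past F \<omega>) - \<delta> \<partial>P)"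
      using integrable_past[OF F, of "\<lambda>S. window_entropy (F - S)"] by (simp add: mean_window_entropy_def prob_space)
    also have "\<dots> \<le> (\<integral>\<omega>. faithful_entropy B i F (past F \<omega>) / card (V i) \<partial>P)"
      using elim sub integrable_past[OF F, of "\<lambda>S. window_entropy (F - S) - \<delta>"]
        integrable_past[OF F, of "\<lambda>S. faithful_entropy B i F S / card (V i)"]
      by (intro integral_mono) auto
    also have "\<dots> = (\<integral>\<omega>. faithful_entropy B i F (past F \<omega>) \<partial>P) / card (V i)" by simp
    also have "\<dots> \<le> model.entropy_on i (V i) / card (V i)"
      by (intro divide_right_mono entropy_ge_faithful_entropy F) (auto simp: B_def)
    finally show ?case .
  qed
qed

section \<open>The lower bound on sofic entropy\<close>

text \<open>The Gibbs distribution of the finite model is almost supported on the good models, so the logarithm of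
  their number is at least its entropy, up to errors of order \<open>o(card (V i))\<close>.\<close>

lemma sofic_entropy_ge_window:
  assumes l: "weak_star_metric l" and F: "finite F" "0 \<in> F"
  shows "ereal (mean_window_entropy F) \<le> sofic_entropy l V \<sigma> \<mu>"
  unfolding sofic_entropy_def
proof (rule INF_greatest)
  fix \<epsilon> :: real assume "\<epsilon> \<in> {0<..}"
  then have \<epsilon>: "\<epsilon> > 0" by simp
  let ?S = "\<lambda>i. good_models l (V i) (\<sigma> i) \<mu> \<epsilon>"
  let ?p = "\<lambda>i. model.expect i (\<lambda>\<tau>. of_bool (\<tau> \<notin> ?S i))"
  let ?rate = "\<lambda>i. ln_card (?S i) / ereal (card (V i))"
  have rate: "ereal (mean_window_entropy F - \<delta>) \<le> limsup ?rate" if "\<delta> > 0" for \<delta>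
  proof (rule le_Limsup)
    have p0: "?p \<longlonglongrightarrow> 0" by (rule good_models_probable[OF l \<epsilon>])
    have "(\<lambda>i. ln 2 / real (card (V i)) + ?p i * ln CARD('a)) \<longlonglongrightarrow> 0 + 0 * ln CARD('a)"
      by (intro tendsto_intros const_over_card_V p0)
    then have "eventually (\<lambda>i. ln 2 / real (card (V i)) + ?p i * ln CARD('a) < \<delta> / 2) sequentially"
      by (rule order_tendstoD(2)) (use that in simp)
    moreover have "eventually (\<lambda>i. ?p i < 1) sequentially" by (rule order_tendstoD(2)[OF p0]) simp
    moreover have "eventually (\<lambda>i. mean_window_entropy F - \<delta> / 2 \<le> model.entropy_on i (V i) / card (V i)) sequentially"
      by (rule entropy_rate_ge[OF F]) (use that in simp)
    ultimately show "eventually (\<lambda>i. ereal (mean_window_entropy F - \<delta>) \<le> ?rate i) sequentially"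
    proof eventually_elim
      case (elim i)
      let ?n = "real (card (V i))"
      have n: "?n > 0" using card_V_pos[of i] by simp
      have sub: "?S i \<subseteq> patterns (V i)" by (auto simp: good_models_def)
      have ne: "?S i \<noteq> {}" using elim(2) by auto
      have fin: "finite (?S i)"
        by (rule finite_subset[OF sub]) (rule finite_patterns[OF model.finite_V])
      have "model.entropy_on i (V i) / ?n \<le> (ln 2 + ln (card (?S i)) + ?p i * (?n * ln CARD('a))) / ?n"
        using model.entropy_le_ln_card[OF sub ne] by (rule divide_right_mono) simp
      also have "\<dots> = ln (card (?S i)) / ?n + (ln 2 / ?n + ?p i * ln CARD('a))"
        using n by (simp add: add_divide_distrib)
      finally have "mean_window_entropy F - \<delta> \<le> ln (card (?S i)) / ?n"
        using elim(1,3) by linarith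
      then show ?case using fin ne n by (simp add: ln_card_def)
    qed
  qed simp
  show "ereal (mean_window_entropy F) \<le> limsup ?rate"
  proof (rule ereal_le_epsilon2)
    fix \<delta> :: real assume "\<delta> > 0"
    from rate[OF this] have "ereal (mean_window_entropy F) - ereal \<delta> \<le> limsup ?rate"
      by (simp only: ereal_minus)
    then show "ereal (mean_window_entropy F) \<le> limsup ?rate + ereal \<delta>"
      by (rule ereal_minus_le[THEN iffD1, rotated]) simp
  qed
qed

lemma window_entropy_nonneg: "finite \<Lambda> \<Longrightarrow> 0 \<le> window_entropy \<Lambda>"
  unfolding window_entropy_def by (intro integral_nonneg_AE always_eventually allI origin_entropy_nonneg)

definition box :: "nat \<Rightarrow> 'g set" where
  "box n = insert 0 {g. to_nat g \<le> n}"

lemma zero_in_box: "0 \<in> box n"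
  by (simp add: box_def)

lemma finite_box: "finite (box n)"
proof -
  have "{g :: 'g. to_nat g \<le> n} = to_nat -` {..n}" by auto
  moreover have "finite (to_nat -` {..n} :: 'g set)" by (rule finite_vimageI[OF finite_atMost inj_to_nat])
  ultimately show ?thesis by (simp only: box_def finite_insert)
qed

text \<open>The saturated conditional entropy is at most the limit of the window entropies: otherwise a
  subsequence of boxes would contradict the bound along its own convergent subsequence.\<close>

lemma cond_entropy_saturation_le_window:
  assumes "0 \<notin> L" "\<delta> > 0"
  shows "eventually (\<lambda>n. cond_partition_entropy \<mu> alphabet_partition (saturation \<mu> (coordinate_algebra L)) - \<delta>
    < window_entropy (box n - L)) sequentially" (is "eventually (\<lambda>n. ?\<Psi> - \<delta> < ?h n) sequentially")
proof (rule ccontr)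
  assume "\<not> eventually (\<lambda>n. ?\<Psi> - \<delta> < ?h n) sequentially"
  then obtain r :: "nat \<Rightarrow> nat" where r: "strict_mono r" "\<And>n. \<not> ?\<Psi> - \<delta> < ?h (r n)"
    using not_eventually_sequentiallyD by blast
  interpret exhausted_past \<phi> D \<mu> L "\<lambda>n. box (r n) - L"
  proof unfold_locales
    show "gibbs_measure \<phi> D \<mu>" by (rule gibbs)
    show "finite (box (r n) - L)" for n by (simp add: finite_box)
    show "0 \<in> box (r n) - L" for n using assms(1) by (simp add: zero_in_box)
    show "incseq (\<lambda>n. box (r n) - L)"
      using strict_mono_mono[OF r(1)] by (auto simp: incseq_def mono_def box_def) (meson order_trans)
    fix F :: "'g set" assume "finite F"
    then obtain n where n: "\<And>g. g \<in> F \<Longrightarrow> to_nat g \<le> n"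
      using finite_nat_set_iff_bounded_le[of "to_nat ` F"] by auto
    have "F \<subseteq> box (r n)" using n seq_suble[OF r(1), of n] by (auto simp: box_def) (meson order_trans)
    then show "\<exists>n. F - L \<subseteq> box (r n) - L" by blast
  qed
  obtain k c where "(\<lambda>j. \<integral>x. origin_entropy (box (r (k j)) - L) x \<partial>\<mu>) \<longlonglongrightarrow> c" "?\<Psi> \<le> c"
    by (rule cond_entropy_saturation_le_limit)
  then have "(\<lambda>j. ?h (r (k j))) \<longlonglongrightarrow> c" by (simp add: window_entropy_def)
  then have "c \<le> ?\<Psi> - \<delta>"
    by (rule LIMSEQ_le_const2) (use r(2) not_less in blast)
  with \<open>?\<Psi> \<le> c\<close> assms(2) show False by simp
qed

text \<open>Truncating the window entropies at the saturated entropy gives convergence to it, dominated by its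
  absolute value.  If the saturated entropy is not an integrable function of the order, its integral is
  \<open>0\<close> by convention, and the nonnegativity of the window entropies suffices.\<close>

lemma sofic_entropy_ge_saturated:
  assumes l: "weak_star_metric l"
  shows "ereal (\<integral>\<omega>. cond_partition_entropy \<mu> alphabet_partition
      (saturation \<mu> (coordinate_algebra {g. \<xi> g \<omega> < \<xi> 0 \<omega>})) \<partial>P) \<le> sofic_entropy l V \<sigma> \<mu>"
proof -
  define L where "L \<omega> = {g. \<xi> g \<omega> < \<xi> 0 \<omega>}" for \<omega>
  define \<Psi> where "\<Psi> \<omega> = cond_partition_entropy \<mu> alphabet_partition (saturation \<mu> (coordinate_algebra (L \<omega>)))" for \<omega>
  define h where "h n \<omega> = window_entropy (box n - past (box n) \<omega>)" for n \<omega>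
  have h_eq: "h n \<omega> = window_entropy (box n - L \<omega>)" for n \<omega>
    unfolding h_def by (rule arg_cong[of _ _ window_entropy]) (auto simp: past_def precursors_def L_def)
  have h_nonneg: "0 \<le> h n \<omega>" for n \<omega> by (simp add: h_def window_entropy_nonneg finite_box)
  have h_int: "integrable P (h n)" for n
    unfolding h_def by (rule integrable_past[where G = "\<lambda>S. window_entropy (box n - S)"]) (auto simp: finite_box zero_in_box)
  have h_le: "ereal (\<integral>\<omega>. h n \<omega> \<partial>P) \<le> sofic_entropy l V \<sigma> \<mu>" for n
    using sofic_entropy_ge_window[OF l finite_box, of n] by (simp add: h_def mean_window_entropy_def zero_in_box)
  have "ereal (\<integral>\<omega>. \<Psi> \<omega> \<partial>P) \<le> sofic_entropy l V \<sigma> \<mu>"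
  proof (cases "integrable P \<Psi>")
    case False
    then have "(\<integral>\<omega>. \<Psi> \<omega> \<partial>P) = 0" by (rule not_integrable_integral_eq)
    also have "0 \<le> (\<integral>\<omega>. h 0 \<omega> \<partial>P)" using h_nonneg by simp
    finally show ?thesis using h_le[of 0] by (metis ereal_less_eq(3) order_trans)
  next
    case True
    have lim: "(\<lambda>n. min (h n \<omega>) (\<Psi> \<omega>)) \<longlonglongrightarrow> \<Psi> \<omega>" for \<omega>
    proof (rule order_tendstoI)
      fix y assume "y < \<Psi> \<omega>"
      then have "eventually (\<lambda>n. \<Psi> \<omega> - (\<Psi> \<omega> - y) < h n \<omega>) sequentially"
        unfolding \<Psi>_def h_eq by (intro cond_entropy_saturation_le_window) (auto simp: L_def)
      then show "eventually (\<lambda>n. y < min (h n \<omega>) (\<Psi> \<omega>)) sequentially"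
        by eventually_elim (use \<open>y < \<Psi> \<omega>\<close> in auto)
    qed (auto intro!: always_eventually)
    have "(\<lambda>n. \<integral>\<omega>. min (h n \<omega>) (\<Psi> \<omega>) \<partial>P) \<longlonglongrightarrow> (\<integral>\<omega>. \<Psi> \<omega> \<partial>P)"
    proof (rule integral_dominated_convergence[where w = "\<lambda>\<omega>. \<bar>\<Psi> \<omega>\<bar>"])
      show "AE \<omega> in P. norm (min (h n \<omega>) (\<Psi> \<omega>)) \<le> \<bar>\<Psi> \<omega>\<bar>" for n
        using h_nonneg[of n] by (intro always_eventually allI) (simp add: min_def abs_le_iff, smt (verit))
    qed (use True h_int lim in auto)
    then have lim_int: "(\<lambda>n. ereal (\<integral>\<omega>. min (h n \<omega>) (\<Psi> \<omega>) \<partial>P)) \<longlonglongrightarrow> ereal (\<integral>\<omega>. \<Psi> \<omega> \<partial>P)" by simp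
    have "ereal (\<integral>\<omega>. min (h n \<omega>) (\<Psi> \<omega>) \<partial>P) \<le> sofic_entropy l V \<sigma> \<mu>" for n
    proof -
      have "(\<integral>\<omega>. min (h n \<omega>) (\<Psi> \<omega>) \<partial>P) \<le> (\<integral>\<omega>. h n \<omega> \<partial>P)"
        using True h_int by (intro integral_mono) auto
      then show ?thesis using h_le[of n] by (metis ereal_less_eq(3) order_trans)
    qed
    then show ?thesis by (intro LIMSEQ_le_const2[OF lim_int]) blast
  qed
  then show ?thesis by (simp add: \<Psi>_def L_def)
qed

end

theorem theorem1p3:
  fixes \<phi> :: "('g::{countable,group_add} \<Rightarrow> 'a::{finite,discrete_topology}) \<Rightarrow> real"
    and D :: "'g set"
    and \<mu> :: "('g \<Rightarrow> 'a) measure"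
    and V :: "nat \<Rightarrow> 'v set"
    and \<sigma> :: "nat \<Rightarrow> 'g \<Rightarrow> 'v \<Rightarrow> 'v"
    and l :: "('g \<Rightarrow> 'a) measure \<Rightarrow> ('g \<Rightarrow> 'a) measure \<Rightarrow> real"
    and P :: "'w measure"
    and \<xi> :: "'g \<Rightarrow> 'w \<Rightarrow> real"
  assumes "infinite (UNIV :: 'g set)"
    and "CARD('a) \<ge> 2"
    and "sofic_approximation V \<sigma>"
    and "potential_with_window \<phi> D"
    and "gibbs_measure \<phi> D \<mu>"
    and "\<And>\<nu>. gibbs_measure \<phi> D \<nu> \<Longrightarrow> \<nu> = \<mu>"
    and "weak_star_metric l"
    and "prob_space P"
    and "prob_space.indep_vars P (\<lambda>_. borel) \<xi> UNIV"
    and "\<And>g. distr P borel (\<xi> g) = uniform_measure lborel {0..1}"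
  shows "sofic_entropy l V \<sigma> \<mu> \<ge>
    ereal (\<integral>\<omega>. cond_partition_entropy \<mu> alphabet_partition
                  (saturation \<mu> (coordinate_algebra {g. \<xi> g \<omega> < \<xi> 0 \<omega>})) \<partial>P)"
proof -
  interpret P: prob_space P by fact
  interpret ordered_sofic_gibbs \<phi> D \<mu> V \<sigma> P \<xi>
    by unfold_locales (fact assms)+
  show ?thesis by (rule sofic_entropy_ge_saturated) fact
qed

end
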